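(* Let $A$ be an artin algebra and $n\ge 2$. Let $X$ be an indecomposable complex in $\mathbf{C}_n(\mathrm{proj}\,A)$ and let $f:X\to\overleftarrow{X}$ be an irreducible morphism in $\mathbf{C}_{[0,n]}(\mathrm{proj}\,A)$, where $\overleftarrow{X}$ is a left enlargement of $X$. Assume that $\overleftarrow{X}$ is a complex of the form $$Z^{0}\xrightarrow{\begin{pmatrix}\widetilde d_X^{0}\\ \widetilde d_Z^{0}\end{pmatrix}} X^1\oplus Z^1\xrightarrow{\begin{pmatrix} d_X^1&0\\0&d_Z^1\end{pmatrix}}X^2\oplus Z^2\xrightarrow{\begin{pmatrix} d_X^2&0\\0&d_Z^2\end{pmatrix}}\cdots\xrightarrow{\begin{pmatrix} d_X^{n-1}&0\\0&d_Z^{n-1}\end{pmatrix}}X^n\oplus Z^n .$$ Then $Z^0$ is a direct summand of the projective cover of $\mathrm{soc}(\mathrm{Ker}\,d_X^1)$.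
   Context: $A$ is an artin algebra and $\mathrm{proj}\,A$ is the category of finitely generated projective $A$-modules. For integers $m<n$, $\mathbf{C}_{[m,n]}(\mathrm{proj}\,A)$ is the full subcategory of the category of bounded complexes (differentials raising degree by one) of finitely generated $A$-modules whose objects are the complexes $X=(X^i,d^i)$ with $X^i\in\mathrm{proj}\,A$ and $X^i=0$ for $i\notin\{m,\dots,n\}$; $\mathbf{C}_n(\mathrm{proj}\,A)=\mathbf{C}_{[1,n]}(\mathrm{proj}\,A)$ for $n\ge2$, regarded as a full subcategory of $\mathbf{C}_{[0,n]}(\mathrm{proj}\,A)$ by setting $X^0=0$. The differential of $X$ is written $d_X^i:X^i\to X^{i+1}$. For $Z\in\mathbf{C}_{[0,n]}(\mathrm{proj}\,A)$, $F(Z)$ denotes the hard truncation $Z^1\to\cdots\to Z^n$ in $\mathbf{C}_n(\mathrm{proj}\,A)$. A left enlargement of an indecomposable complex $X\in\mathbf{C}_n(\mathrm{proj}\,A)$ is an indecomposable complex $Z\in\mathbf{C}_{[0,n]}(\mathrm{proj}\,A)$ such that $Z^0\neq0$ and $X$ is a direct summand of $F(Z)$ in $\mathbf{C}_n(\mathrm{proj}\,A)$; it is denoted $\overleftarrow{X}$. A morphism $f$ in a category is irreducible if it is neither a section (split monomorphism) nor a retraction (split epimorphism), and whenever $f=hg$, either $g$ is a section or $h$ is a retraction. *)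

theory Defs
  imports "HOL-Algebra.Module" "HOL-Algebra.RingHom" "HOL-Library.Equipollence"
begin

section \<open>Modules over a possibly noncommutative ring\<close>

text \<open>
  The library locale \<open>module\<close> requires a commutative base ring. We keep the library's module
  record and its \<open>submodule\<close> and only drop commutativity. The fields \<open>mult\<close> and \<open>one\<close> of the
  record play no role for modules.
\<close>

locale left_module = A?: ring A + M?: abelian_group M
  for A :: "('a, 'r) ring_scheme" (structure) and M :: "('a, 'm) module" (structure) +
  assumes smult_closed:
      "\<lbrakk>a \<in> carrier A; x \<in> carrier M\<rbrakk> \<Longrightarrow> a \<odot>\<^bsub>M\<^esub> x \<in> carrier M"
    and smult_l_distr:
      "\<lbrakk>a \<in> carrier A; b \<in> carrier A; x \<in> carrier M\<rbrakk>
        \<Longrightarrow> (a \<oplus>\<^bsub>A\<^esub> b) \<odot>\<^bsub>M\<^esub> x = (a \<odot>\<^bsub>M\<^esub> x) \<oplus>\<^bsub>M\<^esub> (b \<odot>\<^bsub>M\<^esub> x)"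
    and smult_r_distr:
      "\<lbrakk>a \<in> carrier A; x \<in> carrier M; y \<in> carrier M\<rbrakk>
        \<Longrightarrow> a \<odot>\<^bsub>M\<^esub> (x \<oplus>\<^bsub>M\<^esub> y) = (a \<odot>\<^bsub>M\<^esub> x) \<oplus>\<^bsub>M\<^esub> (a \<odot>\<^bsub>M\<^esub> y)"
    and smult_assoc:
      "\<lbrakk>a \<in> carrier A; b \<in> carrier A; x \<in> carrier M\<rbrakk>
        \<Longrightarrow> (a \<otimes>\<^bsub>A\<^esub> b) \<odot>\<^bsub>M\<^esub> x = a \<odot>\<^bsub>M\<^esub> (b \<odot>\<^bsub>M\<^esub> x)"
    and smult_one: "x \<in> carrier M \<Longrightarrow> \<one>\<^bsub>A\<^esub> \<odot>\<^bsub>M\<^esub> x = x"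

definition mod_hom ::
  "('a, 'r) ring_scheme \<Rightarrow> ('a, 'm) module \<Rightarrow> ('a, 'q) module \<Rightarrow> ('m \<Rightarrow> 'q) set" where
  "mod_hom A M N = {h. h \<in> carrier M \<rightarrow> carrier N
     \<and> (\<forall>x \<in> carrier M. \<forall>y \<in> carrier M. h (x \<oplus>\<^bsub>M\<^esub> y) = h x \<oplus>\<^bsub>N\<^esub> h y)
     \<and> (\<forall>a \<in> carrier A. \<forall>x \<in> carrier M. h (a \<odot>\<^bsub>M\<^esub> x) = a \<odot>\<^bsub>N\<^esub> h x)}"

definition mod_isomorphic ::
  "('a, 'r) ring_scheme \<Rightarrow> ('a, 'm) module \<Rightarrow> ('a, 'q) module \<Rightarrow> bool" where
  "mod_isomorphic A M N \<longleftrightarrow> (\<exists>h \<in> mod_hom A M N. bij_betw h (carrier M) (carrier N))"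

definition zero_mod :: "('a, 'm) module \<Rightarrow> bool" where
  "zero_mod M \<longleftrightarrow> carrier M = {\<zero>\<^bsub>M\<^esub>}"

definition mod_sum :: "('a, 'm) module \<Rightarrow> ('a, 'q) module \<Rightarrow> ('a, 'm \<times> 'q) module" where
  "mod_sum M N =
     \<lparr>carrier = carrier M \<times> carrier N,
      mult = (\<lambda>(x, y) (x', y'). (x \<otimes>\<^bsub>M\<^esub> x', y \<otimes>\<^bsub>N\<^esub> y')),
      one = (\<one>\<^bsub>M\<^esub>, \<one>\<^bsub>N\<^esub>),
      zero = (\<zero>\<^bsub>M\<^esub>, \<zero>\<^bsub>N\<^esub>),
      add = (\<lambda>(x, y) (x', y'). (x \<oplus>\<^bsub>M\<^esub> x', y \<oplus>\<^bsub>N\<^esub> y')),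
      smult = (\<lambda>a (x, y). (a \<odot>\<^bsub>M\<^esub> x, a \<odot>\<^bsub>N\<^esub> y))\<rparr>"

definition mod_summand ::
  "('a, 'r) ring_scheme \<Rightarrow> ('a, 'm) module \<Rightarrow> ('a, 'm) module \<Rightarrow> bool" where
  "mod_summand A M P \<longleftrightarrow>
     (\<exists>N :: ('a, 'm) module. left_module A N \<and> mod_isomorphic A P (mod_sum M N))"

definition mod_span :: "('a, 'r) ring_scheme \<Rightarrow> ('a, 'm) module \<Rightarrow> 'm set \<Rightarrow> 'm set" where
  "mod_span A M S = \<Inter>{H. submodule H A M \<and> S \<subseteq> H}"

definition fin_gen :: "('a, 'r) ring_scheme \<Rightarrow> ('a, 'm) module \<Rightarrow> bool" where
  "fin_gen A M \<longleftrightarrow> (\<exists>S. finite S \<and> S \<subseteq> carrier M \<and> mod_span A M S = carrier M)"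

text \<open>
  The type \<open>'m\<close> is the universe in which the underlying sets of modules live: the lifting
  property below tests modules over \<open>'m\<close> only. It has its usual meaning as soon as \<open>'m\<close> is
  infinite and at least as large as \<open>A\<close>; see \<open>universe_for\<close> below.
\<close>

definition projective :: "('a, 'r) ring_scheme \<Rightarrow> ('a, 'm) module \<Rightarrow> bool" where
  "projective A P \<longleftrightarrow> left_module A P \<and>
     (\<forall>(M :: ('a, 'm) module) (N :: ('a, 'm) module) p h.
        left_module A M \<and> left_module A N \<and> p \<in> mod_hom A M N \<and> p ` carrier M = carrier N
          \<and> h \<in> mod_hom A P N
        \<longrightarrow> (\<exists>l \<in> mod_hom A P M. \<forall>x \<in> carrier P. p (l x) = h x))"

definition proj :: "('a, 'r) ring_scheme \<Rightarrow> ('a, 'm) module set" where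
  "proj A = {P. projective A P \<and> fin_gen A P}"

text \<open>
  Every finitely generated \<open>A\<close>-module is a quotient of some \<open>A\<^sup>k\<close>, so under this condition
  it has an isomorphic copy whose underlying set is a subset of \<open>'m\<close>.
\<close>

definition universe_for :: "'m itself \<Rightarrow> ('a, 'r) ring_scheme \<Rightarrow> bool" where
  "universe_for TYPE('m) A \<longleftrightarrow> lists (carrier A) \<lesssim> (UNIV :: 'm set)"

definition mod_kernel :: "('a, 'm) module \<Rightarrow> ('a, 'q) module \<Rightarrow> ('m \<Rightarrow> 'q) \<Rightarrow> 'm set" where
  "mod_kernel M N h = {x \<in> carrier M. h x = \<zero>\<^bsub>N\<^esub>}"

definition simple_submodule ::
  "('a, 'r) ring_scheme \<Rightarrow> ('a, 'm) module \<Rightarrow> 'm set \<Rightarrow> bool" where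
  "simple_submodule A M S \<longleftrightarrow> submodule S A M \<and> S \<noteq> {\<zero>\<^bsub>M\<^esub>}
     \<and> (\<forall>H. submodule H A M \<and> H \<subseteq> S \<longrightarrow> H = {\<zero>\<^bsub>M\<^esub>} \<or> H = S)"

definition soc :: "('a, 'r) ring_scheme \<Rightarrow> ('a, 'm) module \<Rightarrow> 'm set" where
  "soc A M = mod_span A M (\<Union>{S. simple_submodule A M S})"

definition projective_cover ::
  "('a, 'r) ring_scheme \<Rightarrow> ('a, 'm) module \<Rightarrow> ('m \<Rightarrow> 'm) \<Rightarrow> ('a, 'm) module \<Rightarrow> bool" where
  "projective_cover A P p M \<longleftrightarrow>
     projective A P \<and> p \<in> mod_hom A P M \<and> p ` carrier P = carrier M
     \<and> (\<forall>H. submodule H A P \<and> H <+>\<^bsub>P\<^esub> mod_kernel P M p = carrier P \<longrightarrow> H = carrier P)"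

section \<open>Artin algebras\<close>

definition artinian_cring :: "('k, 's) ring_scheme \<Rightarrow> bool" where
  "artinian_cring K \<longleftrightarrow> cring K \<and>
     (\<forall>I :: nat \<Rightarrow> 'k set. (\<forall>i. ideal (I i) K \<and> I (Suc i) \<subseteq> I i)
        \<longrightarrow> (\<exists>N. \<forall>i\<ge>N. I i = I N))"

definition base_module ::
  "('a, 'r) ring_scheme \<Rightarrow> ('k \<Rightarrow> 'a) \<Rightarrow> ('k, 'a) module" where
  "base_module A \<phi> =
     \<lparr>carrier = carrier A, mult = mult A, one = one A, zero = zero A, add = add A,
      smult = (\<lambda>c x. \<phi> c \<otimes>\<^bsub>A\<^esub> x)\<rparr>"

definition artin_algebra ::
  "('k, 's) ring_scheme \<Rightarrow> ('a, 'r) ring_scheme \<Rightarrow> ('k \<Rightarrow> 'a) \<Rightarrow> bool" where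
  "artin_algebra K A \<phi> \<longleftrightarrow> artinian_cring K \<and> ring A \<and> \<phi> \<in> ring_hom K A
     \<and> (\<forall>c \<in> carrier K. \<forall>x \<in> carrier A. \<phi> c \<otimes>\<^bsub>A\<^esub> x = x \<otimes>\<^bsub>A\<^esub> \<phi> c)
     \<and> fin_gen K (base_module A \<phi>)"

section \<open>Complexes of finitely generated projective modules\<close>

record ('a, 'm) cpx =
  Obj :: "int \<Rightarrow> ('a, 'm) module"
  Diff :: "int \<Rightarrow> 'm \<Rightarrow> 'm"

definition cpx_proj ::
  "('a, 'r) ring_scheme \<Rightarrow> int \<Rightarrow> int \<Rightarrow> ('a, 'm) cpx set" where
  "cpx_proj A m n = {X.
     (\<forall>i. Obj X i \<in> proj A)
     \<and> (\<forall>i. i \<notin> {m..n} \<longrightarrow> zero_mod (Obj X i))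
     \<and> (\<forall>i. Diff X i \<in> mod_hom A (Obj X i) (Obj X (i + 1)))
     \<and> (\<forall>i. \<forall>x \<in> carrier (Obj X i). Diff X (i + 1) (Diff X i x) = \<zero>\<^bsub>Obj X (i + 2)\<^esub>)}"

definition cpx_hom ::
  "('a, 'r) ring_scheme \<Rightarrow> ('a, 'm) cpx \<Rightarrow> ('a, 'q) cpx \<Rightarrow> (int \<Rightarrow> 'm \<Rightarrow> 'q) set" where
  "cpx_hom A X Y = {f.
     (\<forall>i. f i \<in> mod_hom A (Obj X i) (Obj Y i))
     \<and> (\<forall>i. \<forall>x \<in> carrier (Obj X i). f (i + 1) (Diff X i x) = Diff Y i (f i x))}"

text \<open>Morphisms are compared on carriers only, their values elsewhere being irrelevant.\<close>

definition cpx_eq :: "('a, 'm) cpx \<Rightarrow> (int \<Rightarrow> 'm \<Rightarrow> 'q) \<Rightarrow> (int \<Rightarrow> 'm \<Rightarrow> 'q) \<Rightarrow> bool" where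
  "cpx_eq X f g \<longleftrightarrow> (\<forall>i. \<forall>x \<in> carrier (Obj X i). f i x = g i x)"

definition cpx_comp ::
  "(int \<Rightarrow> 'q \<Rightarrow> 'p) \<Rightarrow> (int \<Rightarrow> 'm \<Rightarrow> 'q) \<Rightarrow> int \<Rightarrow> 'm \<Rightarrow> 'p" where
  "cpx_comp h g = (\<lambda>i. h i \<circ> g i)"

definition cpx_isomorphic ::
  "('a, 'r) ring_scheme \<Rightarrow> ('a, 'm) cpx \<Rightarrow> ('a, 'q) cpx \<Rightarrow> bool" where
  "cpx_isomorphic A X Y \<longleftrightarrow> (\<exists>f \<in> cpx_hom A X Y. \<exists>g \<in> cpx_hom A Y X.
     cpx_eq X (cpx_comp g f) (\<lambda>_. id) \<and> cpx_eq Y (cpx_comp f g) (\<lambda>_. id))"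

definition zero_cpx :: "('a, 'm) cpx \<Rightarrow> bool" where
  "zero_cpx X \<longleftrightarrow> (\<forall>i. zero_mod (Obj X i))"

definition cpx_sum :: "('a, 'm) cpx \<Rightarrow> ('a, 'q) cpx \<Rightarrow> ('a, 'm \<times> 'q) cpx" where
  "cpx_sum X Y =
     \<lparr>Obj = (\<lambda>i. mod_sum (Obj X i) (Obj Y i)),
      Diff = (\<lambda>i (x, y). (Diff X i x, Diff Y i y))\<rparr>"

definition cpx_summand ::
  "('a, 'r) ring_scheme \<Rightarrow> int \<Rightarrow> int \<Rightarrow> ('a, 'm) cpx \<Rightarrow> ('a, 'm) cpx \<Rightarrow> bool" where
  "cpx_summand A m n X W \<longleftrightarrow>
     (\<exists>Y :: ('a, 'm) cpx. Y \<in> cpx_proj A m n \<and> cpx_isomorphic A W (cpx_sum X Y))"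

definition cpx_indecomposable ::
  "('a, 'r) ring_scheme \<Rightarrow> int \<Rightarrow> int \<Rightarrow> ('a, 'm) cpx \<Rightarrow> bool" where
  "cpx_indecomposable A m n X \<longleftrightarrow> X \<in> cpx_proj A m n \<and> \<not> zero_cpx X
     \<and> (\<forall>(Y :: ('a, 'm) cpx) (Z :: ('a, 'm) cpx).
          Y \<in> cpx_proj A m n \<and> Z \<in> cpx_proj A m n \<and> cpx_isomorphic A X (cpx_sum Y Z)
          \<longrightarrow> zero_cpx Y \<or> zero_cpx Z)"

definition cpx_section ::
  "('a, 'r) ring_scheme \<Rightarrow> ('a, 'm) cpx \<Rightarrow> ('a, 'm) cpx \<Rightarrow> (int \<Rightarrow> 'm \<Rightarrow> 'm) \<Rightarrow> bool" where
  "cpx_section A X Y f \<longleftrightarrow> f \<in> cpx_hom A X Y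
     \<and> (\<exists>r \<in> cpx_hom A Y X. cpx_eq X (cpx_comp r f) (\<lambda>_. id))"

definition cpx_retraction ::
  "('a, 'r) ring_scheme \<Rightarrow> ('a, 'm) cpx \<Rightarrow> ('a, 'm) cpx \<Rightarrow> (int \<Rightarrow> 'm \<Rightarrow> 'm) \<Rightarrow> bool" where
  "cpx_retraction A X Y f \<longleftrightarrow> f \<in> cpx_hom A X Y
     \<and> (\<exists>s \<in> cpx_hom A Y X. cpx_eq Y (cpx_comp f s) (\<lambda>_. id))"

definition cpx_irreducible ::
  "('a, 'r) ring_scheme \<Rightarrow> int \<Rightarrow> int \<Rightarrow> ('a, 'm) cpx \<Rightarrow> ('a, 'm) cpx
     \<Rightarrow> (int \<Rightarrow> 'm \<Rightarrow> 'm) \<Rightarrow> bool" where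
  "cpx_irreducible A m n X Y f \<longleftrightarrow>
     X \<in> cpx_proj A m n \<and> Y \<in> cpx_proj A m n \<and> f \<in> cpx_hom A X Y
     \<and> \<not> cpx_section A X Y f \<and> \<not> cpx_retraction A X Y f
     \<and> (\<forall>(V :: ('a, 'm) cpx) g h.
          V \<in> cpx_proj A m n \<and> g \<in> cpx_hom A X V \<and> h \<in> cpx_hom A V Y
            \<and> cpx_eq X f (cpx_comp h g)
          \<longrightarrow> cpx_section A X V g \<or> cpx_retraction A V Y h)"

section \<open>Left enlargements\<close>

text \<open>
  The hard truncation \<open>F\<close>. A complex concentrated in degrees \<open>1,\<dots>,n\<close> is literally also one
  concentrated in degrees \<open>0,\<dots>,n\<close>, so no separate embedding is needed.
\<close>

definition hard_trunc :: "('a, 'm) cpx \<Rightarrow> ('a, 'm) cpx" where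
  "hard_trunc Z =
     \<lparr>Obj = (\<lambda>i. if 1 \<le> i then Obj Z i else (Obj Z i)\<lparr>carrier := {\<zero>\<^bsub>Obj Z i\<^esub>}\<rparr>),
      Diff = (\<lambda>i. if 1 \<le> i then Diff Z i else (\<lambda>_. \<zero>\<^bsub>Obj Z (i + 1)\<^esub>))\<rparr>"

definition left_enlargement ::
  "('a, 'r) ring_scheme \<Rightarrow> int \<Rightarrow> ('a, 'm) cpx \<Rightarrow> ('a, 'm) cpx \<Rightarrow> bool" where
  "left_enlargement A n X W \<longleftrightarrow>
     W \<in> cpx_proj A 0 n \<and> cpx_indecomposable A 0 n W \<and> \<not> zero_mod (Obj W 0)
     \<and> cpx_summand A 1 n X (hard_trunc W)"

text \<open>
  For \<open>X\<close> concentrated in degrees \<open>1,\<dots>,n\<close>, a complex \<open>Z\<close> concentrated in degrees \<open>0,\<dots>,n\<close>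
  and \<open>a : Z\<^sup>0 \<rightarrow> X\<^sup>1\<close>, this is
  \<open>Z\<^sup>0 \<rightarrow> X\<^sup>1 \<oplus> Z\<^sup>1 \<rightarrow> \<dots> \<rightarrow> X\<^sup>n \<oplus> Z\<^sup>n\<close>, whose first differential has the components \<open>a\<close> and
  \<open>Diff Z 0\<close> and whose other differentials are diagonal. In degree \<open>0\<close> the module \<open>Z\<^sup>0\<close> appears
  as \<open>X\<^sup>0 \<oplus> Z\<^sup>0\<close> with \<open>X\<^sup>0 = 0\<close>.
\<close>

definition block_cpx ::
  "('a, 'm) cpx \<Rightarrow> ('a, 'm) cpx \<Rightarrow> ('m \<Rightarrow> 'm) \<Rightarrow> ('a, 'm \<times> 'm) cpx" where
  "block_cpx X Z a =
     \<lparr>Obj = (\<lambda>i. mod_sum (Obj X i) (Obj Z i)),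
      Diff = (\<lambda>i (x, z). (if i = 0 then a z else Diff X i x, Diff Z i z))\<rparr>"

end

(*
  A morphism f : X -> W factors through any complex obtained from W by replacing W^0 with a
  projective module mapping onto a proper submodule M of W^0. The second factor is no retraction,
  so irreducibility gives maps r^i : W^i -> X^i (i >= 1) splitting f such that r^1 d^0 vanishes on M;
  it does not vanish on W^0, as f is no section. For M maximal, r^1 d^0 thus identifies W^0/M with
  a simple submodule of V = soc(Ker d_X^1), and all these maps W^0 -> V lie in one coset, not
  containing 0, of a submodule of Hom(W^0, V) over the base ring K. A linear functional that is
  nonzero on this coset and the resulting duality between homomorphisms into and out of each simple
  submodule of V show that W^0/rad W^0 embeds into V, hence is a quotient of V. So a projective
  module mapping onto V also maps onto W^0 = Z^0.
*)

theory Submission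
  imports Defs
begin

subsection \<open>Submodules\<close>

text \<open>That each maximal submodule of \<open>W^0\<close> is killed by a nonzero map into V
  shows only that every simple quotient of \<open>W^0\<close> occurs in V. The obstacle is
  multiplicity, because the maps for different submodules are chosen independently. The coset
  settles it. In the model case of matrices over a field, a functional on Hom(T^m, T^k) has the form
  a |-> tr(ba) with b : T^k -> T^m. If k < m, some maximal submodule contains the image of b, every
  a that kills it has ab = 0, and tr(ba) = tr(ab) = 0, although the functional is nonzero on the
  coset. Since K is only an artinian ring, a substitute for the kernel of the functional is used: a
  submodule \<open>B\<close> maximal among those that contain the direction of the coset and miss
  one of its members. Maps into a simple module S are proportional modulo \<open>B\<close>, as a
  scalar that does not kill S acts on it invertibly. No matrices or multiplicities appear: the
  embedding is built by enlarging a submodule N of V by one simple summand at a time and correcting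
  one map l : W^0 -> N.\<close>

context left_module
begin

declare smult_closed [simp, intro]

lemma smult_zero_left [simp]:
  assumes "x \<in> carrier M"
  shows "\<zero>\<^bsub>A\<^esub> \<odot>\<^bsub>M\<^esub> x = \<zero>\<^bsub>M\<^esub>"
proof -
  have "\<zero>\<^bsub>A\<^esub> \<odot>\<^bsub>M\<^esub> x \<oplus>\<^bsub>M\<^esub> \<zero>\<^bsub>A\<^esub> \<odot>\<^bsub>M\<^esub> x = \<zero>\<^bsub>A\<^esub> \<odot>\<^bsub>M\<^esub> x"
    using smult_l_distr[of "\<zero>\<^bsub>A\<^esub>" "\<zero>\<^bsub>A\<^esub>" x] assms by simp
  then show ?thesis using assms by (simp add: M.add.r_cancel_one')
qed

lemma smult_zero_right [simp]:
  assumes "a \<in> carrier A"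
  shows "a \<odot>\<^bsub>M\<^esub> \<zero>\<^bsub>M\<^esub> = \<zero>\<^bsub>M\<^esub>"
proof -
  have "a \<odot>\<^bsub>M\<^esub> \<zero>\<^bsub>M\<^esub> \<oplus>\<^bsub>M\<^esub> a \<odot>\<^bsub>M\<^esub> \<zero>\<^bsub>M\<^esub> = a \<odot>\<^bsub>M\<^esub> \<zero>\<^bsub>M\<^esub>"
    using smult_r_distr[of a "\<zero>\<^bsub>M\<^esub>" "\<zero>\<^bsub>M\<^esub>"] assms by simp
  then show ?thesis using assms by (simp add: M.add.r_cancel_one')
qed

lemma smult_minus_left:
  assumes "a \<in> carrier A" "x \<in> carrier M"
  shows "(\<ominus>\<^bsub>A\<^esub> a) \<odot>\<^bsub>M\<^esub> x = \<ominus>\<^bsub>M\<^esub> (a \<odot>\<^bsub>M\<^esub> x)"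
proof -
  have "(\<ominus>\<^bsub>A\<^esub> a) \<odot>\<^bsub>M\<^esub> x \<oplus>\<^bsub>M\<^esub> a \<odot>\<^bsub>M\<^esub> x = \<zero>\<^bsub>M\<^esub>"
    using smult_l_distr[of "\<ominus>\<^bsub>A\<^esub> a" a x] assms by (simp add: A.l_neg)
  then show ?thesis using assms by (metis A.a_inv_closed M.minus_equality smult_closed)
qed

lemma smult_minus_right:
  assumes "a \<in> carrier A" "x \<in> carrier M"
  shows "a \<odot>\<^bsub>M\<^esub> (\<ominus>\<^bsub>M\<^esub> x) = \<ominus>\<^bsub>M\<^esub> (a \<odot>\<^bsub>M\<^esub> x)"
proof -
  have "a \<odot>\<^bsub>M\<^esub> (\<ominus>\<^bsub>M\<^esub> x) \<oplus>\<^bsub>M\<^esub> a \<odot>\<^bsub>M\<^esub> x = \<zero>\<^bsub>M\<^esub>"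
    using smult_r_distr[of a "\<ominus>\<^bsub>M\<^esub> x" x] assms by (simp add: M.l_neg)
  then show ?thesis using assms by (metis M.a_inv_closed M.minus_equality smult_closed)
qed

lemma uminus_eq_smult: "x \<in> carrier M \<Longrightarrow> \<ominus>\<^bsub>M\<^esub> x = (\<ominus>\<^bsub>A\<^esub> \<one>\<^bsub>A\<^esub>) \<odot>\<^bsub>M\<^esub> x"
  by (simp add: smult_minus_left smult_one)

lemma minus_eq_zero_iff:
  "\<lbrakk>x \<in> carrier M; y \<in> carrier M\<rbrakk> \<Longrightarrow> x \<ominus>\<^bsub>M\<^esub> y = \<zero>\<^bsub>M\<^esub> \<longleftrightarrow> x = y"
  by (metis M.a_inv_closed M.minus_eq M.minus_equality M.minus_minus M.r_neg)

text \<open>Closure under negation is automatic, because \<open>-x\<close> is the product of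
  \<open>-1\<close> and \<open>x\<close>.\<close>

lemma submodule_iff:
  "submodule H A M \<longleftrightarrow> H \<subseteq> carrier M \<and> \<zero>\<^bsub>M\<^esub> \<in> H
     \<and> (\<forall>x\<in>H. \<forall>y\<in>H. x \<oplus>\<^bsub>M\<^esub> y \<in> H) \<and> (\<forall>a\<in>carrier A. \<forall>x\<in>H. a \<odot>\<^bsub>M\<^esub> x \<in> H)" (is "_ \<longleftrightarrow> ?r")
proof
  assume "submodule H A M"
  then interpret s: submodule H A M .
  show ?r using s.subset s.m_closed s.one_closed s.smult_closed by auto
next
  assume r: ?r
  show "submodule H A M"
  proof (intro submodule.intro subgroup.intro submodule_axioms.intro)
    fix x assume x: "x \<in> H"
    have "(\<ominus>\<^bsub>A\<^esub> \<one>\<^bsub>A\<^esub>) \<odot>\<^bsub>M\<^esub> x \<in> H" using r x by simp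
    then have "\<ominus>\<^bsub>M\<^esub> x \<in> H" using x r by (subst uminus_eq_smult) auto
    then show "inv\<^bsub>add_monoid M\<^esub> x \<in> H" by (simp add: a_inv_def)
  qed (use r in auto)
qed

lemmas submoduleI = submodule_iff[THEN iffD2, OF conjI, OF _ conjI, OF _ _ conjI, rule_format]

lemma submoduleD:
  assumes "submodule H A M"
  shows "H \<subseteq> carrier M" "\<zero>\<^bsub>M\<^esub> \<in> H" "\<And>x. x \<in> H \<Longrightarrow> x \<in> carrier M"
    "\<And>x y. \<lbrakk>x \<in> H; y \<in> H\<rbrakk> \<Longrightarrow> x \<oplus>\<^bsub>M\<^esub> y \<in> H"
    "\<And>a x. \<lbrakk>a \<in> carrier A; x \<in> H\<rbrakk> \<Longrightarrow> a \<odot>\<^bsub>M\<^esub> x \<in> H"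
    "\<And>x. x \<in> H \<Longrightarrow> \<ominus>\<^bsub>M\<^esub> x \<in> H"
    "\<And>x y. \<lbrakk>x \<in> H; y \<in> H\<rbrakk> \<Longrightarrow> x \<ominus>\<^bsub>M\<^esub> y \<in> H"
proof -
  note s = assms[unfolded submodule_iff]
  show "H \<subseteq> carrier M" "\<zero>\<^bsub>M\<^esub> \<in> H" "\<And>x. x \<in> H \<Longrightarrow> x \<in> carrier M"
    "\<And>x y. \<lbrakk>x \<in> H; y \<in> H\<rbrakk> \<Longrightarrow> x \<oplus>\<^bsub>M\<^esub> y \<in> H"
    "\<And>a x. \<lbrakk>a \<in> carrier A; x \<in> H\<rbrakk> \<Longrightarrow> a \<odot>\<^bsub>M\<^esub> x \<in> H" using s by auto
  show n: "\<And>x. x \<in> H \<Longrightarrow> \<ominus>\<^bsub>M\<^esub> x \<in> H"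
    using s by (metis A.a_inv_closed A.one_closed subsetD uminus_eq_smult)
  show "\<And>x y. \<lbrakk>x \<in> H; y \<in> H\<rbrakk> \<Longrightarrow> x \<ominus>\<^bsub>M\<^esub> y \<in> H" using s n by (simp add: a_minus_def)
qed

lemma submodule_carrier: "submodule (carrier M) A M"
  by (rule submoduleI) auto

lemma submodule_zero: "submodule {\<zero>\<^bsub>M\<^esub>} A M"
  by (rule submoduleI) auto

lemma submodule_Inter:
  assumes "\<And>H. H \<in> \<H> \<Longrightarrow> submodule H A M" "\<H> \<noteq> {}"
  shows "submodule (\<Inter>\<H>) A M"
  using assms by (intro submoduleI) (auto dest: submoduleD)

lemma submodule_Int: "\<lbrakk>submodule H A M; submodule L A M\<rbrakk> \<Longrightarrow> submodule (H \<inter> L) A M"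
  by (intro submoduleI) (auto dest: submoduleD)

lemma submodule_Union_chain:
  assumes "\<And>H. H \<in> \<C> \<Longrightarrow> submodule H A M" "\<C> \<noteq> {}"
    "\<And>H L. H \<in> \<C> \<Longrightarrow> L \<in> \<C> \<Longrightarrow> H \<subseteq> L \<or> L \<subseteq> H"
  shows "submodule (\<Union>\<C>) A M"
proof (rule submoduleI)
  fix x y assume "x \<in> \<Union>\<C>" "y \<in> \<Union>\<C>"
  then obtain H L where "H \<in> \<C>" "L \<in> \<C>" "x \<in> H" "y \<in> L" by auto
  then show "x \<oplus>\<^bsub>M\<^esub> y \<in> \<Union>\<C>" using assms(1,3) by (metis UnionI subsetD submoduleD(4))
qed (use assms(1,2) in \<open>auto dest: submoduleD\<close>)

lemma set_add_Collect: "H <+>\<^bsub>M\<^esub> L = {x \<oplus>\<^bsub>M\<^esub> y | x y. x \<in> H \<and> y \<in> L}"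
  by (auto simp: set_add_def')

lemma set_addI: "\<lbrakk>x \<in> H; y \<in> L\<rbrakk> \<Longrightarrow> x \<oplus>\<^bsub>M\<^esub> y \<in> H <+>\<^bsub>M\<^esub> L"
  by (auto simp: set_add_def')

lemma set_addE:
  assumes "u \<in> H <+>\<^bsub>M\<^esub> L"
  obtains x y where "x \<in> H" "y \<in> L" "u = x \<oplus>\<^bsub>M\<^esub> y"
  using assms by (auto simp: set_add_def')

lemma submodule_set_add:
  assumes "submodule H A M" "submodule L A M"
  shows "submodule ((H <+>\<^bsub>M\<^esub> L)) A M"
proof (rule submoduleI)
  note h = submoduleD[OF assms(1)] and l = submoduleD[OF assms(2)]
  show "(H <+>\<^bsub>M\<^esub> L) \<subseteq> carrier M" using h(1) l(1) by (auto simp: set_add_Collect)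
  show "\<zero>\<^bsub>M\<^esub> \<in> (H <+>\<^bsub>M\<^esub> L)" using set_addI[OF h(2) l(2)] by simp
  fix u v assume "u \<in> (H <+>\<^bsub>M\<^esub> L)" "v \<in> (H <+>\<^bsub>M\<^esub> L)"
  then obtain x y x' y' where e: "x \<in> H" "y \<in> L" "x' \<in> H" "y' \<in> L" "u = x \<oplus>\<^bsub>M\<^esub> y" "v = x' \<oplus>\<^bsub>M\<^esub> y'"
    by (elim set_addE)
  then have "u \<oplus>\<^bsub>M\<^esub> v = (x \<oplus>\<^bsub>M\<^esub> x') \<oplus>\<^bsub>M\<^esub> (y \<oplus>\<^bsub>M\<^esub> y')"
    using h(3)[OF e(1)] h(3)[OF e(3)] l(3)[OF e(2)] l(3)[OF e(4)] by (simp add: M.a_ac)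
  then show "u \<oplus>\<^bsub>M\<^esub> v \<in> (H <+>\<^bsub>M\<^esub> L)" using set_addI[OF h(4)[OF e(1,3)] l(4)[OF e(2,4)]] by simp
next
  note h = submoduleD[OF assms(1)] and l = submoduleD[OF assms(2)]
  fix a u assume a: "a \<in> carrier A" and "u \<in> (H <+>\<^bsub>M\<^esub> L)"
  then obtain x y where e: "x \<in> H" "y \<in> L" "u = x \<oplus>\<^bsub>M\<^esub> y" by (elim set_addE)
  then have "a \<odot>\<^bsub>M\<^esub> u = a \<odot>\<^bsub>M\<^esub> x \<oplus>\<^bsub>M\<^esub> a \<odot>\<^bsub>M\<^esub> y" 
    using a h(3)[OF e(1)] l(3)[OF e(2)] by (simp add: smult_r_distr)
  then show "a \<odot>\<^bsub>M\<^esub> u \<in> (H <+>\<^bsub>M\<^esub> L)" using set_addI[OF h(5)[OF a e(1)] l(5)[OF a e(2)]] by simp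
qed

lemma set_add_upper:
  assumes "submodule H A M" "submodule L A M"
  shows "H \<subseteq> (H <+>\<^bsub>M\<^esub> L)" "L \<subseteq> (H <+>\<^bsub>M\<^esub> L)"
proof -
  note h = submoduleD[OF assms(1)] and l = submoduleD[OF assms(2)]
  show "H \<subseteq> (H <+>\<^bsub>M\<^esub> L)"
  proof
    fix x assume "x \<in> H"
    then have "x = x \<oplus>\<^bsub>M\<^esub> \<zero>\<^bsub>M\<^esub>" using h(3) by simp
    then show "x \<in> (H <+>\<^bsub>M\<^esub> L)" using set_addI[OF \<open>x \<in> H\<close> l(2)] by simp
  qed
  show "L \<subseteq> (H <+>\<^bsub>M\<^esub> L)"
  proof
    fix x assume "x \<in> L"
    then have "x = \<zero>\<^bsub>M\<^esub> \<oplus>\<^bsub>M\<^esub> x" using l(3) by simp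
    then show "x \<in> (H <+>\<^bsub>M\<^esub> L)" using set_addI[OF h(2) \<open>x \<in> L\<close>] by simp
  qed
qed

lemma set_add_least: "\<lbrakk>submodule N A M; H \<subseteq> N; L \<subseteq> N\<rbrakk> \<Longrightarrow> (H <+>\<^bsub>M\<^esub> L) \<subseteq> N"
  by (auto elim!: set_addE dest: submoduleD)

lemma submodule_mod_span: "S \<subseteq> carrier M \<Longrightarrow> submodule (mod_span A M S) A M"
  unfolding mod_span_def by (rule submodule_Inter) (use submodule_carrier in auto)

lemma mod_span_least: "\<lbrakk>submodule H A M; S \<subseteq> H\<rbrakk> \<Longrightarrow> mod_span A M S \<subseteq> H"
  unfolding mod_span_def by auto

lemma mod_span_subset: "S \<subseteq> mod_span A M S"
  unfolding mod_span_def by auto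

lemma mod_span_mono: "S \<subseteq> T \<Longrightarrow> mod_span A M S \<subseteq> mod_span A M T"
  unfolding mod_span_def by auto

lemma mod_span_empty: "mod_span A M {} = {\<zero>\<^bsub>M\<^esub>}"
  using mod_span_least[OF submodule_zero, of "{}"] submoduleD(2)[OF submodule_mod_span[of "{}"]] by auto

lemma submodule_cyclic:
  assumes "x \<in> carrier M"
  shows "submodule {a \<odot>\<^bsub>M\<^esub> x | a. a \<in> carrier A} A M"
proof (rule submoduleI)
  show "\<zero>\<^bsub>M\<^esub> \<in> {a \<odot>\<^bsub>M\<^esub> x | a. a \<in> carrier A}" using assms smult_zero_left A.zero_closed by force
next
  fix u v assume "u \<in> {a \<odot>\<^bsub>M\<^esub> x | a. a \<in> carrier A}" "v \<in> {a \<odot>\<^bsub>M\<^esub> x | a. a \<in> carrier A}"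
  then obtain a b where "a \<in> carrier A" "b \<in> carrier A" "u = a \<odot>\<^bsub>M\<^esub> x" "v = b \<odot>\<^bsub>M\<^esub> x" by auto
  then show "u \<oplus>\<^bsub>M\<^esub> v \<in> {a \<odot>\<^bsub>M\<^esub> x | a. a \<in> carrier A}"
    using smult_l_distr[of a b x] assms by (metis (mono_tags, lifting) A.a_closed mem_Collect_eq)
next
  fix b u assume "b \<in> carrier A" "u \<in> {a \<odot>\<^bsub>M\<^esub> x | a. a \<in> carrier A}"
  then obtain a where "a \<in> carrier A" "u = a \<odot>\<^bsub>M\<^esub> x" by auto
  then show "b \<odot>\<^bsub>M\<^esub> u \<in> {a \<odot>\<^bsub>M\<^esub> x | a. a \<in> carrier A}"
    using smult_assoc[of b a x] assms \<open>b \<in> carrier A\<close>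
    by (metis (mono_tags, lifting) A.m_closed mem_Collect_eq)
qed (use assms in auto)

lemma mod_span_insert:
  assumes "x \<in> carrier M" "S \<subseteq> carrier M"
  shows "mod_span A M (insert x S) = {a \<odot>\<^bsub>M\<^esub> x | a. a \<in> carrier A} <+>\<^bsub>M\<^esub> mod_span A M S"
    (is "?l = ?c <+>\<^bsub>M\<^esub> ?s")
proof
  note c = submodule_cyclic[OF assms(1)] and s = submodule_mod_span[OF assms(2)]
  have "x \<in> ?c" using assms(1) smult_one by force
  then show "?l \<subseteq> ?c <+>\<^bsub>M\<^esub> ?s"
    using set_add_upper[OF c s] mod_span_subset[of S] submodule_set_add[OF c s]
    by (intro mod_span_least) auto
  have l: "submodule ?l A M" using assms by (intro submodule_mod_span) auto
  have "x \<in> ?l" using mod_span_subset[of "insert x S"] by auto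
  then show "?c <+>\<^bsub>M\<^esub> ?s \<subseteq> ?l"
    using l mod_span_mono[of S "insert x S"] by (intro set_add_least) (auto dest: submoduleD)
qed

lemma mod_span_insertE:
  assumes "x \<in> carrier M" "S \<subseteq> carrier M" "y \<in> mod_span A M (insert x S)"
  obtains a s where "a \<in> carrier A" "s \<in> mod_span A M S" "y = a \<odot>\<^bsub>M\<^esub> x \<oplus>\<^bsub>M\<^esub> s"
proof -
  obtain u s where "u \<in> {a \<odot>\<^bsub>M\<^esub> x | a. a \<in> carrier A}" "s \<in> mod_span A M S" "y = u \<oplus>\<^bsub>M\<^esub> s"
    using assms(3) unfolding mod_span_insert[OF assms(1,2)] by (rule set_addE)
  then show thesis using that by blast
qed

lemma submodule_left_module:
  assumes "submodule H A M"
  shows "left_module A (M\<lparr>carrier := H\<rparr>)"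
proof -
  note h = submoduleD[OF assms]
  have "abelian_group (M\<lparr>carrier := H\<rparr>)"
  proof (rule abelian_groupI)
    fix x assume "x \<in> carrier (M\<lparr>carrier := H\<rparr>)"
    then show "\<exists>y\<in>carrier (M\<lparr>carrier := H\<rparr>). y \<oplus>\<^bsub>M\<lparr>carrier := H\<rparr>\<^esub> x = \<zero>\<^bsub>M\<lparr>carrier := H\<rparr>\<^esub>"
      using h(3,6) by (auto intro!: bexI[of _ "\<ominus>\<^bsub>M\<^esub> x"] simp: M.l_neg)
  qed (use h in \<open>auto simp: M.a_ac\<close>)
  then show ?thesis
    using h by (intro left_module.intro left_module_axioms.intro A.ring_axioms)
      (auto simp: smult_l_distr smult_r_distr smult_assoc smult_one)
qed

text \<open>Submodules are turned into modules by changing only the carrier, so zero, addition and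
  scalar multiplication stay literally the same and statements pass between both levels by
  unfolding.\<close>

lemma submodule_restrict_iff:
  assumes "submodule N A M"
  shows "submodule H A (M\<lparr>carrier := N\<rparr>) \<longleftrightarrow> submodule H A M \<and> H \<subseteq> N"
proof -
  interpret N: left_module A "M\<lparr>carrier := N\<rparr>" by (rule submodule_left_module[OF assms])
  show ?thesis using submoduleD(1)[OF assms] by (auto simp: submodule_iff N.submodule_iff)
qed

lemma mod_span_restrict:
  assumes "submodule N A M" "S \<subseteq> N"
  shows "mod_span A (M\<lparr>carrier := N\<rparr>) S = mod_span A M S"
proof
  interpret N: left_module A "M\<lparr>carrier := N\<rparr>" by (rule submodule_left_module[OF assms(1)])
  have S: "S \<subseteq> carrier M" using assms submoduleD(1) by auto
  have "submodule (mod_span A M S) A (M\<lparr>carrier := N\<rparr>)"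
    using submodule_restrict_iff[OF assms(1)] submodule_mod_span[OF S] mod_span_least[OF assms] by auto
  then show "mod_span A (M\<lparr>carrier := N\<rparr>) S \<subseteq> mod_span A M S"
    using mod_span_subset by (intro N.mod_span_least) auto
  have "submodule (mod_span A (M\<lparr>carrier := N\<rparr>) S) A (M\<lparr>carrier := N\<rparr>)"
    using assms(2) by (intro N.submodule_mod_span) simp
  then show "mod_span A M S \<subseteq> mod_span A (M\<lparr>carrier := N\<rparr>) S"
    using N.mod_span_subset submodule_restrict_iff[OF assms(1)] by (intro mod_span_least) auto
qed

end

subsection \<open>Homomorphisms\<close>

lemma mod_homI:
  assumes "\<And>x. x \<in> carrier M \<Longrightarrow> h x \<in> carrier N"
    and "\<And>x y. \<lbrakk>x \<in> carrier M; y \<in> carrier M\<rbrakk> \<Longrightarrow> h (x \<oplus>\<^bsub>M\<^esub> y) = h x \<oplus>\<^bsub>N\<^esub> h y"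
    and "\<And>a x. \<lbrakk>a \<in> carrier A; x \<in> carrier M\<rbrakk> \<Longrightarrow> h (a \<odot>\<^bsub>M\<^esub> x) = a \<odot>\<^bsub>N\<^esub> h x"
  shows "h \<in> mod_hom A M N"
  using assms unfolding mod_hom_def by blast

lemma mod_homD:
  assumes "h \<in> mod_hom A M N"
  shows "\<And>x. x \<in> carrier M \<Longrightarrow> h x \<in> carrier N"
    and "\<And>x y. \<lbrakk>x \<in> carrier M; y \<in> carrier M\<rbrakk> \<Longrightarrow> h (x \<oplus>\<^bsub>M\<^esub> y) = h x \<oplus>\<^bsub>N\<^esub> h y"
    and "\<And>a x. \<lbrakk>a \<in> carrier A; x \<in> carrier M\<rbrakk> \<Longrightarrow> h (a \<odot>\<^bsub>M\<^esub> x) = a \<odot>\<^bsub>N\<^esub> h x"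
  using assms unfolding mod_hom_def by blast+

lemma mod_hom_id: "(\<lambda>x. x) \<in> mod_hom A M M"
  by (rule mod_homI) auto

lemma mod_hom_comp: "\<lbrakk>g \<in> mod_hom A M N; h \<in> mod_hom A N L\<rbrakk> \<Longrightarrow> (\<lambda>x. h (g x)) \<in> mod_hom A M L"
  by (rule mod_homI) (simp_all add: mod_homD)

lemma mod_hom_cong:
  assumes "g \<in> mod_hom A M N" "left_module A M" "\<And>x. x \<in> carrier M \<Longrightarrow> h x = g x"
  shows "h \<in> mod_hom A M N"
proof -
  interpret left_module A M by fact
  show ?thesis by (rule mod_homI) (simp_all add: assms(3) mod_homD[OF assms(1)])
qed

lemma mod_hom_zero_map: "left_module A N \<Longrightarrow> (\<lambda>_. \<zero>\<^bsub>N\<^esub>) \<in> mod_hom A M N"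
proof -
  assume "left_module A N"
  then interpret left_module A N .
  show ?thesis by (rule mod_homI) auto
qed

lemma mod_hom_add:
  assumes "left_module A N" "g \<in> mod_hom A M N" "h \<in> mod_hom A M N"
  shows "(\<lambda>x. g x \<oplus>\<^bsub>N\<^esub> h x) \<in> mod_hom A M N"
proof -
  interpret left_module A N by fact
  show ?thesis
    by (rule mod_homI) (simp_all add: mod_homD[OF assms(2)] mod_homD[OF assms(3)] smult_r_distr M.a_ac)
qed

lemma mod_hom_zero:
  assumes "left_module A M" "left_module A N" "h \<in> mod_hom A M N"
  shows "h \<zero>\<^bsub>M\<^esub> = \<zero>\<^bsub>N\<^esub>"
proof -
  interpret M: left_module A M by fact
  interpret N: left_module A N by fact
  have "h (\<zero>\<^bsub>A\<^esub> \<odot>\<^bsub>M\<^esub> \<zero>\<^bsub>M\<^esub>) = \<zero>\<^bsub>A\<^esub> \<odot>\<^bsub>N\<^esub> h \<zero>\<^bsub>M\<^esub>" by (intro mod_homD(3)[OF assms(3)]) auto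
  then show ?thesis using mod_homD(1)[OF assms(3)] by simp
qed

lemma mod_hom_uminus:
  assumes "left_module A M" "left_module A N" "h \<in> mod_hom A M N" "x \<in> carrier M"
  shows "h (\<ominus>\<^bsub>M\<^esub> x) = \<ominus>\<^bsub>N\<^esub> h x"
proof -
  interpret M: left_module A M by fact
  interpret N: left_module A N by fact
  show ?thesis using assms(4) mod_homD[OF assms(3)]
    by (simp add: M.uminus_eq_smult N.uminus_eq_smult)
qed

lemma mod_hom_minus:
  assumes "left_module A M" "left_module A N" "h \<in> mod_hom A M N" "x \<in> carrier M" "y \<in> carrier M"
  shows "h (x \<ominus>\<^bsub>M\<^esub> y) = h x \<ominus>\<^bsub>N\<^esub> h y"
proof -
  interpret M: left_module A M by fact
  show ?thesis using assms(4,5) mod_homD(2)[OF assms(3)] mod_hom_uminus[OF assms(1-3)]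
    by (simp add: a_minus_def)
qed

lemma mod_hom_uminus_map:
  assumes "left_module A N" "h \<in> mod_hom A M N"
  shows "(\<lambda>x. \<ominus>\<^bsub>N\<^esub> h x) \<in> mod_hom A M N"
proof -
  interpret left_module A N by fact
  show ?thesis
    by (rule mod_homI) (simp_all add: mod_homD[OF assms(2)] M.minus_add smult_minus_right M.a_comm)
qed

lemma mod_hom_minus_map:
  assumes "left_module A N" "g \<in> mod_hom A M N" "h \<in> mod_hom A M N"
  shows "(\<lambda>x. g x \<ominus>\<^bsub>N\<^esub> h x) \<in> mod_hom A M N"
  using mod_hom_add[OF assms(1,2) mod_hom_uminus_map[OF assms(1,3)]] by (simp add: a_minus_def)

lemma mod_hom_restrict_target:
  assumes "h \<in> mod_hom A M N" "h ` carrier M \<subseteq> H"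
  shows "h \<in> mod_hom A M (N\<lparr>carrier := H\<rparr>)"
  by (rule mod_homI) (use assms(2) in \<open>auto simp: mod_homD[OF assms(1)]\<close>)

lemma mod_hom_expand_target:
  assumes "h \<in> mod_hom A M (N\<lparr>carrier := H\<rparr>)" "H \<subseteq> carrier N"
  shows "h \<in> mod_hom A M N"
  by (rule mod_homI) (use mod_homD[OF assms(1)] assms(2) in auto)

lemma submodule_vimage:
  assumes "left_module A M" "left_module A N" "h \<in> mod_hom A M N" "submodule H A N"
  shows "submodule {x \<in> carrier M. h x \<in> H} A M"
proof -
  interpret M: left_module A M by fact
  interpret N: left_module A N by fact
  show ?thesis
    by (rule M.submoduleI)
      (auto simp: mod_homD[OF assms(3)] mod_hom_zero[OF assms(1-3)] N.submoduleD[OF assms(4)])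
qed

lemma submodule_kernel:
  assumes "left_module A M" "left_module A N" "h \<in> mod_hom A M N"
  shows "submodule (mod_kernel M N h) A M"
proof -
  interpret N: left_module A N by fact
  show ?thesis using submodule_vimage[OF assms N.submodule_zero] by (simp add: mod_kernel_def)
qed

lemma submodule_image:
  assumes "left_module A M" "left_module A N" "h \<in> mod_hom A M N" "submodule H A M"
  shows "submodule (h ` H) A N"
proof -
  interpret M: left_module A M by fact
  interpret N: left_module A N by fact
  note s = M.submoduleD[OF assms(4)] and h = mod_homD[OF assms(3)]
  show ?thesis
  proof (rule N.submoduleI)
    show "\<zero>\<^bsub>N\<^esub> \<in> h ` H" using s(2) mod_hom_zero[OF assms(1-3)] by force
  next
    fix x y assume "x \<in> h ` H" "y \<in> h ` H"
    then obtain u v where "u \<in> H" "v \<in> H" "x = h u" "y = h v" by auto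
    then have "x \<oplus>\<^bsub>N\<^esub> y = h (u \<oplus>\<^bsub>M\<^esub> v)" "u \<oplus>\<^bsub>M\<^esub> v \<in> H" using s(3,4) h(2) by auto
    then show "x \<oplus>\<^bsub>N\<^esub> y \<in> h ` H" by auto
  next
    fix a x assume a: "a \<in> carrier A" and "x \<in> h ` H"
    then obtain u where "u \<in> H" "x = h u" by auto
    then have "a \<odot>\<^bsub>N\<^esub> x = h (a \<odot>\<^bsub>M\<^esub> u)" "a \<odot>\<^bsub>M\<^esub> u \<in> H" using a s(3,5) h(3) by auto
    then show "a \<odot>\<^bsub>N\<^esub> x \<in> h ` H" by auto
  qed (use s(3) h(1) in auto)
qed

text \<open>Both inclusions come from minimality of a span, compared once with a preimage and once
  with an image.\<close>

lemma mod_span_image: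
  assumes "left_module A M" "left_module A N" "h \<in> mod_hom A M N" "S \<subseteq> carrier M"
  shows "h ` mod_span A M S = mod_span A N (h ` S)"
proof
  interpret M: left_module A M by fact
  interpret N: left_module A N by fact
  have hS: "h ` S \<subseteq> carrier N" using mod_homD(1)[OF assms(3)] assms(4) by auto
  have "mod_span A M S \<subseteq> {x \<in> carrier M. h x \<in> mod_span A N (h ` S)}"
    using N.mod_span_subset[of "h ` S"] assms(4)
    by (intro M.mod_span_least submodule_vimage[OF assms(1-3)] N.submodule_mod_span hS) auto
  then show "h ` mod_span A M S \<subseteq> mod_span A N (h ` S)" by auto
  show "mod_span A N (h ` S) \<subseteq> h ` mod_span A M S"
    using M.mod_span_subset[of S]
    by (intro N.mod_span_least submodule_image[OF assms(1-3)] M.submodule_mod_span assms(4)) auto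
qed

subsection \<open>Chain conditions\<close>

text \<open>The descending chain condition in the form of minimal elements, ready to be applied to a
  family of submodules.\<close>

definition dcc_module :: "('a, 'r) ring_scheme \<Rightarrow> ('a, 'm) module \<Rightarrow> bool" where
  "dcc_module A M \<longleftrightarrow> (\<forall>\<H>. \<H> \<noteq> {} \<and> (\<forall>H\<in>\<H>. submodule H A M)
     \<longrightarrow> (\<exists>H\<in>\<H>. \<forall>L\<in>\<H>. L \<subseteq> H \<longrightarrow> L = H))"

definition finitely_spanned :: "('a, 'r) ring_scheme \<Rightarrow> ('a, 'm) module \<Rightarrow> 'm set \<Rightarrow> bool" where
  "finitely_spanned A M H \<longleftrightarrow> (\<exists>S. finite S \<and> S \<subseteq> H \<and> mod_span A M S = H)"

definition noetherian_module :: "('a, 'r) ring_scheme \<Rightarrow> ('a, 'm) module \<Rightarrow> bool" where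
  "noetherian_module A M \<longleftrightarrow>
     (\<forall>H. submodule H A M \<longrightarrow> finitely_spanned A M H)"

lemma dcc_moduleE:
  assumes "dcc_module A M" "\<H> \<noteq> {}" "\<And>H. H \<in> \<H> \<Longrightarrow> submodule H A M"
  obtains H where "H \<in> \<H>" "\<And>L. L \<in> \<H> \<Longrightarrow> L \<subseteq> H \<Longrightarrow> L = H"
  using assms unfolding dcc_module_def by meson

lemma finitely_spannedI:
  assumes "left_module A M" "submodule I A M" "finite S" "S \<subseteq> I" "I \<subseteq> mod_span A M S"
  shows "finitely_spanned A M I"
proof -
  interpret left_module A M by fact
  show ?thesis unfolding finitely_spanned_def using assms mod_span_least[OF assms(2,4)] by blast
qed

text \<open>Lifts of generators of the image together with generators of the kernel span:
  subtracting a suitable combination of the lifts moves any element of \<open>I\<close> into the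
  kernel.\<close>

lemma finitely_spanned_extension:
  assumes M: "left_module A M" and N: "left_module A N" and h: "h \<in> mod_hom A M N"
    and I: "submodule I A M"
    and im: "finitely_spanned A N (h ` I)"
    and ker: "finitely_spanned A M {x \<in> I. h x = \<zero>\<^bsub>N\<^esub>}"
  shows "finitely_spanned A M I"
proof -
  interpret M: left_module A M by fact
  interpret N: left_module A N by fact
  note i = M.submoduleD[OF I]
  obtain T where T: "finite T" "T \<subseteq> h ` I" "mod_span A N T = h ` I" using im unfolding finitely_spanned_def by blast
  obtain T' where T': "finite T'" "T' \<subseteq> I" "T = h ` T'"
    using finite_subset_image[OF T(1,2)] by blast
  let ?k = "{x \<in> I. h x = \<zero>\<^bsub>N\<^esub>}"
  obtain U where U: "finite U" "U \<subseteq> ?k" "mod_span A M U = ?k" using ker unfolding finitely_spanned_def by blast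
  have TU: "T' \<union> U \<subseteq> carrier M" "T' \<subseteq> carrier M" using T'(2) U(2) i(1) by auto
  have sp: "submodule (mod_span A M (T' \<union> U)) A M" by (rule M.submodule_mod_span[OF TU(1)])
  have "I \<subseteq> mod_span A M (T' \<union> U)"
  proof
    fix x assume x: "x \<in> I"
    then have "h x \<in> h ` mod_span A M T'"
      using mod_span_image[OF M N h TU(2)] T(3) T'(3) by auto
    then obtain y where y: "y \<in> mod_span A M T'" "h x = h y" by auto
    have yI: "y \<in> I" using y(1) M.mod_span_least[OF I T'(2)] by auto
    have "h (x \<ominus>\<^bsub>M\<^esub> y) = \<zero>\<^bsub>N\<^esub>"
      using y(2) mod_hom_minus[OF M N h i(3)[OF x] i(3)[OF yI]] mod_homD(1)[OF h i(3)[OF yI]]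
      by (simp add: N.minus_eq N.r_neg)
    then have "x \<ominus>\<^bsub>M\<^esub> y \<in> mod_span A M U" using U(3) i(7)[OF x yI] by auto
    then have "x \<ominus>\<^bsub>M\<^esub> y \<in> mod_span A M (T' \<union> U)" using M.mod_span_mono[of U "T' \<union> U"] by auto
    moreover have "y \<in> mod_span A M (T' \<union> U)" using y(1) M.mod_span_mono[of T' "T' \<union> U"] by auto
    ultimately have "(x \<ominus>\<^bsub>M\<^esub> y) \<oplus>\<^bsub>M\<^esub> y \<in> mod_span A M (T' \<union> U)" by (rule M.submoduleD(4)[OF sp])
    then show "x \<in> mod_span A M (T' \<union> U)" using i(3)[OF x] i(3)[OF yI]
      by (simp add: M.minus_eq M.a_assoc M.l_neg)
  qed
  then show ?thesis using T'(1,2) U(1,2) by (intro finitely_spannedI[OF M I, of "T' \<union> U"]) auto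
qed

section \<open>Modules over an artinian commutative ring\<close>

lemma artinian_minimal_ideal:
  assumes "artinian_cring K" "\<I> \<noteq> {}" "\<And>I. I \<in> \<I> \<Longrightarrow> ideal I K"
  obtains I where "I \<in> \<I>" "\<And>J. J \<in> \<I> \<Longrightarrow> J \<subseteq> I \<Longrightarrow> J = I"
proof -
  have "wf {(I, J). ideal I K \<and> ideal J K \<and> I \<subset> J}"
  proof (unfold wf_iff_no_infinite_down_chain, safe)
    fix f :: "nat \<Rightarrow> 'a set"
    assume f: "\<forall>i. (f (Suc i), f i) \<in> {(I, J). ideal I K \<and> ideal J K \<and> I \<subset> J}"
    then have "\<forall>i. ideal (f i) K \<and> f (Suc i) \<subseteq> f i" by auto
    then obtain N where "\<forall>i\<ge>N. f i = f N" using assms(1) unfolding artinian_cring_def by blast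
    then have "f (Suc N) = f N" by (meson le_SucI order_refl)
    moreover have "f (Suc N) \<subset> f N" using spec[OF f, of N] by auto
    ultimately show False by simp
  qed
  from wfE_min'[OF this assms(2)] obtain I where I: "I \<in> \<I>"
    "\<And>J. (J, I) \<in> {(I, J). ideal I K \<and> ideal J K \<and> I \<subset> J} \<Longrightarrow> J \<notin> \<I>"
    by blast
  show thesis
  proof (rule that[OF I(1)])
    fix J assume J: "J \<in> \<I>" "J \<subseteq> I"
    have "(J, I) \<notin> {(I, J). ideal I K \<and> ideal J K \<and> I \<subset> J}" using I(2) J(1) by blast
    then show "J = I" using assms(3)[OF I(1)] assms(3)[OF J(1)] J(2) by blast
  qed
qed

text \<open>The principal ideals of the powers of \<open>c\<close> descend, so two consecutive ones
  agree, and \<open>c^i\<close> is a multiple of \<open>c^(i+1)\<close>. The factor \<open>d\<close>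
  is an inverse of \<open>c\<close> up to the power \<open>c^i\<close>.\<close>

lemma artinian_power_stable:
  assumes "artinian_cring K" "c \<in> carrier K"
  obtains i :: nat and d where "d \<in> carrier K" "c [^]\<^bsub>K\<^esub> i = d \<otimes>\<^bsub>K\<^esub> c \<otimes>\<^bsub>K\<^esub> c [^]\<^bsub>K\<^esub> i"
proof -
  interpret cring K using assms(1) unfolding artinian_cring_def by simp
  define I where "I i = PIdl\<^bsub>K\<^esub> (c [^]\<^bsub>K\<^esub> i)" for i :: nat
  have "ideal (I i) K \<and> I (Suc i) \<subseteq> I i" for i
  proof
    show i: "ideal (I i) K" unfolding I_def using assms(2) by (intro cgenideal_ideal) simp
    have "c [^]\<^bsub>K\<^esub> i \<in> I i" unfolding I_def using assms(2) by (intro cgenideal_self) simp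
    then have "c [^]\<^bsub>K\<^esub> Suc i \<in> I i" using ideal.I_r_closed[OF i _ assms(2)] by simp
    then show "I (Suc i) \<subseteq> I i" unfolding I_def[of "Suc i"] by (rule cgenideal_minimal[OF i])
  qed
  then obtain N where "\<forall>i\<ge>N. I i = I N" using assms(1) unfolding artinian_cring_def by blast
  then have "I (Suc N) = I N" by (meson le_SucI order_refl)
  then have "PIdl\<^bsub>K\<^esub> (c [^]\<^bsub>K\<^esub> Suc N) = PIdl\<^bsub>K\<^esub> (c [^]\<^bsub>K\<^esub> N)" by (simp only: I_def)
  then have "c [^]\<^bsub>K\<^esub> N \<in> PIdl\<^bsub>K\<^esub> (c [^]\<^bsub>K\<^esub> Suc N)" using assms(2) cgenideal_self[of "c [^]\<^bsub>K\<^esub> N"] by simp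
  then obtain d where "d \<in> carrier K" "c [^]\<^bsub>K\<^esub> N = d \<otimes>\<^bsub>K\<^esub> c [^]\<^bsub>K\<^esub> Suc N" by (auto simp: cgenideal_def)
  then show thesis using that assms(2) by (metis m_assoc m_comm nat_pow_Suc nat_pow_closed)
qed

text \<open>In \<open>c^i = d c c^i\<close> the power can be removed on \<open>I\<close>: if
  \<open>c\<close> is onto, every element has the form \<open>c^i y\<close>; if \<open>c\<close> is
  injective, \<open>c^i\<close> can be cancelled from \<open>c^i (d c x - x) = 0\<close>. Later this
  inverts scalars on minimal counterexamples and on simple modules.\<close>

lemma artinian_acts_as_field:
  assumes "artinian_cring K" "left_module K M" "c \<in> carrier K" "submodule I K M"
    and "(\<forall>x\<in>I. \<exists>y\<in>I. x = c \<odot>\<^bsub>M\<^esub> y) \<or> (\<forall>x\<in>I. c \<odot>\<^bsub>M\<^esub> x = \<zero>\<^bsub>M\<^esub> \<longrightarrow> x = \<zero>\<^bsub>M\<^esub>)"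
  obtains d where "d \<in> carrier K" "\<And>x. x \<in> I \<Longrightarrow> d \<odot>\<^bsub>M\<^esub> (c \<odot>\<^bsub>M\<^esub> x) = x"
proof -
  interpret K: cring K using assms(1) unfolding artinian_cring_def by simp
  interpret M: left_module K M by fact
  note I = M.submoduleD[OF assms(4)]
  obtain i :: nat and d where d: "d \<in> carrier K" "c [^]\<^bsub>K\<^esub> i = d \<otimes>\<^bsub>K\<^esub> c \<otimes>\<^bsub>K\<^esub> c [^]\<^bsub>K\<^esub> i"
    using artinian_power_stable[OF assms(1,3)] by blast
  define p where "p i = c [^]\<^bsub>K\<^esub> i" for i :: nat
  have p: "p i \<in> carrier K" for i using assms(3) by (simp add: p_def)
  have pS: "p (Suc i) \<odot>\<^bsub>M\<^esub> x = p i \<odot>\<^bsub>M\<^esub> (c \<odot>\<^bsub>M\<^esub> x)" if "x \<in> I" for i x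
    using that assms(3) p I(3) by (simp add: p_def M.smult_assoc)
  have *: "d \<odot>\<^bsub>M\<^esub> (c \<odot>\<^bsub>M\<^esub> (p i \<odot>\<^bsub>M\<^esub> x)) = p i \<odot>\<^bsub>M\<^esub> x" if "x \<in> I" for x
    using arg_cong[OF d(2), of "\<lambda>e. e \<odot>\<^bsub>M\<^esub> x"] that d(1) assms(3) p I(3)
    by (simp add: M.smult_assoc p_def)
  show thesis
  proof (rule that[OF d(1)])
    fix x assume x: "x \<in> I"
    then have dcx: "d \<odot>\<^bsub>M\<^esub> (c \<odot>\<^bsub>M\<^esub> x) \<in> I" using d(1) assms(3) I(5) by auto
    from assms(5) show "d \<odot>\<^bsub>M\<^esub> (c \<odot>\<^bsub>M\<^esub> x) = x"
    proof
      assume s: "\<forall>x\<in>I. \<exists>y\<in>I. x = c \<odot>\<^bsub>M\<^esub> y"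
      have "\<exists>y\<in>I. x = p j \<odot>\<^bsub>M\<^esub> y" for j
      proof (induction j)
        case 0 then show ?case using x I(3) by (auto simp: p_def M.smult_one)
      next
        case (Suc j) then show ?case using s pS by metis
      qed
      then show ?thesis using * by metis
    next
      assume s: "\<forall>x\<in>I. c \<odot>\<^bsub>M\<^esub> x = \<zero>\<^bsub>M\<^esub> \<longrightarrow> x = \<zero>\<^bsub>M\<^esub>"
      have inj: "y \<in> I \<Longrightarrow> p j \<odot>\<^bsub>M\<^esub> y = \<zero>\<^bsub>M\<^esub> \<Longrightarrow> y = \<zero>\<^bsub>M\<^esub>" for j y
      proof (induction j arbitrary: y)
        case 0 then show ?case using I(3) by (simp add: p_def M.smult_one)
      next
        case (Suc j) then show ?case using s pS I(5) assms(3) by metis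
      qed
      have pc: "p i \<odot>\<^bsub>M\<^esub> (d \<odot>\<^bsub>M\<^esub> (c \<odot>\<^bsub>M\<^esub> x)) = d \<odot>\<^bsub>M\<^esub> (c \<odot>\<^bsub>M\<^esub> (p i \<odot>\<^bsub>M\<^esub> x))"
        using x I(3) d(1) assms(3) p[of i] M.smult_assoc[symmetric] by (simp add: K.m_ac)
      have "p i \<odot>\<^bsub>M\<^esub> (d \<odot>\<^bsub>M\<^esub> (c \<odot>\<^bsub>M\<^esub> x) \<ominus>\<^bsub>M\<^esub> x) = \<zero>\<^bsub>M\<^esub>"
        using x dcx I(3) p[of i] pc *[OF x]
        by (simp add: M.minus_eq M.smult_r_distr M.smult_minus_right M.r_neg)
      then have "d \<odot>\<^bsub>M\<^esub> (c \<odot>\<^bsub>M\<^esub> x) \<ominus>\<^bsub>M\<^esub> x = \<zero>\<^bsub>M\<^esub>" using inj I(7)[OF dcx x] by blast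
      then show ?thesis using M.minus_eq_zero_iff I(3) x dcx by blast
    qed
  qed
qed

lemma scalar_mod_hom:
  assumes "left_module K M" "cring K" "c \<in> carrier K"
  shows "(\<lambda>x. c \<odot>\<^bsub>M\<^esub> x) \<in> mod_hom K M M"
proof -
  interpret left_module K M by fact
  interpret K: cring K by fact
  show ?thesis
  proof (rule mod_homI)
    fix a x assume "a \<in> carrier K" "x \<in> carrier M"
    then show "c \<odot>\<^bsub>M\<^esub> (a \<odot>\<^bsub>M\<^esub> x) = a \<odot>\<^bsub>M\<^esub> (c \<odot>\<^bsub>M\<^esub> x)"
      using assms(3) by (simp add: smult_assoc[symmetric] K.m_comm)
  qed (use assms(3) in \<open>auto simp: smult_r_distr\<close>)
qed

text \<open>Induction on a generating set. Among comparable submodules, a member is determined by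
  its ideal of leading coefficients at the new generator \<open>x\<close> together with its
  intersection with the span of the remaining generators. Minimising the ideal first and the
  intersection second gives a minimal member.\<close>

lemma dcc_fin_gen:
  assumes K: "artinian_cring K" and "left_module K M" "fin_gen K M"
  shows "dcc_module K M"
proof -
  interpret K: cring K using K unfolding artinian_cring_def by simp
  interpret M: left_module K M by fact
  \<comment> \<open>The induction needs families of submodules of the given module that lie inside a
    span, so that the module itself stays fixed while the generating set shrinks.\<close>
  have main: "\<exists>H\<in>\<H>. \<forall>L\<in>\<H>. L \<subseteq> H \<longrightarrow> L = H"
    if "finite S" "S \<subseteq> carrier M" "\<H> \<noteq> {}" "\<forall>H\<in>\<H>. submodule H K M \<and> H \<subseteq> mod_span K M S" for S \<H>
    using that
  proof (induction S arbitrary: \<H> rule: finite_induct)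
    case empty
    then have "H = {\<zero>\<^bsub>M\<^esub>}" if "H \<in> \<H>" for H
      using that M.submoduleD(2) M.mod_span_empty by fastforce
    then show ?case using empty by blast
  next
    case (insert x S)
    have x: "x \<in> carrier M" "S \<subseteq> carrier M" using insert.prems by auto
    let ?N = "mod_span K M S"
    have N: "submodule ?N K M" by (rule M.submodule_mod_span[OF x(2)])
    note N' = M.submoduleD[OF N]
    have sub: "submodule H K M" if "H \<in> \<H>" for H using insert.prems that by blast
    define J where "J H = {c \<in> carrier K. \<exists>s\<in>?N. c \<odot>\<^bsub>M\<^esub> x \<oplus>\<^bsub>M\<^esub> s \<in> H}" for H
    have J: "ideal (J H) K" if "H \<in> \<H>" for H
    proof -
      note H = M.submoduleD[OF sub[OF that]]
      have add: "c \<oplus>\<^bsub>K\<^esub> d \<in> J H" if "c \<in> J H" "d \<in> J H" for c d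
      proof -
        from that obtain s t where *: "c \<in> carrier K" "d \<in> carrier K" "s \<in> ?N" "t \<in> ?N"
          "c \<odot>\<^bsub>M\<^esub> x \<oplus>\<^bsub>M\<^esub> s \<in> H" "d \<odot>\<^bsub>M\<^esub> x \<oplus>\<^bsub>M\<^esub> t \<in> H" by (auto simp: J_def)
        have "(c \<oplus>\<^bsub>K\<^esub> d) \<odot>\<^bsub>M\<^esub> x \<oplus>\<^bsub>M\<^esub> (s \<oplus>\<^bsub>M\<^esub> t) = (c \<odot>\<^bsub>M\<^esub> x \<oplus>\<^bsub>M\<^esub> s) \<oplus>\<^bsub>M\<^esub> (d \<odot>\<^bsub>M\<^esub> x \<oplus>\<^bsub>M\<^esub> t)"
          using * x N'(3)[OF *(3)] N'(3)[OF *(4)] by (simp add: M.smult_l_distr M.a_ac)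
        then show ?thesis using * H(4) N'(4) unfolding J_def by (smt (verit) K.a_closed mem_Collect_eq)
      qed
      have mult: "d \<otimes>\<^bsub>K\<^esub> c \<in> J H" if "c \<in> J H" "d \<in> carrier K" for c d
      proof -
        from that obtain s where *: "c \<in> carrier K" "s \<in> ?N" "c \<odot>\<^bsub>M\<^esub> x \<oplus>\<^bsub>M\<^esub> s \<in> H" by (auto simp: J_def)
        have "(d \<otimes>\<^bsub>K\<^esub> c) \<odot>\<^bsub>M\<^esub> x \<oplus>\<^bsub>M\<^esub> d \<odot>\<^bsub>M\<^esub> s = d \<odot>\<^bsub>M\<^esub> (c \<odot>\<^bsub>M\<^esub> x \<oplus>\<^bsub>M\<^esub> s)"
          using * x that N'(3)[OF *(2)] by (simp add: M.smult_assoc M.smult_r_distr)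
        then show ?thesis using * that H(5) N'(5) unfolding J_def by (smt (verit) K.m_closed mem_Collect_eq)
      qed
      have zero: "\<zero>\<^bsub>K\<^esub> \<in> J H" unfolding J_def using x H(2) N'(2) by (auto intro!: bexI[of _ "\<zero>\<^bsub>M\<^esub>"])
      have neg: "\<ominus>\<^bsub>K\<^esub> c \<in> J H" if "c \<in> J H" for c
        using mult[OF that, of "\<ominus>\<^bsub>K\<^esub> \<one>\<^bsub>K\<^esub>"] that by (simp add: J_def K.l_minus)
      show ?thesis
      proof (rule idealI[OF K.ring_axioms])
        show "subgroup (J H) (add_monoid K)"
          using zero add neg by (intro subgroup.intro) (auto simp: J_def a_inv_def)
      qed (use mult in \<open>auto simp: K.m_comm J_def\<close>)
    qed
    obtain H0 where H0: "H0 \<in> \<H>" "\<And>H. H \<in> \<H> \<Longrightarrow> J H \<subseteq> J H0 \<Longrightarrow> J H = J H0"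
    proof -
      have J': "J ` \<H> \<noteq> {}" "\<And>I. I \<in> J ` \<H> \<Longrightarrow> ideal I K" using J insert.prems(2) by auto
      show thesis
      proof (rule artinian_minimal_ideal[OF K J'])
        fix I assume "I \<in> J ` \<H>" "\<And>L. L \<in> J ` \<H> \<Longrightarrow> L \<subseteq> I \<Longrightarrow> L = I"
        then show thesis using that by (metis imageE imageI)
      qed
    qed
    \<comment> \<open>Below \<open>H0\<close> the coefficient ideal can no longer shrink, so from
      here on only the intersection with the span varies.\<close>
    let ?\<H>' = "{H \<in> \<H>. H \<subseteq> H0}"
    have "\<exists>I\<in>(\<lambda>H. H \<inter> ?N) ` ?\<H>'. \<forall>L\<in>(\<lambda>H. H \<inter> ?N) ` ?\<H>'. L \<subseteq> I \<longrightarrow> L = I"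
      using H0(1) N x(2) sub M.submodule_Int by (intro insert.IH) auto
    then have "\<exists>H1\<in>?\<H>'. \<forall>L\<in>?\<H>'. L \<inter> ?N \<subseteq> H1 \<inter> ?N \<longrightarrow> L \<inter> ?N = H1 \<inter> ?N"
      by (simp only: bex_simps ball_simps)
    then obtain H1 where H1: "H1 \<in> \<H>" "H1 \<subseteq> H0"
      "\<And>L. L \<in> \<H> \<Longrightarrow> L \<subseteq> H0 \<Longrightarrow> L \<inter> ?N \<subseteq> H1 \<inter> ?N \<Longrightarrow> L \<inter> ?N = H1 \<inter> ?N"
      by (metis (no_types, lifting) mem_Collect_eq)
    show ?case
    proof (intro bexI[OF _ H1(1)] ballI impI)
      fix L assume L: "L \<in> \<H>" "L \<subseteq> H1"
      have LN: "L \<inter> ?N = H1 \<inter> ?N" using L H1 by blast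
      have Jm: "H \<subseteq> H' \<Longrightarrow> J H \<subseteq> J H'" for H H' unfolding J_def by (rule Collect_mono) (meson subsetD)
      have "J L \<subseteq> J H1" "J H1 \<subseteq> J H0" using Jm L(2) H1(2) by auto
      then have JJ: "J L = J H1" using H0(2) L H1(1) by (metis subset_trans)
      note l = M.submoduleD[OF sub[OF L(1)]] and h = M.submoduleD[OF sub[OF H1(1)]]
      show "L = H1"
      proof
        show "H1 \<subseteq> L"
        proof
          fix y assume y: "y \<in> H1"
          then have "y \<in> mod_span K M (insert x S)" using insert.prems(3) H1(1) by blast
          then obtain c s where cs: "c \<in> carrier K" "s \<in> ?N" "y = c \<odot>\<^bsub>M\<^esub> x \<oplus>\<^bsub>M\<^esub> s"
            by (rule M.mod_span_insertE[OF x])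
          \<comment> \<open>Equal coefficient ideals give an element of \<open>L\<close> with the
            same \<open>x\<close>-coefficient as \<open>y\<close>. Their difference has no
            \<open>x\<close>-part left, so it lies in the common intersection with the span of
            \<open>S\<close>, and therefore in \<open>L\<close>.\<close>
          then have "c \<in> J L" using JJ y unfolding J_def by blast
          then obtain t where t: "t \<in> ?N" "c \<odot>\<^bsub>M\<^esub> x \<oplus>\<^bsub>M\<^esub> t \<in> L" unfolding J_def by blast
          have cM: "c \<odot>\<^bsub>M\<^esub> x \<in> carrier M" "s \<in> carrier M" "t \<in> carrier M" using cs t x N'(3) by auto
          have "y \<ominus>\<^bsub>M\<^esub> (c \<odot>\<^bsub>M\<^esub> x \<oplus>\<^bsub>M\<^esub> t) = s \<ominus>\<^bsub>M\<^esub> t"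
          proof -
            have "y \<ominus>\<^bsub>M\<^esub> (c \<odot>\<^bsub>M\<^esub> x \<oplus>\<^bsub>M\<^esub> t)
                = s \<oplus>\<^bsub>M\<^esub> (c \<odot>\<^bsub>M\<^esub> x \<oplus>\<^bsub>M\<^esub> (\<ominus>\<^bsub>M\<^esub> (c \<odot>\<^bsub>M\<^esub> x) \<oplus>\<^bsub>M\<^esub> \<ominus>\<^bsub>M\<^esub> t))"
              using cM unfolding cs(3) by (simp add: M.minus_eq M.minus_add M.a_ac)
            then show ?thesis using cM by (simp add: M.r_neg2 M.minus_eq)
          qed
          moreover have "y \<ominus>\<^bsub>M\<^esub> (c \<odot>\<^bsub>M\<^esub> x \<oplus>\<^bsub>M\<^esub> t) \<in> H1" using h(7) y t(2) L(2) by blast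
          ultimately have "s \<ominus>\<^bsub>M\<^esub> t \<in> L" using N'(7)[OF cs(2) t(1)] LN by auto
          then have "(c \<odot>\<^bsub>M\<^esub> x \<oplus>\<^bsub>M\<^esub> t) \<oplus>\<^bsub>M\<^esub> (s \<ominus>\<^bsub>M\<^esub> t) \<in> L" using l(4) t(2) by blast
          moreover have "(c \<odot>\<^bsub>M\<^esub> x \<oplus>\<^bsub>M\<^esub> t) \<oplus>\<^bsub>M\<^esub> (s \<ominus>\<^bsub>M\<^esub> t) = y"
          proof -
            have "(c \<odot>\<^bsub>M\<^esub> x \<oplus>\<^bsub>M\<^esub> t) \<oplus>\<^bsub>M\<^esub> (s \<ominus>\<^bsub>M\<^esub> t) = (c \<odot>\<^bsub>M\<^esub> x \<oplus>\<^bsub>M\<^esub> s) \<oplus>\<^bsub>M\<^esub> (t \<oplus>\<^bsub>M\<^esub> \<ominus>\<^bsub>M\<^esub> t)"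
              using cM by (simp add: M.minus_eq M.a_ac)
            then show ?thesis using cM unfolding cs(3) by (simp add: M.r_neg)
          qed
          ultimately show "y \<in> L" by simp
        qed
      qed (use L in auto)
    qed
  qed
  obtain S where "finite S" "S \<subseteq> carrier M" "mod_span K M S = carrier M"
    using assms(3) unfolding fin_gen_def by blast
  then show ?thesis unfolding dcc_module_def using main M.submoduleD(1) by metis
qed

text \<open>
  A minimal submodule \<open>I\<close> that is not finitely generated satisfies \<open>c I = I\<close> or \<open>c I = 0\<close> for
  every scalar \<open>c\<close>. Hence \<open>I\<close> is a vector space all of whose proper subspaces are finitely
  generated, and a hyperplane of \<open>I\<close> gives a contradiction.
\<close>

lemma dcc_imp_noetherian:
  assumes K: "artinian_cring K" and "left_module K M" "dcc_module K M"
  shows "noetherian_module K M"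
proof (rule ccontr)
  interpret K: cring K using K unfolding artinian_cring_def by simp
  interpret M: left_module K M by fact
  let ?fg = "finitely_spanned K M"
  assume "\<not> noetherian_module K M"
  then have ne: "{H. submodule H K M \<and> \<not> ?fg H} \<noteq> {}" unfolding noetherian_module_def by blast
  obtain I where I: "submodule I K M" "\<not> ?fg I"
    and min: "\<And>L. submodule L K M \<Longrightarrow> L \<subseteq> I \<Longrightarrow> L \<noteq> I \<Longrightarrow> ?fg L"
  proof (rule dcc_moduleE[OF assms(3) ne])
    fix H assume H: "H \<in> {H. submodule H K M \<and> \<not> ?fg H}"
      "\<And>L. L \<in> {H. submodule H K M \<and> \<not> ?fg H} \<Longrightarrow> L \<subseteq> H \<Longrightarrow> L = H"
    show thesis using that[of H] H by blast
  qed blast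
  note i = M.submoduleD[OF I(1)]
  \<comment> \<open>If \<open>c\<close> neither kills \<open>I\<close> nor maps it onto itself, then
    its image and its kernel on \<open>I\<close> are proper submodules, hence finitely generated by
    minimality, and the extension property makes \<open>I\<close> finitely generated.\<close>
  have surj: "\<forall>x\<in>I. \<exists>y\<in>I. x = c \<odot>\<^bsub>M\<^esub> y"
    if c: "c \<in> carrier K" and nz: "\<exists>x\<in>I. c \<odot>\<^bsub>M\<^esub> x \<noteq> \<zero>\<^bsub>M\<^esub>" for c
  proof (rule ccontr)
    have hom: "(\<lambda>x. c \<odot>\<^bsub>M\<^esub> x) \<in> mod_hom K M M" by (rule scalar_mod_hom[OF assms(2) K.is_cring c])
    let ?cI = "(\<lambda>x. c \<odot>\<^bsub>M\<^esub> x) ` I" and ?k = "{x \<in> I. c \<odot>\<^bsub>M\<^esub> x = \<zero>\<^bsub>M\<^esub>}"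
    assume "\<not> (\<forall>x\<in>I. \<exists>y\<in>I. x = c \<odot>\<^bsub>M\<^esub> y)"
    then have "?cI \<noteq> I" by auto
    moreover have "?cI \<subseteq> I" using i(5) c by auto
    moreover have "submodule ?cI K M" by (rule submodule_image[OF assms(2,2) hom I(1)])
    ultimately have cI: "?fg ?cI" using min by blast
    have "mod_kernel M M (\<lambda>x. c \<odot>\<^bsub>M\<^esub> x) \<inter> I = ?k" using i(3) by (auto simp: mod_kernel_def)
    then have k: "submodule ?k K M"
      using M.submodule_Int[OF submodule_kernel[OF assms(2,2) hom] I(1)] by simp
    have "?k \<noteq> I" using nz by auto
    then have "?fg ?k" using min[OF k] by blast
    then have "?fg I" by (rule finitely_spanned_extension[OF assms(2,2) hom I(1) cI])
    then show False using I(2) by simp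
  qed
  have unit: "\<exists>d\<in>carrier K. \<forall>x\<in>I. d \<odot>\<^bsub>M\<^esub> (c \<odot>\<^bsub>M\<^esub> x) = x"
    if c: "c \<in> carrier K" and nz: "\<exists>x\<in>I. c \<odot>\<^bsub>M\<^esub> x \<noteq> \<zero>\<^bsub>M\<^esub>" for c
    using artinian_acts_as_field[OF K assms(2) c I(1)] surj[OF that] by metis
  have "I \<noteq> {\<zero>\<^bsub>M\<^esub>}"
  proof
    assume "I = {\<zero>\<^bsub>M\<^esub>}"
    then have "?fg I" unfolding finitely_spanned_def using M.mod_span_empty by (intro exI[of _ "{}"]) auto
    then show False using I(2) by simp
  qed
  then obtain x where x: "x \<in> I" "x \<noteq> \<zero>\<^bsub>M\<^esub>" using i(2) by blast
  \<comment> \<open>A maximal member of this family is the hyperplane: a complement to the line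
    through \<open>x\<close>.\<close>
  let ?C = "{H. submodule H K M \<and> H \<subseteq> I \<and> x \<notin> H}"
  have "\<exists>H\<in>?C. \<forall>L\<in>?C. H \<subseteq> L \<longrightarrow> L = H"
  proof (rule subset_Zorn_nonempty)
    show "?C \<noteq> {}" using M.submodule_zero x i(2) by (intro ex_in_conv[THEN iffD1] exI[of _ "{\<zero>\<^bsub>M\<^esub>}"]) auto
    fix C assume C: "C \<noteq> {}" "subset.chain ?C C"
    then have "submodule (\<Union>C) K M"
      by (intro M.submodule_Union_chain) (auto simp: subset.chain_def)
    then show "\<Union>C \<in> ?C" using C by (auto simp: subset.chain_def)
  qed
  then obtain H where H': "H \<in> ?C" "\<And>L. L \<in> ?C \<Longrightarrow> H \<subseteq> L \<Longrightarrow> L = H" by (elim bexE) (metis (no_types, lifting))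
  have H: "submodule H K M" "H \<subseteq> I" "x \<notin> H" using H'(1) by simp_all
  have Hmax: "L = H" if "submodule L K M" "L \<subseteq> I" "x \<notin> L" "H \<subseteq> L" for L
    using H'(2)[of L] that by simp
  note h = M.submoduleD[OF H(1)]
  obtain T where T: "finite T" "T \<subseteq> H" "mod_span K M T = H"
    using min[OF H(1,2)] H(3) x(1) unfolding finitely_spanned_def by blast
  have TM: "insert x T \<subseteq> carrier M" using subset_trans[OF T(2) h(1)] i(3)[OF x(1)] by simp
  have sp: "submodule (mod_span K M (insert x T)) K M" by (rule M.submodule_mod_span[OF TM])
  have "I \<subseteq> mod_span K M (insert x T)"
  proof
    fix y assume y: "y \<in> I"
    have HT: "H \<subseteq> mod_span K M (insert x T)" using T(3) M.mod_span_mono[of T "insert x T"] by auto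
    show "y \<in> mod_span K M (insert x T)"
    proof (cases "y \<in> H")
      case True then show ?thesis using HT by auto
    next
      case False
      \<comment> \<open>For \<open>y\<close> outside \<open>H\<close>, maximality of
        \<open>H\<close> forces \<open>x\<close> into the sum of \<open>H\<close> and the line of
        \<open>y\<close>. The coefficient of \<open>y\<close> is invertible on \<open>I\<close>, so
        conversely \<open>y\<close> lies in the span of \<open>x\<close> and
        \<open>H\<close>.\<close>
      let ?L = "{a \<odot>\<^bsub>M\<^esub> y | a. a \<in> carrier K} <+>\<^bsub>M\<^esub> H"
      have cy: "submodule {a \<odot>\<^bsub>M\<^esub> y | a. a \<in> carrier K} K M" by (rule M.submodule_cyclic[OF i(3)[OF y]])
      have L: "submodule ?L K M" by (rule M.submodule_set_add[OF cy H(1)])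
      have LI: "?L \<subseteq> I" by (rule M.set_add_least[OF I(1)]) (use i(5) y H(2) in auto)
      have yL: "y \<in> ?L" using M.set_add_upper(1)[OF cy H(1)] M.smult_one[OF i(3)[OF y]] by force
      have "x \<in> ?L" 
      proof (rule ccontr)
        assume "x \<notin> ?L"
        then have "?L = H" using Hmax[OF L LI _ M.set_add_upper(2)[OF cy H(1)]] by simp
        then show False using yL False by simp
      qed
      then obtain u z where u: "u \<in> {a \<odot>\<^bsub>M\<^esub> y | a. a \<in> carrier K}" and z: "z \<in> H" "x = u \<oplus>\<^bsub>M\<^esub> z" by (rule M.set_addE)
      from u obtain c where c: "c \<in> carrier K" "u = c \<odot>\<^bsub>M\<^esub> y" by blast
      have "u \<noteq> \<zero>\<^bsub>M\<^esub>" using z(2) H(3) h(3)[OF z(1)] z(1) by auto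
      then obtain d where d: "d \<in> carrier K" "d \<odot>\<^bsub>M\<^esub> (c \<odot>\<^bsub>M\<^esub> y) = y" 
        using unit[OF c(1) bexI[OF _ y]] y c(2) by auto
      have uM: "u \<in> carrier M" "z \<in> carrier M" using c i(3)[OF y] h(3)[OF z(1)] by auto
      have "x \<ominus>\<^bsub>M\<^esub> z = u" unfolding z(2) using uM by (simp add: M.minus_eq M.a_assoc M.r_neg)
      moreover have "x \<ominus>\<^bsub>M\<^esub> z \<in> mod_span K M (insert x T)"
        using M.submoduleD(7)[OF sp] M.mod_span_subset[of "insert x T"] HT z(1) by auto
      ultimately have "u \<in> mod_span K M (insert x T)" by simp
      then have "d \<odot>\<^bsub>M\<^esub> u \<in> mod_span K M (insert x T)" by (rule M.submoduleD(5)[OF sp d(1)])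
      then show ?thesis using d(2) c(2) by simp
    qed
  qed
  then have "?fg I" using T(1) subset_trans[OF T(2) H(2)] x(1)
    by (intro finitely_spannedI[OF assms(2) I(1), of "insert x T"]) simp_all
  then show False using I(2) by simp
qed

subsection \<open>Modules over artin algebras\<close>

definition restrict_scalars :: "('k \<Rightarrow> 'a) \<Rightarrow> ('a, 'm) module \<Rightarrow> ('k, 'm) module" where
  "restrict_scalars \<phi> M =
     \<lparr>carrier = carrier M, mult = mult M, one = one M, zero = zero M, add = add M,
      smult = (\<lambda>c x. \<phi> c \<odot>\<^bsub>M\<^esub> x)\<rparr>"

lemma restrict_scalars_simps [simp]:
  "carrier (restrict_scalars \<phi> M) = carrier M" "zero (restrict_scalars \<phi> M) = zero M"
  "add (restrict_scalars \<phi> M) = add M" "c \<odot>\<^bsub>restrict_scalars \<phi> M\<^esub> x = \<phi> c \<odot>\<^bsub>M\<^esub> x"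
  by (simp_all add: restrict_scalars_def)

locale artin_alg =
  fixes K :: "('k, 's) ring_scheme" and A :: "('a, 'r) ring_scheme" and \<phi> :: "'k \<Rightarrow> 'a"
  assumes artin: "artin_algebra K A \<phi>"
begin

lemma K_artinian: "artinian_cring K"
  and A_ring: "ring A"
  and \<phi>_hom: "\<phi> \<in> ring_hom K A"
  and \<phi>_central: "\<And>c x. \<lbrakk>c \<in> carrier K; x \<in> carrier A\<rbrakk> \<Longrightarrow> \<phi> c \<otimes>\<^bsub>A\<^esub> x = x \<otimes>\<^bsub>A\<^esub> \<phi> c"
  and A_fin_gen: "fin_gen K (base_module A \<phi>)"
  using artin unfolding artin_algebra_def by auto

lemma K_cring: "cring K"
  using K_artinian unfolding artinian_cring_def by simp

lemma \<phi>_closed [simp, intro]: "c \<in> carrier K \<Longrightarrow> \<phi> c \<in> carrier A"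
  using \<phi>_hom by (rule ring_hom_closed)

lemma \<phi>_smult_hom:
  assumes "left_module A M" "c \<in> carrier K"
  shows "(\<lambda>x. \<phi> c \<odot>\<^bsub>M\<^esub> x) \<in> mod_hom A M M"
proof -
  interpret left_module A M by fact
  show ?thesis
    by (rule mod_homI)
      (use assms(2) in \<open>auto simp: smult_r_distr smult_assoc[symmetric] \<phi>_central\<close>)
qed

lemma left_module_restrict_scalars:
  assumes "left_module A M"
  shows "left_module K (restrict_scalars \<phi> M)"
proof -
  interpret left_module A M by fact
  interpret K: cring K by (rule K_cring)
  have "abelian_group (restrict_scalars \<phi> M)"
  proof (rule abelian_groupI)
    fix x assume "x \<in> carrier (restrict_scalars \<phi> M)"
    then show "\<exists>y\<in>carrier (restrict_scalars \<phi> M).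
        y \<oplus>\<^bsub>restrict_scalars \<phi> M\<^esub> x = \<zero>\<^bsub>restrict_scalars \<phi> M\<^esub>"
      by (auto intro!: bexI[of _ "\<ominus>\<^bsub>M\<^esub> x"] simp: M.l_neg)
  qed (auto simp: M.a_ac)
  then show ?thesis
    by (intro left_module.intro left_module_axioms.intro K.ring_axioms)
      (auto simp: smult_l_distr smult_r_distr smult_assoc smult_one
        ring_hom_add[OF \<phi>_hom] ring_hom_mult[OF \<phi>_hom] ring_hom_one[OF \<phi>_hom])
qed

lemma submodule_restrict_scalars:
  assumes "left_module A M" "submodule H A M"
  shows "submodule H K (restrict_scalars \<phi> M)"
proof -
  interpret left_module A M by fact
  interpret R: left_module K "restrict_scalars \<phi> M" by (rule left_module_restrict_scalars[OF assms(1)])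
  show ?thesis using submoduleD[OF assms(2)] by (intro R.submoduleI) auto
qed

lemma mod_hom_restrict_scalars:
  "h \<in> mod_hom A M N \<Longrightarrow> h \<in> mod_hom K (restrict_scalars \<phi> M) (restrict_scalars \<phi> N)"
  by (rule mod_homI) (auto simp: mod_homD)

text \<open>With the identity as structure map, \<open>base_module\<close> is the regular module of
  \<open>A\<close>.\<close>

lemma A_left_module: "left_module A (base_module A (\<lambda>x. x))"
proof -
  interpret ring A by (rule A_ring)
  have "abelian_group (base_module A (\<lambda>x. x))"
  proof (rule abelian_groupI)
    fix x assume "x \<in> carrier (base_module A (\<lambda>x. x))"
    then show "\<exists>y\<in>carrier (base_module A (\<lambda>x. x)).
        y \<oplus>\<^bsub>base_module A (\<lambda>x. x)\<^esub> x = \<zero>\<^bsub>base_module A (\<lambda>x. x)\<^esub>"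
      by (auto intro!: bexI[of _ "\<ominus>\<^bsub>A\<^esub> x"] simp: l_neg base_module_def)
  qed (auto simp: a_ac base_module_def)
  then show ?thesis
    by (intro left_module.intro left_module_axioms.intro A_ring)
      (auto simp: base_module_def l_distr r_distr m_assoc)
qed

lemma base_module_restrict: "base_module A \<phi> = restrict_scalars \<phi> (base_module A (\<lambda>x. x))"
  by (simp add: base_module_def restrict_scalars_def)

text \<open>The products of \<open>K\<close>-generators of \<open>A\<close> with
  \<open>A\<close>-generators of \<open>M\<close> suffice. Their \<open>K\<close>-span is stable
  under \<open>A\<close>: in \<open>a (e m) = (a e) m\<close> the factor \<open>a e\<close> is again
  a \<open>K\<close>-combination of the generators of \<open>A\<close>.\<close>

lemma fin_gen_restrict_scalars:
  assumes "left_module A M" "fin_gen A M"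
  shows "fin_gen K (restrict_scalars \<phi> M)"
proof -
  interpret left_module A M by fact
  let ?R = "restrict_scalars \<phi> M" and ?A = "base_module A \<phi>" and ?A' = "base_module A (\<lambda>x. x)"
  interpret R: left_module K ?R by (rule left_module_restrict_scalars[OF assms(1)])
  interpret A': left_module A ?A' by (rule A_left_module)
  interpret AK: left_module K ?A
    unfolding base_module_restrict by (rule left_module_restrict_scalars[OF A_left_module])
  have carA: "carrier ?A' = carrier A" "carrier ?A = carrier A" by (simp_all add: base_module_def)
  obtain E where E: "finite E" "E \<subseteq> carrier A" "mod_span K ?A E = carrier A"
    using A_fin_gen unfolding fin_gen_def carA by blast
  obtain S where S: "finite S" "S \<subseteq> carrier M" "mod_span A M S = carrier M"
    using assms(2) unfolding fin_gen_def by blast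
  define T where "T = (\<lambda>(e, m). e \<odot>\<^bsub>M\<^esub> m) ` (E \<times> S)"
  have T: "finite T" "T \<subseteq> carrier ?R" using E S by (auto simp: T_def)
  let ?L = "mod_span K ?R T"
  have L: "submodule ?L K ?R" by (rule R.submodule_mod_span[OF T(2)])
  have L_car: "?L \<subseteq> carrier M" using R.submoduleD(1)[OF L] by simp
  have act: "(\<lambda>a. a \<odot>\<^bsub>M\<^esub> m) \<in> mod_hom K ?A ?R" if "m \<in> carrier M" for m
    unfolding base_module_restrict
    by (rule mod_hom_restrict_scalars, rule mod_homI)
      (use that in \<open>auto simp: base_module_def smult_l_distr smult_assoc\<close>)
  have AS: "a \<odot>\<^bsub>M\<^esub> m \<in> ?L" if "a \<in> carrier A" "m \<in> S" for a m
  proof -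
    have m: "m \<in> carrier M" using that S by auto
    have "carrier A \<subseteq> {a \<in> carrier ?A. a \<odot>\<^bsub>M\<^esub> m \<in> ?L}"
      unfolding E(3)[symmetric]
      using submodule_vimage[OF AK.left_module_axioms R.left_module_axioms act[OF m] L] E(2) that(2)
        R.mod_span_subset[of T]
      by (intro AK.mod_span_least) (auto simp: carA T_def)
    then show ?thesis using that(1) by auto
  qed
  have "submodule ?L A M"
  proof (rule submoduleI)
    fix a x assume a: "a \<in> carrier A" and x: "x \<in> ?L"
    have "(\<lambda>x. a \<odot>\<^bsub>M\<^esub> x) \<in> mod_hom K ?R ?R"
      by (rule mod_homI) (use a in \<open>auto simp: smult_r_distr smult_assoc[symmetric] \<phi>_central\<close>)
    from submodule_vimage[OF R.left_module_axioms R.left_module_axioms this L]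
    have "?L \<subseteq> {x \<in> carrier ?R. a \<odot>\<^bsub>M\<^esub> x \<in> ?L}"
    proof (rule R.mod_span_least)
      show "T \<subseteq> {x \<in> carrier ?R. a \<odot>\<^bsub>M\<^esub> x \<in> ?L}"
      proof
        fix t assume "t \<in> T"
        then obtain e m where em: "e \<in> E" "m \<in> S" "t = e \<odot>\<^bsub>M\<^esub> m" by (auto simp: T_def)
        have "a \<odot>\<^bsub>M\<^esub> t = (a \<otimes>\<^bsub>A\<^esub> e) \<odot>\<^bsub>M\<^esub> m" using em a E(2) S(2) by (auto simp: smult_assoc subset_iff)
        then have "a \<odot>\<^bsub>M\<^esub> t \<in> ?L" using AS[OF _ em(2)] a em(1) E(2) by auto
        then show "t \<in> {x \<in> carrier ?R. a \<odot>\<^bsub>M\<^esub> x \<in> ?L}" using \<open>t \<in> T\<close> T(2) by auto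
      qed
    qed
    then show "a \<odot>\<^bsub>M\<^esub> x \<in> ?L" using x by auto
  qed (use R.submoduleD[OF L] in auto)
  moreover have "S \<subseteq> ?L" using AS[OF A.one_closed] S(2) smult_one by force
  ultimately have "carrier M \<subseteq> ?L" unfolding S(3)[symmetric] by (rule mod_span_least)
  then show ?thesis unfolding fin_gen_def using T L_car by (intro exI[of _ T]) auto
qed

lemma noetherian_restrict_scalars:
  assumes "left_module A M" "fin_gen A M"
  shows "noetherian_module K (restrict_scalars \<phi> M)"
  by (intro dcc_imp_noetherian dcc_fin_gen K_artinian left_module_restrict_scalars fin_gen_restrict_scalars assms)

text \<open>Every \<open>A\<close>-submodule is a \<open>K\<close>-submodule, so chain conditions
  descend from \<open>K\<close> to \<open>A\<close>.\<close>

lemma dcc_fin_gen_module: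
  assumes "left_module A M" "fin_gen A M"
  shows "dcc_module A M"
proof -
  have "dcc_module K (restrict_scalars \<phi> M)"
    by (intro dcc_fin_gen K_artinian left_module_restrict_scalars fin_gen_restrict_scalars assms)
  then show ?thesis
    using submodule_restrict_scalars[OF assms(1)] unfolding dcc_module_def by blast
qed

lemma noetherian_fin_gen_module:
  assumes "left_module A M" "fin_gen A M"
  shows "noetherian_module A M"
  unfolding noetherian_module_def
proof (intro allI impI)
  interpret left_module A M by fact
  let ?R = "restrict_scalars \<phi> M"
  interpret R: left_module K ?R by (rule left_module_restrict_scalars[OF assms(1)])
  fix H assume H: "submodule H A M"
  obtain S where S: "finite S" "S \<subseteq> H" "mod_span K ?R S = H"
    using noetherian_restrict_scalars[OF assms] submodule_restrict_scalars[OF assms(1) H]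
    unfolding noetherian_module_def finitely_spanned_def by blast
  have S': "S \<subseteq> carrier M" using S(2) submoduleD(1)[OF H] by auto
  have "mod_span K ?R S \<subseteq> mod_span A M S"
    using submodule_restrict_scalars[OF assms(1) submodule_mod_span[OF S']] mod_span_subset
    by (intro R.mod_span_least) auto
  then show "finitely_spanned A M H" using S by (intro finitely_spannedI[OF assms(1) H, of S]) auto
qed

lemma fin_gen_submodule:
  assumes "left_module A M" "fin_gen A M" "submodule H A M"
  shows "fin_gen A (M\<lparr>carrier := H\<rparr>)"
proof -
  interpret left_module A M by fact
  obtain S where "finite S" "S \<subseteq> H" "mod_span A M S = H"
    using noetherian_fin_gen_module[OF assms(1,2)] assms(3)
    unfolding noetherian_module_def finitely_spanned_def by blast
  then show ?thesis unfolding fin_gen_def using mod_span_restrict[OF assms(3)] by auto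
qed

end

text \<open>The maps in \<open>F\<close> jointly embed \<open>I\<close> into a finite power of
  \<open>S\<close>. The power is never formed: one map \<open>e\<close> is removed at a time, its
  image being finitely generated in \<open>S\<close> and its kernel being separated by the remaining
  maps.\<close>

lemma finitely_spanned_separating:
  assumes U: "left_module K U" and S: "left_module K S" "noetherian_module K S"
    and F: "finite F" "F \<subseteq> mod_hom K U S"
    and I: "submodule I K U" "\<And>x. x \<in> I \<Longrightarrow> \<forall>e\<in>F. e x = \<zero>\<^bsub>S\<^esub> \<Longrightarrow> x = \<zero>\<^bsub>U\<^esub>"
  shows "finitely_spanned K U I"
  using F I
proof (induction F arbitrary: I rule: finite_induct)
  case empty
  interpret U: left_module K U by fact
  have "I = {\<zero>\<^bsub>U\<^esub>}" using empty.prems(3) U.submoduleD(2)[OF empty.prems(2)] by blast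
  then show ?case unfolding finitely_spanned_def using U.mod_span_empty by (intro exI[of _ "{}"]) simp
next
  case (insert e F)
  interpret U: left_module K U by fact
  have e: "e \<in> mod_hom K U S" using insert.prems(1) by simp
  let ?k = "{x \<in> I. e x = \<zero>\<^bsub>S\<^esub>}"
  have "I \<inter> mod_kernel U S e = ?k"
    using U.submoduleD(1)[OF insert.prems(2)] by (auto simp: mod_kernel_def)
  then have k: "submodule ?k K U"
    using U.submodule_Int[OF insert.prems(2) submodule_kernel[OF U S(1) e]] by simp
  have "finitely_spanned K U ?k" using insert.prems by (intro insert.IH k) auto
  moreover have "finitely_spanned K S (e ` I)"
    using S(2) submodule_image[OF U S(1) e insert.prems(2)] unfolding noetherian_module_def by simp
  ultimately show ?case by (intro finitely_spanned_extension[OF U S(1) e insert.prems(2)])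
qed

subsection \<open>Modules of homomorphisms\<close>

text \<open>Requiring \<open>extensional\<close> functions turns equality on the carrier into
  equality of elements, so that the module laws can hold literally.\<close>

definition hom_mod ::
  "('a, 'r) ring_scheme \<Rightarrow> ('k \<Rightarrow> 'a) \<Rightarrow> ('a, 'm) module \<Rightarrow> ('a, 'q) module \<Rightarrow> ('k, 'm \<Rightarrow> 'q) module"
  where "hom_mod A \<phi> M N =
    \<lparr>carrier = mod_hom A M N \<inter> extensional (carrier M), mult = undefined, one = undefined,
     zero = (\<lambda>x\<in>carrier M. \<zero>\<^bsub>N\<^esub>), add = (\<lambda>f g. \<lambda>x\<in>carrier M. f x \<oplus>\<^bsub>N\<^esub> g x),
     smult = (\<lambda>c f. \<lambda>x\<in>carrier M. \<phi> c \<odot>\<^bsub>N\<^esub> f x)\<rparr>"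

lemma hom_mod_simps:
  "carrier (hom_mod A \<phi> M N) = mod_hom A M N \<inter> extensional (carrier M)"
  "zero (hom_mod A \<phi> M N) = (\<lambda>x\<in>carrier M. \<zero>\<^bsub>N\<^esub>)"
  "f \<oplus>\<^bsub>hom_mod A \<phi> M N\<^esub> g = (\<lambda>x\<in>carrier M. f x \<oplus>\<^bsub>N\<^esub> g x)"
  "c \<odot>\<^bsub>hom_mod A \<phi> M N\<^esub> f = (\<lambda>x\<in>carrier M. \<phi> c \<odot>\<^bsub>N\<^esub> f x)"
  by (simp_all add: hom_mod_def)

text \<open>Maps into a submodule form a homomorphism module that differs from the large one only in
  its carrier, so the facts about restricted carriers apply to it.\<close>

lemma hom_mod_restrict: "hom_mod A \<phi> M (N\<lparr>carrier := H\<rparr>) =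
    (hom_mod A \<phi> M N)\<lparr>carrier := carrier (hom_mod A \<phi> M (N\<lparr>carrier := H\<rparr>))\<rparr>"
  by (simp add: hom_mod_def)

lemma restrict_mod_hom:
  assumes "left_module A M" "h \<in> mod_hom A M N"
  shows "restrict h (carrier M) \<in> carrier (hom_mod A \<phi> M N)"
  using mod_hom_cong[OF assms(2,1)] by (simp add: hom_mod_simps)

lemma hom_modD:
  assumes "f \<in> carrier (hom_mod A \<phi> M N)"
  shows "f \<in> mod_hom A M N" "\<And>x. x \<in> carrier M \<Longrightarrow> f x \<in> carrier N"
proof -
  show f: "f \<in> mod_hom A M N" using assms by (simp add: hom_mod_simps)
  show "\<And>x. x \<in> carrier M \<Longrightarrow> f x \<in> carrier N" by (rule mod_homD(1)[OF f])
qed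

lemma hom_mod_eqI:
  assumes "f \<in> carrier (hom_mod A \<phi> M N)" "g \<in> carrier (hom_mod A \<phi> M' N')" "carrier M' = carrier M"
    "\<And>x. x \<in> carrier M \<Longrightarrow> f x = g x"
  shows "f = g"
proof (rule extensionalityI)
  show "f \<in> extensional (carrier M)" using assms(1) by (simp add: hom_mod_simps)
  show "g \<in> extensional (carrier M)" using assms(2,3) by (simp add: hom_mod_simps)
qed (rule assms(4))

context artin_alg
begin

lemma left_module_hom_mod:
  assumes M: "left_module A M" and N: "left_module A N"
  shows "left_module K (hom_mod A \<phi> M N)" (is "left_module K ?H")
proof -
  interpret M: left_module A M by fact
  interpret N: left_module A N by fact
  interpret K: cring K by (rule K_cring)
  interpret R: left_module K "restrict_scalars \<phi> N" by (rule left_module_restrict_scalars[OF N])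
  have add: "f \<oplus>\<^bsub>?H\<^esub> g \<in> carrier ?H" if "f \<in> carrier ?H" "g \<in> carrier ?H" for f g
    using restrict_mod_hom[OF M mod_hom_add[OF N hom_modD(1)[OF that(1)] hom_modD(1)[OF that(2)]]]
    by (simp add: hom_mod_simps(3))
  have zero: "\<zero>\<^bsub>?H\<^esub> \<in> carrier ?H"
    using restrict_mod_hom[OF M mod_hom_zero_map[OF N]] by (simp add: hom_mod_simps(2))
  have smult: "c \<odot>\<^bsub>?H\<^esub> f \<in> carrier ?H" if "c \<in> carrier K" "f \<in> carrier ?H" for c f
    using restrict_mod_hom[OF M mod_hom_comp[OF hom_modD(1)[OF that(2)] \<phi>_smult_hom[OF N that(1)]]]
    by (simp add: hom_mod_simps(4))
  have ext: "(\<lambda>x\<in>carrier M. f x) = f" if "f \<in> carrier ?H" for f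
    using that by (simp add: hom_mod_simps extensional_restrict)
  note D = hom_modD(2)[of _ A \<phi> M N]
  have grp: "abelian_group ?H"
  proof (rule abelian_groupI)
    fix f assume f: "f \<in> carrier ?H"
    show "\<zero>\<^bsub>?H\<^esub> \<oplus>\<^bsub>?H\<^esub> f = f"
      by (rule hom_mod_eqI[OF add[OF zero f] f]) (use D[OF f] in \<open>auto simp: hom_mod_simps(2,3)\<close>)
    have n: "(\<lambda>x\<in>carrier M. \<ominus>\<^bsub>N\<^esub> f x) \<in> carrier ?H"
      by (rule restrict_mod_hom[OF M mod_hom_uminus_map[OF N hom_modD(1)[OF f]]])
    show "\<exists>g\<in>carrier ?H. g \<oplus>\<^bsub>?H\<^esub> f = \<zero>\<^bsub>?H\<^esub>"
      by (rule bexI[OF _ n], rule hom_mod_eqI[OF add[OF n f] zero])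
        (use D[OF f] in \<open>auto simp: hom_mod_simps(2,3) N.l_neg\<close>)
  next
    fix f g assume fg: "f \<in> carrier ?H" "g \<in> carrier ?H"
    show "f \<oplus>\<^bsub>?H\<^esub> g = g \<oplus>\<^bsub>?H\<^esub> f"
      by (rule hom_mod_eqI[OF add[OF fg] add[OF fg(2,1)]])
        (use D[OF fg(1)] D[OF fg(2)] in \<open>auto simp: hom_mod_simps(3) N.a_comm\<close>)
    fix h assume h: "h \<in> carrier ?H"
    show "f \<oplus>\<^bsub>?H\<^esub> g \<oplus>\<^bsub>?H\<^esub> h = f \<oplus>\<^bsub>?H\<^esub> (g \<oplus>\<^bsub>?H\<^esub> h)"
      by (rule hom_mod_eqI[OF add[OF add[OF fg] h] add[OF fg(1) add[OF fg(2) h]]])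
        (use D[OF fg(1)] D[OF fg(2)] D[OF h] in \<open>auto simp: hom_mod_simps(3) N.a_assoc\<close>)
  qed (use add zero in auto)
  show ?thesis
  proof (intro left_module.intro left_module_axioms.intro K.ring_axioms grp smult)
    fix c d f assume c: "c \<in> carrier K" "d \<in> carrier K" and f: "f \<in> carrier ?H"
    show "(c \<oplus>\<^bsub>K\<^esub> d) \<odot>\<^bsub>?H\<^esub> f = c \<odot>\<^bsub>?H\<^esub> f \<oplus>\<^bsub>?H\<^esub> d \<odot>\<^bsub>?H\<^esub> f"
      by (rule hom_mod_eqI[OF smult add[OF smult smult]])
        (use D[OF f] c f R.smult_l_distr[of c d] in \<open>auto simp: hom_mod_simps(3,4)\<close>)
    show "(c \<otimes>\<^bsub>K\<^esub> d) \<odot>\<^bsub>?H\<^esub> f = c \<odot>\<^bsub>?H\<^esub> (d \<odot>\<^bsub>?H\<^esub> f)"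
      by (rule hom_mod_eqI[OF smult smult[OF _ smult]])
        (use D[OF f] c f R.smult_assoc[of c d] in \<open>auto simp: hom_mod_simps(3,4)\<close>)
  next
    fix c f g assume c: "c \<in> carrier K" and f: "f \<in> carrier ?H" "g \<in> carrier ?H"
    show "c \<odot>\<^bsub>?H\<^esub> (f \<oplus>\<^bsub>?H\<^esub> g) = c \<odot>\<^bsub>?H\<^esub> f \<oplus>\<^bsub>?H\<^esub> c \<odot>\<^bsub>?H\<^esub> g"
      by (rule hom_mod_eqI[OF smult[OF _ add] add[OF smult smult]])
        (use D[OF f(1)] D[OF f(2)] c f R.smult_r_distr[of c] in \<open>auto simp: hom_mod_simps(3,4)\<close>)
  next
    fix f assume f: "f \<in> carrier ?H"
    show "\<one>\<^bsub>K\<^esub> \<odot>\<^bsub>?H\<^esub> f = f"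
      by (rule hom_mod_eqI[OF smult])
        (use D[OF f] f R.smult_one in \<open>auto simp: hom_mod_simps(3,4)\<close>)
  qed
qed

lemma hom_mod_uminus:
  assumes M: "left_module A M" and N: "left_module A N" and f: "f \<in> carrier (hom_mod A \<phi> M N)"
  shows "\<ominus>\<^bsub>hom_mod A \<phi> M N\<^esub> f = (\<lambda>x\<in>carrier M. \<ominus>\<^bsub>N\<^esub> f x)"
proof -
  interpret N: left_module A N by fact
  interpret H: left_module K "hom_mod A \<phi> M N" by (rule left_module_hom_mod[OF M N])
  have n: "(\<lambda>x\<in>carrier M. \<ominus>\<^bsub>N\<^esub> f x) \<in> carrier (hom_mod A \<phi> M N)"
    by (rule restrict_mod_hom[OF M mod_hom_uminus_map[OF N hom_modD(1)[OF f]]])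
  have "(\<lambda>x\<in>carrier M. \<ominus>\<^bsub>N\<^esub> f x) \<oplus>\<^bsub>hom_mod A \<phi> M N\<^esub> f = \<zero>\<^bsub>hom_mod A \<phi> M N\<^esub>"
    by (rule hom_mod_eqI[OF H.M.a_closed[OF n f] H.M.zero_closed])
      (use hom_modD(2)[OF f] in \<open>auto simp: hom_mod_simps(2,3) N.l_neg\<close>)
  then show ?thesis using H.M.minus_equality f n by blast
qed

lemma hom_mod_minus:
  assumes M: "left_module A M" and N: "left_module A N"
    and "f \<in> carrier (hom_mod A \<phi> M N)" "g \<in> carrier (hom_mod A \<phi> M N)"
  shows "f \<ominus>\<^bsub>hom_mod A \<phi> M N\<^esub> g = (\<lambda>x\<in>carrier M. f x \<ominus>\<^bsub>N\<^esub> g x)"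
  unfolding a_minus_def[of "hom_mod A \<phi> M N"] hom_mod_uminus[OF M N assms(4)] hom_mod_simps(3)
  by (rule restrict_ext) (simp add: a_minus_def)

text \<open>Evaluations at the generators of \<open>M\<close> are \<open>K\<close>-linear and
  jointly injective, with values in \<open>N\<close>, which is noetherian over
  \<open>K\<close>.\<close>

lemma fin_gen_hom_mod:
  assumes M: "left_module A M" "fin_gen A M" and N: "left_module A N" "fin_gen A N"
  shows "fin_gen K (hom_mod A \<phi> M N)"
proof -
  interpret M: left_module A M by (rule M(1))
  interpret N: left_module A N by (rule N(1))
  let ?H = "hom_mod A \<phi> M N" and ?R = "restrict_scalars \<phi> N"
  interpret H: left_module K ?H by (rule left_module_hom_mod[OF M(1) N(1)])
  interpret R: left_module K ?R by (rule left_module_restrict_scalars[OF N(1)])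
  obtain S where S: "finite S" "S \<subseteq> carrier M" "mod_span A M S = carrier M"
    using M(2) unfolding fin_gen_def by blast
  have "finitely_spanned K ?H (carrier ?H)"
  proof (rule finitely_spanned_separating[OF H.left_module_axioms R.left_module_axioms
        noetherian_restrict_scalars[OF N], of "(\<lambda>s f. f s) ` S"])
    show "(\<lambda>s f. f s) ` S \<subseteq> mod_hom K ?H ?R"
      using S(2) by (auto intro!: mod_homI simp: hom_modD(2) hom_mod_simps(3,4))
    fix f assume f: "f \<in> carrier ?H" and z: "\<forall>e\<in>(\<lambda>s f. f s) ` S. e f = \<zero>\<^bsub>?R\<^esub>"
    note fh = hom_modD(1)[OF f]
    have "mod_span A M S \<subseteq> mod_kernel M N f"
      using z S(2) by (intro M.mod_span_least submodule_kernel[OF M(1) N(1) fh]) (auto simp: mod_kernel_def)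
    then show "f = \<zero>\<^bsub>?H\<^esub>" unfolding S(3)
      by (intro hom_mod_eqI[OF f H.M.zero_closed refl]) (auto simp: mod_kernel_def hom_mod_simps(2))
  qed (use S(1) H.submodule_carrier in auto)
  then show ?thesis unfolding finitely_spanned_def fin_gen_def .
qed

end

subsection \<open>A duality lemma\<close>

text \<open>
  A submodule \<open>B\<close> such that any two elements outside \<open>B\<close> are proportional modulo \<open>B\<close> plays the
  role of the kernel of a linear functional with values in a field.
\<close>

locale pairing =
  G: left_module K G + U: left_module K U + H: left_module K H
  for K :: "('k, 's) ring_scheme" and G :: "('k, 'g) module" and U :: "('k, 'u) module"
    and H :: "('k, 'h) module" +
  fixes b :: "'g \<Rightarrow> 'u \<Rightarrow> 'h" and B :: "'h set"
  assumes b_left: "\<And>u. u \<in> carrier U \<Longrightarrow> (\<lambda>g. b g u) \<in> mod_hom K G H"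
    and b_right: "\<And>g. g \<in> carrier G \<Longrightarrow> b g \<in> mod_hom K U H"
    and B: "submodule B K H"
    and hyperplane: "\<And>h h'. \<lbrakk>h \<in> carrier H; h \<notin> B; h' \<in> carrier H\<rbrakk>
          \<Longrightarrow> \<exists>c\<in>carrier K. h' \<ominus>\<^bsub>H\<^esub> c \<odot>\<^bsub>H\<^esub> h \<in> B"
    and separating: "\<And>g. \<lbrakk>g \<in> carrier G; g \<noteq> \<zero>\<^bsub>G\<^esub>\<rbrakk> \<Longrightarrow> \<exists>u\<in>carrier U. b g u \<notin> B"
begin

lemma b_closed [simp, intro]: "\<lbrakk>g \<in> carrier G; u \<in> carrier U\<rbrakk> \<Longrightarrow> b g u \<in> carrier H"
  by (rule mod_homD(1)[OF b_right])

lemmas B' = H.submoduleD[OF B]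

lemma b_left_comb:
  "\<lbrakk>g \<in> carrier G; h \<in> carrier G; c \<in> carrier K; u \<in> carrier U\<rbrakk>
    \<Longrightarrow> b (g \<ominus>\<^bsub>G\<^esub> c \<odot>\<^bsub>G\<^esub> h) u = b g u \<ominus>\<^bsub>H\<^esub> c \<odot>\<^bsub>H\<^esub> b h u"
  using mod_hom_minus[OF G.left_module_axioms H.left_module_axioms b_left] mod_homD(3)[OF b_left] by simp

lemma b_right_comb:
  "\<lbrakk>g \<in> carrier G; u \<in> carrier U; v \<in> carrier U; c \<in> carrier K\<rbrakk>
    \<Longrightarrow> b g (u \<ominus>\<^bsub>U\<^esub> c \<odot>\<^bsub>U\<^esub> v) = b g u \<ominus>\<^bsub>H\<^esub> c \<odot>\<^bsub>H\<^esub> b g v"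
  using mod_hom_minus[OF U.left_module_axioms H.left_module_axioms b_right] mod_homD(3)[OF b_right] by simp

lemma comb_in_B: "\<lbrakk>x \<in> B; y \<in> B; c \<in> carrier K\<rbrakk> \<Longrightarrow> x \<ominus>\<^bsub>H\<^esub> c \<odot>\<^bsub>H\<^esub> y \<in> B"
  by (intro B'(7) B'(5))

lemma comb_in_B_iff:
  assumes "x \<in> carrier H" "y \<in> B" "c \<in> carrier K"
  shows "x \<ominus>\<^bsub>H\<^esub> c \<odot>\<^bsub>H\<^esub> y \<in> B \<longleftrightarrow> x \<in> B"
proof
  have cy: "c \<odot>\<^bsub>H\<^esub> y \<in> B" "c \<odot>\<^bsub>H\<^esub> y \<in> carrier H" using B'(5)[OF assms(3,2)] B'(3) by auto
  assume "x \<ominus>\<^bsub>H\<^esub> c \<odot>\<^bsub>H\<^esub> y \<in> B"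
  from B'(4)[OF this cy(1)] show "x \<in> B"
    using assms(1) cy(2) by (simp add: H.M.minus_eq H.M.a_assoc H.M.l_neg)
qed (use comb_in_B assms in auto)

text \<open>The double annihilator property of a nondegenerate pairing, with \<open>B\<close> in the
  role of zero. For empty \<open>S\<close> it is the axiom \<open>separating\<close>; each further
  element of \<open>S\<close> is handled by one elimination step.\<close>

lemma annihilator_separates:
  assumes "finite S" "S \<subseteq> carrier G" "g \<in> carrier G" "g \<notin> mod_span K G S"
  shows "\<exists>u\<in>carrier U. (\<forall>s\<in>S. b s u \<in> B) \<and> b g u \<notin> B"
  using assms
proof (induction S arbitrary: g rule: finite_induct)
  case empty
  then show ?case using separating G.mod_span_empty by auto
next
  case (insert h S)
  have S: "h \<in> carrier G" "S \<subseteq> carrier G" using insert.prems by auto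
  have sp: "submodule (mod_span K G S) K G" "submodule (mod_span K G (insert h S)) K G"
    using S by (auto intro!: G.submodule_mod_span)
  have gS: "g \<notin> mod_span K G S" using insert.prems(3) G.mod_span_mono[of S "insert h S"] by auto
  show ?case
  proof (cases "h \<in> mod_span K G S")
    case True
    obtain u where u: "u \<in> carrier U" "\<forall>s\<in>S. b s u \<in> B" "b g u \<notin> B"
      using insert.IH[OF S(2) insert.prems(2) gS] by blast
    have "mod_span K G S \<subseteq> {s \<in> carrier G. b s u \<in> B}"
      using u(2) S(2)
      by (intro G.mod_span_least submodule_vimage[OF G.left_module_axioms H.left_module_axioms b_left[OF u(1)] B])
        auto
    then show ?thesis using u True by auto
  next
    case False
    obtain v where v: "v \<in> carrier U" "\<forall>s\<in>S. b s v \<in> B" "b h v \<notin> B"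
      using insert.IH[OF S(2,1) False] by blast
    obtain c where c: "c \<in> carrier K" "b g v \<ominus>\<^bsub>H\<^esub> c \<odot>\<^bsub>H\<^esub> b h v \<in> B"
      using hyperplane[OF b_closed[OF S(1) v(1)] v(3) b_closed[OF insert.prems(2) v(1)]] by blast
    \<comment> \<open>\<open>g\<close> is shifted by a multiple of \<open>h\<close> until
      \<open>v\<close> annihilates it modulo \<open>B\<close>. Some \<open>u\<close> detecting
      \<open>g'\<close> can then be corrected by a multiple of \<open>v\<close> so that it
      annihilates \<open>h\<close>, with no change at \<open>g'\<close> modulo \<open>B\<close>.
      Since the result \<open>w\<close> annihilates \<open>h\<close>, it does not distinguish
      \<open>g\<close> from \<open>g'\<close>.\<close>
    define g' where "g' = g \<ominus>\<^bsub>G\<^esub> c \<odot>\<^bsub>G\<^esub> h"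
    have g': "g' \<in> carrier G" using c S(1) insert.prems(2) by (simp add: g'_def)
    have g'v: "b g' v \<in> B" using c S(1) insert.prems(2) v(1) by (simp add: g'_def b_left_comb)
    have "g' \<notin> mod_span K G S"
    proof
      assume "g' \<in> mod_span K G S"
      then have "g' \<in> mod_span K G (insert h S)" using G.mod_span_mono[of S "insert h S"] by auto
      moreover have "c \<odot>\<^bsub>G\<^esub> h \<in> mod_span K G (insert h S)"
        using G.submoduleD(5)[OF sp(2) c(1)] G.mod_span_subset[of "insert h S"] by auto
      ultimately have "g' \<oplus>\<^bsub>G\<^esub> c \<odot>\<^bsub>G\<^esub> h \<in> mod_span K G (insert h S)"
        by (rule G.submoduleD(4)[OF sp(2)])
      then show False using insert.prems(2,3) S(1) c(1)
        by (simp add: g'_def G.M.minus_eq G.M.a_assoc G.M.l_neg)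
    qed
    then obtain u where u: "u \<in> carrier U" "\<forall>s\<in>S. b s u \<in> B" "b g' u \<notin> B"
      using insert.IH[OF S(2) g'] by blast
    obtain d where d: "d \<in> carrier K" "b h u \<ominus>\<^bsub>H\<^esub> d \<odot>\<^bsub>H\<^esub> b h v \<in> B"
      using hyperplane[OF b_closed[OF S(1) v(1)] v(3) b_closed[OF S(1) u(1)]] by blast
    define w where "w = u \<ominus>\<^bsub>U\<^esub> d \<odot>\<^bsub>U\<^esub> v"
    have w: "w \<in> carrier U" using u v d by (simp add: w_def)
    have hw: "b h w \<in> B" using d S(1) u(1) v(1) by (simp add: w_def b_right_comb)
    have sw: "b s w \<in> B" if "s \<in> S" for s
      using that d(1) S(2) u(1,2) v(1,2) comb_in_B by (auto simp: w_def b_right_comb subset_iff)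
    have "b g' w \<notin> B"
      using u(3) comb_in_B_iff[OF b_closed[OF g' u(1)] g'v d(1)] d(1) u(1) v(1) g'
      by (simp add: w_def b_right_comb)
    then have "b g w \<notin> B"
      using comb_in_B_iff[OF b_closed[OF insert.prems(2) w] hw c(1)] c(1) S(1) insert.prems(2) w
      by (simp add: g'_def b_left_comb)
    then show ?thesis using w hw sw by auto
  qed
qed

text \<open>Riesz representation modulo \<open>B\<close>, by interpolation on a generating set.
  Agreement on a set extends to its span; at a generator outside the span, a \<open>v\<close> that
  annihilates the earlier generators but not this one adjusts the value there and spoils
  nothing.\<close>

lemma functional_represented:
  assumes "fin_gen K G" and \<psi>: "\<psi> \<in> mod_hom K G H"
  shows "\<exists>u\<in>carrier U. \<forall>g\<in>carrier G. b g u \<ominus>\<^bsub>H\<^esub> \<psi> g \<in> B"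
proof -
  have diff: "(\<lambda>g. b g u \<ominus>\<^bsub>H\<^esub> \<psi> g) \<in> mod_hom K G H" if "u \<in> carrier U" for u
    by (rule mod_hom_minus_map[OF H.left_module_axioms b_left[OF that] \<psi>])
  have ext: "mod_span K G S \<subseteq> {g \<in> carrier G. b g u \<ominus>\<^bsub>H\<^esub> \<psi> g \<in> B}"
    if "u \<in> carrier U" "S \<subseteq> carrier G" "\<forall>g\<in>S. b g u \<ominus>\<^bsub>H\<^esub> \<psi> g \<in> B" for u S
    using that(2,3)
    by (intro G.mod_span_least
        submodule_vimage[OF G.left_module_axioms H.left_module_axioms diff[OF that(1)] B]) auto
  have main: "\<exists>u\<in>carrier U. \<forall>g\<in>S. b g u \<ominus>\<^bsub>H\<^esub> \<psi> g \<in> B" if "finite S" "S \<subseteq> carrier G" for S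
    using that
  proof (induction S rule: finite_induct)
    case empty
    then show ?case using U.M.zero_closed by auto
  next
    case (insert h S)
    have S: "h \<in> carrier G" "S \<subseteq> carrier G" using insert.prems by auto
    obtain u where u: "u \<in> carrier U" "\<forall>g\<in>S. b g u \<ominus>\<^bsub>H\<^esub> \<psi> g \<in> B" using insert by auto
    show ?case
    proof (cases "h \<in> mod_span K G S")
      case True
      then show ?thesis using u ext[OF u(1) S(2) u(2)] by auto
    next
      case False
      obtain v where v: "v \<in> carrier U" "\<forall>s\<in>S. b s v \<in> B" "b h v \<notin> B"
        using annihilator_separates[OF insert.hyps(1) S(2,1) False] by blast
      have \<psi>c: "\<psi> g \<in> carrier H" if "g \<in> carrier G" for g using mod_homD(1)[OF \<psi> that] .
      have "b h u \<ominus>\<^bsub>H\<^esub> \<psi> h \<in> carrier H" using u(1) S(1) \<psi>c by simp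
      then obtain c where c: "c \<in> carrier K" "(b h u \<ominus>\<^bsub>H\<^esub> \<psi> h) \<ominus>\<^bsub>H\<^esub> c \<odot>\<^bsub>H\<^esub> b h v \<in> B"
        using hyperplane[OF b_closed[OF S(1) v(1)] v(3)] by blast
      define w where "w = u \<ominus>\<^bsub>U\<^esub> c \<odot>\<^bsub>U\<^esub> v"
      have w: "w \<in> carrier U" using u v c by (simp add: w_def)
      have eq: "b g w \<ominus>\<^bsub>H\<^esub> \<psi> g = (b g u \<ominus>\<^bsub>H\<^esub> \<psi> g) \<ominus>\<^bsub>H\<^esub> c \<odot>\<^bsub>H\<^esub> b g v" if "g \<in> carrier G" for g
      proof -
        have "b g w = b g u \<ominus>\<^bsub>H\<^esub> c \<odot>\<^bsub>H\<^esub> b g v" using that u(1) v(1) c(1) by (simp add: w_def b_right_comb)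
        then show ?thesis using that u(1) v(1) c(1) \<psi>c[OF that] by (simp add: H.M.minus_eq H.M.a_ac)
      qed
      have "b g w \<ominus>\<^bsub>H\<^esub> \<psi> g \<in> B" if "g \<in> S" for g
        using eq[of g] that S(2) comb_in_B[of "b g u \<ominus>\<^bsub>H\<^esub> \<psi> g" "b g v" c] u(2) v(2) c(1) by auto
      moreover have "b h w \<ominus>\<^bsub>H\<^esub> \<psi> h \<in> B" using eq[OF S(1)] c(2) by simp
      ultimately show ?thesis using w by auto
    qed
  qed
  obtain S where S: "finite S" "S \<subseteq> carrier G" "mod_span K G S = carrier G"
    using assms(1) unfolding fin_gen_def by blast
  then obtain u where u: "u \<in> carrier U" "\<forall>g\<in>S. b g u \<ominus>\<^bsub>H\<^esub> \<psi> g \<in> B" using main by blast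
  then show ?thesis using ext[OF u(1) S(2) u(2)] unfolding S(3) by auto
qed

end

subsection \<open>Semisimple modules\<close>

lemma factor_through_surjection:
  assumes M: "left_module A M" and N: "left_module A N" and L: "left_module A L"
    and p: "p \<in> mod_hom A M N" "p ` carrier M = carrier N"
    and h: "h \<in> mod_hom A M L" "\<And>x. \<lbrakk>x \<in> carrier M; p x = \<zero>\<^bsub>N\<^esub>\<rbrakk> \<Longrightarrow> h x = \<zero>\<^bsub>L\<^esub>"
  obtains t where "t \<in> mod_hom A N L" "\<And>x. x \<in> carrier M \<Longrightarrow> t (p x) = h x"
proof -
  interpret M: left_module A M by fact
  interpret N: left_module A N by fact
  interpret L: left_module A L by fact
  note ph = mod_homD[OF p(1)] and hh = mod_homD[OF h(1)]
  define t where "t y = h (SOME x. x \<in> carrier M \<and> p x = y)" for y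
  have tp: "t (p x) = h x" if x: "x \<in> carrier M" for x
  proof -
    define x' where "x' = (SOME x'. x' \<in> carrier M \<and> p x' = p x)"
    have x': "x' \<in> carrier M" "p x' = p x"
      using someI[of "\<lambda>x'. x' \<in> carrier M \<and> p x' = p x" x] x by (auto simp: x'_def)
    have "p (x' \<ominus>\<^bsub>M\<^esub> x) = \<zero>\<^bsub>N\<^esub>"
      using mod_hom_minus[OF M N p(1) x'(1) x] x' x ph(1) N.minus_eq_zero_iff by simp
    then have "h x' \<ominus>\<^bsub>L\<^esub> h x = \<zero>\<^bsub>L\<^esub>" using h(2) mod_hom_minus[OF M L h(1) x'(1) x] x x'(1) by simp
    then show ?thesis using L.minus_eq_zero_iff[OF hh(1)[OF x'(1)] hh(1)[OF x]]
      by (simp add: t_def x'_def)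
  qed
  have ex: "\<exists>x\<in>carrier M. y = p x" if "y \<in> carrier N" for y using p(2) that by auto
  have "t \<in> mod_hom A N L"
  proof (rule mod_homI)
    fix y assume "y \<in> carrier N"
    then obtain x where "x \<in> carrier M" "y = p x" using ex by blast
    then show "t y \<in> carrier L" using tp hh(1) by simp
  next
    fix y y' assume "y \<in> carrier N" "y' \<in> carrier N"
    then obtain x x' where x: "x \<in> carrier M" "y = p x" "x' \<in> carrier M" "y' = p x'" using ex by metis
    then have "y \<oplus>\<^bsub>N\<^esub> y' = p (x \<oplus>\<^bsub>M\<^esub> x')" using ph(2) by simp
    then show "t (y \<oplus>\<^bsub>N\<^esub> y') = t y \<oplus>\<^bsub>L\<^esub> t y'" using x tp[of "x \<oplus>\<^bsub>M\<^esub> x'"] tp[of x] tp[of x'] hh(2) by simp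
  next
    fix a y assume a: "a \<in> carrier A" and "y \<in> carrier N"
    then obtain x where x: "x \<in> carrier M" "y = p x" using ex by blast
    then have "a \<odot>\<^bsub>N\<^esub> y = p (a \<odot>\<^bsub>M\<^esub> x)" using ph(3) a by simp
    then show "t (a \<odot>\<^bsub>N\<^esub> y) = a \<odot>\<^bsub>L\<^esub> t y" using x a tp[of "a \<odot>\<^bsub>M\<^esub> x"] tp[of x] hh(3) by simp
  qed
  then show thesis using that tp by blast
qed

context left_module
begin

lemma add_minus_left: "\<lbrakk>x \<in> carrier M; y \<in> carrier M\<rbrakk> \<Longrightarrow> (x \<oplus>\<^bsub>M\<^esub> y) \<ominus>\<^bsub>M\<^esub> x = y"
  by (simp add: M.minus_eq M.a_assoc M.a_comm[of y "\<ominus>\<^bsub>M\<^esub> x"] M.r_neg2)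

lemma add_minus_right: "\<lbrakk>x \<in> carrier M; y \<in> carrier M\<rbrakk> \<Longrightarrow> (x \<oplus>\<^bsub>M\<^esub> y) \<ominus>\<^bsub>M\<^esub> y = x"
  by (simp add: M.minus_eq M.a_assoc M.r_neg)

lemma minus_zero_right: "x \<in> carrier M \<Longrightarrow> x \<ominus>\<^bsub>M\<^esub> \<zero>\<^bsub>M\<^esub> = x"
  using add_minus_right[of x "\<zero>\<^bsub>M\<^esub>"] by simp

lemma minus_self: "x \<in> carrier M \<Longrightarrow> x \<ominus>\<^bsub>M\<^esub> x = \<zero>\<^bsub>M\<^esub>"
  by (simp add: M.minus_eq M.r_neg)

text \<open>The component \<open>p x\<close> is pinned down by \<open>x - p x\<close> being in
  \<open>C\<close>: two candidates differ by an element of \<open>N\<close> and of \<open>C\<close>,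
  hence by zero. Linearity follows from this uniqueness.\<close>

lemma direct_sum_projections:
  assumes N: "submodule N A M" and C: "submodule C A M" and NC: "N \<inter> C = {\<zero>\<^bsub>M\<^esub>}"
  obtains p where "p \<in> mod_hom A (M\<lparr>carrier := N <+>\<^bsub>M\<^esub> C\<rparr>) (M\<lparr>carrier := N\<rparr>)"
    "\<And>x. x \<in> N <+>\<^bsub>M\<^esub> C \<Longrightarrow> x \<ominus>\<^bsub>M\<^esub> p x \<in> C"
    "\<And>x. x \<in> N \<Longrightarrow> p x = x" "\<And>x. x \<in> C \<Longrightarrow> p x = \<zero>\<^bsub>M\<^esub>"
proof -
  note n = submoduleD[OF N] and c = submoduleD[OF C]
  let ?D = "N <+>\<^bsub>M\<^esub> C"
  have D: "submodule ?D A M" by (rule submodule_set_add[OF N C])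
  define p where "p x = (THE y. y \<in> N \<and> x \<ominus>\<^bsub>M\<^esub> y \<in> C)" for x
  have peq: "p x = y" if "y \<in> N" "x \<ominus>\<^bsub>M\<^esub> y \<in> C" "x \<in> carrier M" for x y
    unfolding p_def
  proof (rule the_equality)
    fix z assume z: "z \<in> N \<and> x \<ominus>\<^bsub>M\<^esub> z \<in> C"
    have zy: "z \<in> carrier M" "y \<in> carrier M" using z that n(3) by auto
    have "(x \<ominus>\<^bsub>M\<^esub> y) \<ominus>\<^bsub>M\<^esub> (x \<ominus>\<^bsub>M\<^esub> z) = (z \<ominus>\<^bsub>M\<^esub> y) \<oplus>\<^bsub>M\<^esub> (x \<ominus>\<^bsub>M\<^esub> x)"
      using zy that(3) by (simp add: M.minus_eq M.minus_add M.a_ac)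
    also have "\<dots> = z \<ominus>\<^bsub>M\<^esub> y" using zy that(3) by (simp add: M.minus_eq M.r_neg)
    finally have "z \<ominus>\<^bsub>M\<^esub> y \<in> C" using c(7)[OF that(2) conjunct2[OF z]] by simp
    then have "z \<ominus>\<^bsub>M\<^esub> y \<in> N \<inter> C" using n(7) z that(1) by blast
    then show "z = y" using NC minus_eq_zero_iff[OF zy] by auto
  qed (use that in auto)
  have p: "p x \<in> N" "x \<ominus>\<^bsub>M\<^esub> p x \<in> C" "p x \<in> carrier M" "x \<in> carrier M" if xD: "x \<in> ?D" for x
  proof -
    obtain y z where yz: "y \<in> N" "z \<in> C" "x = y \<oplus>\<^bsub>M\<^esub> z" by (rule set_addE[OF xD])
    have m: "y \<in> carrier M" "z \<in> carrier M" using n(3)[OF yz(1)] c(3)[OF yz(2)] by auto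
    have xy: "x \<ominus>\<^bsub>M\<^esub> y = z" unfolding yz(3) by (rule add_minus_left[OF m])
    have x: "x \<in> carrier M" using yz(3) m by simp
    have "p x = y" using peq[OF yz(1) _ x] xy yz(2) by simp
    then show "p x \<in> N" "x \<ominus>\<^bsub>M\<^esub> p x \<in> C" "p x \<in> carrier M" "x \<in> carrier M"
      using yz(1,2) m x xy by simp_all
  qed
  show thesis
  proof (rule that[of p])
    show "p \<in> mod_hom A (M\<lparr>carrier := ?D\<rparr>) (M\<lparr>carrier := N\<rparr>)"
    proof (rule mod_homI)
      fix x y assume "x \<in> carrier (M\<lparr>carrier := ?D\<rparr>)" "y \<in> carrier (M\<lparr>carrier := ?D\<rparr>)"
      then have xy: "x \<in> ?D" "y \<in> ?D" by auto
      have "(x \<oplus>\<^bsub>M\<^esub> y) \<ominus>\<^bsub>M\<^esub> (p x \<oplus>\<^bsub>M\<^esub> p y) = (x \<ominus>\<^bsub>M\<^esub> p x) \<oplus>\<^bsub>M\<^esub> (y \<ominus>\<^bsub>M\<^esub> p y)"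
        using p(3,4)[OF xy(1)] p(3,4)[OF xy(2)] by (simp add: M.minus_eq M.minus_add M.a_ac)
      also have "\<dots> \<in> C" by (rule c(4)[OF p(2)[OF xy(1)] p(2)[OF xy(2)]])
      finally have "p (x \<oplus>\<^bsub>M\<^esub> y) = p x \<oplus>\<^bsub>M\<^esub> p y"
        by (rule peq[OF n(4)[OF p(1)[OF xy(1)] p(1)[OF xy(2)]] _ M.a_closed[OF p(4)[OF xy(1)] p(4)[OF xy(2)]]])
      then show "p (x \<oplus>\<^bsub>M\<lparr>carrier := ?D\<rparr>\<^esub> y) = p x \<oplus>\<^bsub>M\<lparr>carrier := N\<rparr>\<^esub> p y" by simp
    next
      fix a x assume a: "a \<in> carrier A" and "x \<in> carrier (M\<lparr>carrier := ?D\<rparr>)"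
      then have x: "x \<in> ?D" by auto
      have "a \<odot>\<^bsub>M\<^esub> x \<ominus>\<^bsub>M\<^esub> a \<odot>\<^bsub>M\<^esub> p x = a \<odot>\<^bsub>M\<^esub> (x \<ominus>\<^bsub>M\<^esub> p x)"
        using p(3,4)[OF x] a by (simp add: M.minus_eq smult_r_distr smult_minus_right)
      also have "\<dots> \<in> C" by (rule c(5)[OF a p(2)[OF x]])
      finally have "p (a \<odot>\<^bsub>M\<^esub> x) = a \<odot>\<^bsub>M\<^esub> p x" 
        by (rule peq[OF n(5)[OF a p(1)[OF x]] _ smult_closed[OF a p(4)[OF x]]])
      then show "p (a \<odot>\<^bsub>M\<lparr>carrier := ?D\<rparr>\<^esub> x) = a \<odot>\<^bsub>M\<lparr>carrier := N\<rparr>\<^esub> p x" by simp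
    qed (use p(1) in auto)
    fix x
    show "x \<ominus>\<^bsub>M\<^esub> p x \<in> C" if "x \<in> ?D" using p(2)[OF that] .
    show "p x = x" if "x \<in> N" 
      by (rule peq[OF that _ n(3)[OF that]]) (simp add: minus_self[OF n(3)[OF that]] c(2))
    show "p x = \<zero>\<^bsub>M\<^esub>" if "x \<in> C" 
      by (rule peq[OF n(2) _ c(3)[OF that]]) (simp add: minus_zero_right[OF c(3)[OF that]] that)
  qed
qed

lemma simple_submoduleD:
  assumes "simple_submodule A M S"
  shows "submodule S A M" "S \<noteq> {\<zero>\<^bsub>M\<^esub>}"
    "\<And>H. \<lbrakk>submodule H A M; H \<subseteq> S; H \<noteq> {\<zero>\<^bsub>M\<^esub>}\<rbrakk> \<Longrightarrow> H = S"
  using assms unfolding simple_submodule_def by auto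

lemma simple_submodule_cases:
  assumes "simple_submodule A M S" "submodule H A M"
  shows "S \<subseteq> H \<or> H \<inter> S = {\<zero>\<^bsub>M\<^esub>}"
  using simple_submoduleD(3)[OF assms(1) submodule_Int[OF assms(2) simple_submoduleD(1)[OF assms(1)]]] by auto

lemma simple_submodule_exists:
  assumes "dcc_module A M" "submodule H A M" "H \<noteq> {\<zero>\<^bsub>M\<^esub>}"
  obtains S where "simple_submodule A M S" "S \<subseteq> H"
proof -
  let ?\<H> = "{L. submodule L A M \<and> L \<subseteq> H \<and> L \<noteq> {\<zero>\<^bsub>M\<^esub>}}"
  have ne: "?\<H> \<noteq> {}" using assms(2,3) by blast
  show thesis
  proof (rule dcc_moduleE[OF assms(1) ne])
    fix S assume S: "S \<in> ?\<H>" and min: "\<And>L. L \<in> ?\<H> \<Longrightarrow> L \<subseteq> S \<Longrightarrow> L = S"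
    have "simple_submodule A M S"
      unfolding simple_submodule_def
    proof (intro conjI allI impI)
      fix L assume "submodule L A M \<and> L \<subseteq> S"
      then show "L = {\<zero>\<^bsub>M\<^esub>} \<or> L = S" using min[of L] S by auto
    qed (use S in auto)
    then show thesis using that S by blast
  qed simp
qed

text \<open>Expresses that the module is the sum of its simple submodules without forming a sum over
  a family.\<close>

definition semisimple :: bool where
  "semisimple \<longleftrightarrow> (\<forall>H. submodule H A M \<and> (\<forall>S. simple_submodule A M S \<longrightarrow> S \<subseteq> H) \<longrightarrow> H = carrier M)"

text \<open>Zorn's lemma gives \<open>C\<close> maximal with zero intersection with
  \<open>N\<close>. A simple submodule outside \<open>N + C\<close> meets it in zero and could be
  added to \<open>C\<close>, so \<open>N + C\<close> contains all simple submodules.\<close>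

lemma complement_exists:
  assumes semisimple and N: "submodule N A M"
  obtains C where "submodule C A M" "N \<inter> C = {\<zero>\<^bsub>M\<^esub>}" "N <+>\<^bsub>M\<^esub> C = carrier M"
proof -
  let ?C = "{C. submodule C A M \<and> N \<inter> C = {\<zero>\<^bsub>M\<^esub>}}"
  note n = submoduleD[OF N]
  have "\<exists>C\<in>?C. \<forall>L\<in>?C. C \<subseteq> L \<longrightarrow> L = C"
  proof (rule subset_Zorn_nonempty)
    have "{\<zero>\<^bsub>M\<^esub>} \<in> ?C" using submodule_zero n(2) by auto
    then show "?C \<noteq> {}" by blast
    fix \<C> assume c: "\<C> \<noteq> {}" "subset.chain ?C \<C>"
    then have "submodule (\<Union>\<C>) A M" by (intro submodule_Union_chain) (auto simp: subset.chain_def)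
    moreover have "N \<inter> \<Union>\<C> = {\<zero>\<^bsub>M\<^esub>}" using c unfolding subset.chain_def by blast
    ultimately show "\<Union>\<C> \<in> ?C" by simp
  qed
  then obtain C where C': "C \<in> ?C" "\<And>L. L \<in> ?C \<Longrightarrow> C \<subseteq> L \<Longrightarrow> L = C"
    by (elim bexE) (metis (no_types, lifting))
  then have C: "submodule C A M" "N \<inter> C = {\<zero>\<^bsub>M\<^esub>}" by simp_all
  note c = submoduleD[OF C(1)]
  have NC: "submodule (N <+>\<^bsub>M\<^esub> C) A M" by (rule submodule_set_add[OF N C(1)])
  have "S \<subseteq> N <+>\<^bsub>M\<^esub> C" if S: "simple_submodule A M S" for S
  proof (rule ccontr)
    note sS = simple_submoduleD(1)[OF S]
    assume "\<not> ?thesis"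
    then have z: "(N <+>\<^bsub>M\<^esub> C) \<inter> S = {\<zero>\<^bsub>M\<^esub>}" using simple_submodule_cases[OF S NC] by blast
    have CS: "submodule (C <+>\<^bsub>M\<^esub> S) A M" by (rule submodule_set_add[OF C(1) sS])
    have "N \<inter> (C <+>\<^bsub>M\<^esub> S) \<subseteq> {\<zero>\<^bsub>M\<^esub>}"
    proof
      fix x assume x: "x \<in> N \<inter> (C <+>\<^bsub>M\<^esub> S)"
      then obtain y s where ys: "y \<in> C" "s \<in> S" "x = y \<oplus>\<^bsub>M\<^esub> s" by (auto elim: set_addE)
      have m: "y \<in> carrier M" "s \<in> carrier M" "x \<in> carrier M" using ys c(3) submoduleD(3)[OF sS] x n(3) by auto
      have "s = x \<oplus>\<^bsub>M\<^esub> \<ominus>\<^bsub>M\<^esub> y" using add_minus_left[OF m(1,2)] unfolding ys(3) by (simp add: M.minus_eq)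
      also have "\<dots> \<in> N <+>\<^bsub>M\<^esub> C" by (rule set_addI[OF _ c(6)[OF ys(1)]]) (use x in simp)
      finally have "s = \<zero>\<^bsub>M\<^esub>" using z ys(2) by blast
      then have "x = y" using ys(3) m by simp
      then show "x \<in> {\<zero>\<^bsub>M\<^esub>}" using x ys(1) C(2) by blast
    qed
    then have "C <+>\<^bsub>M\<^esub> S \<in> ?C" using CS n(2) submoduleD(2)[OF CS] by blast
    then have "C <+>\<^bsub>M\<^esub> S = C" using C'(2) set_add_upper(1)[OF C(1) sS] by blast
    then have "S \<subseteq> N <+>\<^bsub>M\<^esub> C" using set_add_upper(2)[OF C(1) sS] set_add_upper(2)[OF N C(1)] by blast
    then show False using z simple_submoduleD(2)[OF S] submoduleD(2)[OF sS] by blast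
  qed
  then have "N <+>\<^bsub>M\<^esub> C = carrier M" using assms(1) NC unfolding semisimple_def by blast
  then show thesis using that C by blast
qed

lemma semisimple_projection:
  assumes semisimple and N: "submodule N A M"
  obtains p where "p \<in> mod_hom A M (M\<lparr>carrier := N\<rparr>)" "\<And>x. x \<in> N \<Longrightarrow> p x = x"
proof -
  obtain C where C: "submodule C A M" "N \<inter> C = {\<zero>\<^bsub>M\<^esub>}" "N <+>\<^bsub>M\<^esub> C = carrier M"
    by (rule complement_exists[OF assms])
  show thesis
  proof (rule direct_sum_projections[OF N C(1,2)])
    fix p assume p: "p \<in> mod_hom A (M\<lparr>carrier := N <+>\<^bsub>M\<^esub> C\<rparr>) (M\<lparr>carrier := N\<rparr>)" "\<And>x. x \<in> N \<Longrightarrow> p x = x"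
    then show thesis using that[of p] unfolding C(3) by simp
  qed
qed

text \<open>A surjection onto \<open>S\<close> splits. The splitting is moreover extended from
  \<open>S\<close> to an endomorphism \<open>u\<close> of the whole module, by precomposing with a
  projection onto \<open>S\<close>, because the pairing below uses endomorphisms as its second
  argument.\<close>

lemma semisimple_right_inverse:
  assumes ss: semisimple and S: "submodule S A M"
    and w: "w \<in> mod_hom A M (M\<lparr>carrier := S\<rparr>)" "w ` carrier M = S"
  obtains u where "u \<in> mod_hom A M M" "\<And>s. s \<in> S \<Longrightarrow> w (u s) = s"
proof -
  have SM: "left_module A (M\<lparr>carrier := S\<rparr>)" by (rule submodule_left_module[OF S])
  note self = left_module_axioms
  let ?k = "mod_kernel M (M\<lparr>carrier := S\<rparr>) w"
  have k: "submodule ?k A M" by (rule submodule_kernel[OF self SM w(1)])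
  obtain C where C: "submodule C A M" "?k \<inter> C = {\<zero>\<^bsub>M\<^esub>}" "?k <+>\<^bsub>M\<^esub> C = carrier M"
    by (rule complement_exists[OF ss k])
  obtain p where p: "p \<in> mod_hom A M (M\<lparr>carrier := ?k\<rparr>)" "\<And>x. x \<in> ?k \<Longrightarrow> p x = x"
    by (rule semisimple_projection[OF ss k]) blast
  have pM: "p \<in> mod_hom A M M" by (rule mod_hom_expand_target[OF p(1)]) (rule submoduleD(1)[OF k])
  \<comment> \<open>Subtracting a projection onto the kernel of \<open>w\<close> gives a map that
    kills this kernel and therefore factors through \<open>w\<close>; the factor \<open>t\<close> is
    the section.\<close>
  have q: "(\<lambda>x. x \<ominus>\<^bsub>M\<^esub> p x) \<in> mod_hom A M M" by (rule mod_hom_minus_map[OF self mod_hom_id pM])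
  have "\<exists>t. t \<in> mod_hom A (M\<lparr>carrier := S\<rparr>) M \<and> (\<forall>x\<in>carrier M. t (w x) = x \<ominus>\<^bsub>M\<^esub> p x)"
  proof (rule factor_through_surjection[OF self SM self w(1) _ q])
    show "w ` carrier M = carrier (M\<lparr>carrier := S\<rparr>)" using w(2) by simp
    fix x assume "x \<in> carrier M" "w x = \<zero>\<^bsub>M\<lparr>carrier := S\<rparr>\<^esub>"
    then have "p x = x" using p(2) by (simp add: mod_kernel_def)
    then show "x \<ominus>\<^bsub>M\<^esub> p x = \<zero>\<^bsub>M\<^esub>" using minus_self[OF \<open>x \<in> carrier M\<close>] by simp
  qed blast
  then obtain t where t: "t \<in> mod_hom A (M\<lparr>carrier := S\<rparr>) M" "\<And>x. x \<in> carrier M \<Longrightarrow> t (w x) = x \<ominus>\<^bsub>M\<^esub> p x"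
    by blast
  obtain r where r: "r \<in> mod_hom A M (M\<lparr>carrier := S\<rparr>)" "\<And>x. x \<in> S \<Longrightarrow> r x = x"
    by (rule semisimple_projection[OF ss S]) blast
  show thesis
  proof (rule that[OF mod_hom_comp[OF r(1) t(1)]])
    fix s assume s: "s \<in> S"
    then obtain x where x: "x \<in> carrier M" "s = w x" using w(2) by auto
    have "p x \<in> ?k" using mod_homD(1)[OF p(1) x(1)] by simp
    then have px: "p x \<in> carrier M" "w (p x) = \<zero>\<^bsub>M\<^esub>" by (auto simp: mod_kernel_def)
    have "w (x \<ominus>\<^bsub>M\<^esub> p x) = w x \<ominus>\<^bsub>M\<lparr>carrier := S\<rparr>\<^esub> w (p x)"
      by (rule mod_hom_minus[OF self SM w(1) x(1) px(1)])
    also have "\<dots> = w x"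
    proof -
      interpret SM: left_module A "M\<lparr>carrier := S\<rparr>" by (rule SM)
      have "w x \<ominus>\<^bsub>M\<lparr>carrier := S\<rparr>\<^esub> \<zero>\<^bsub>M\<lparr>carrier := S\<rparr>\<^esub> = w x"
        by (rule SM.minus_zero_right[OF mod_homD(1)[OF w(1) x(1)]])
      then show ?thesis using px(2) by simp
    qed
    finally show "w (t (r s)) = s" using r(2)[OF s] t(2)[OF x(1)] x(2) by simp
  qed
qed

end

subsection \<open>Homomorphisms with minimal kernel\<close>

definition maximal_submodule :: "('a, 'r) ring_scheme \<Rightarrow> ('a, 'm) module \<Rightarrow> 'm set \<Rightarrow> bool" where
  "maximal_submodule A M H \<longleftrightarrow> submodule H A M \<and> H \<noteq> carrier M
     \<and> (\<forall>L. submodule L A M \<and> H \<subseteq> L \<longrightarrow> L = H \<or> L = carrier M)"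

text \<open>In the application, \<open>Q\<close> is \<open>W^0\<close>, \<open>V\<close> is the
  socle and \<open>a\<^sub>1\<close> is one member of the coset. Maximality of \<open>B\<close> says
  that every submodule strictly above \<open>B\<close> contains \<open>a\<^sub>1\<close>, which is
  what remains of a functional that is nonzero at \<open>a\<^sub>1\<close>. The assumption
  \<open>avoid\<close> is the contribution of irreducibility.\<close>

locale hom_hyperplane = artin_alg K A \<phi> + Q: left_module A Q + V: left_module A V
  for K :: "('k, 's) ring_scheme" and A :: "('a, 'r) ring_scheme" and \<phi> :: "'k \<Rightarrow> 'a"
    and Q :: "('a, 'q) module" and V :: "('a, 'v) module" +
  fixes B :: "('q \<Rightarrow> 'v) set" and a\<^sub>1 :: "'q \<Rightarrow> 'v"
  assumes V_fin_gen: "fin_gen A V" and V_semisimple: "V.semisimple"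
    and B_sub: "submodule B K (hom_mod A \<phi> Q V)"
    and a\<^sub>1: "a\<^sub>1 \<in> carrier (hom_mod A \<phi> Q V)" "a\<^sub>1 \<notin> B"
    and B_max: "\<And>L. \<lbrakk>submodule L K (hom_mod A \<phi> Q V); B \<subseteq> L; a\<^sub>1 \<notin> L\<rbrakk> \<Longrightarrow> L = B"
    and avoid: "\<And>M. maximal_submodule A Q M
          \<Longrightarrow> \<exists>a\<in>carrier (hom_mod A \<phi> Q V). a \<notin> B \<and> (\<forall>x\<in>M. a x = \<zero>\<^bsub>V\<^esub>)"
begin

abbreviation "HQV \<equiv> hom_mod A \<phi> Q V"
abbreviation "sub S \<equiv> V\<lparr>carrier := S\<rparr>"

lemmas Q_mod = Q.left_module_axioms and V_mod = V.left_module_axioms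

lemma HQV_mod: "left_module K HQV"
  by (rule left_module_hom_mod[OF Q_mod V_mod])

sublocale H: left_module K HQV
  by (rule HQV_mod)

lemmas B_D = H.submoduleD[OF B_sub]

lemma sub_mod: "submodule S A V \<Longrightarrow> left_module A (sub S)"
  by (rule V.submodule_left_module)

lemma hom_sub_subset:
  assumes "submodule S A V"
  shows "carrier (hom_mod A \<phi> M (sub S)) \<subseteq> carrier (hom_mod A \<phi> M V)"
  using mod_hom_expand_target[of _ A M S V] V.submoduleD(1)[OF assms] by (auto simp: hom_mod_simps)

lemma submodule_hom_sub:
  assumes "left_module A M" "submodule S A V"
  shows "submodule (carrier (hom_mod A \<phi> M (sub S))) K (hom_mod A \<phi> M V)"
proof -
  interpret HS: left_module K "hom_mod A \<phi> M (sub S)"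
    by (rule left_module_hom_mod[OF assms(1) sub_mod[OF assms(2)]])
  interpret HV: left_module K "hom_mod A \<phi> M V" by (rule left_module_hom_mod[OF assms(1) V_mod])
  show ?thesis
    using HS.M.zero_closed HS.M.a_closed HS.smult_closed hom_sub_subset[OF assms(2)]
    by (intro HV.submoduleI) (simp_all add: hom_mod_def)
qed

definition cmp :: "('v \<Rightarrow> 'v) \<Rightarrow> ('q \<Rightarrow> 'v) \<Rightarrow> 'q \<Rightarrow> 'v" where
  "cmp v \<nu> = (\<lambda>x\<in>carrier Q. v (\<nu> x))"

lemma cmp_closed:
  assumes "v \<in> mod_hom A V N" "\<nu> \<in> carrier HQV"
  shows "cmp v \<nu> \<in> carrier (hom_mod A \<phi> Q N)"
  unfolding cmp_def by (rule restrict_mod_hom[OF Q_mod mod_hom_comp[OF hom_modD(1)[OF assms(2)] assms(1)]])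

lemma sub_hom_V: "\<lbrakk>submodule S A V; w \<in> mod_hom A M (sub S)\<rbrakk> \<Longrightarrow> w \<in> mod_hom A M V"
  by (rule mod_hom_expand_target) (auto dest: V.submoduleD)

text \<open>Maps into \<open>S\<close> outside \<open>B\<close> are multiples of
  \<open>a\<^sub>1\<close> modulo \<open>B\<close> and conversely, hence of each other. Maximality
  of \<open>B\<close> gives \<open>a\<^sub>1 = d g + b\<close>; the point is to solve this for
  \<open>g\<close>, that is, to invert the scalar \<open>d\<close> on \<open>S\<close>.\<close>

lemma hyperplane:
  assumes S: "simple_submodule A V S"
    and h: "h \<in> carrier (hom_mod A \<phi> Q (sub S))" "h \<notin> B"
    and h': "h' \<in> carrier (hom_mod A \<phi> Q (sub S))"
  shows "\<exists>c\<in>carrier K. h' \<ominus>\<^bsub>HQV\<^esub> c \<odot>\<^bsub>HQV\<^esub> h \<in> B"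
proof -
  note sS = V.simple_submoduleD(1)[OF S]
  note sub = subsetD[OF hom_sub_subset[OF sS]]
  interpret K: cring K by (rule K_cring)
  have approx: "\<exists>c\<in>carrier K. g \<ominus>\<^bsub>HQV\<^esub> c \<odot>\<^bsub>HQV\<^esub> a\<^sub>1 \<in> B \<and> (\<exists>d\<in>carrier K. a\<^sub>1 \<ominus>\<^bsub>HQV\<^esub> d \<odot>\<^bsub>HQV\<^esub> g \<in> B)"
    if g: "g \<in> carrier (hom_mod A \<phi> Q (sub S))" "g \<notin> B" for g
  proof -
    note gH = sub[OF g(1)]
    let ?L = "{c \<odot>\<^bsub>HQV\<^esub> g | c. c \<in> carrier K} <+>\<^bsub>HQV\<^esub> B"
    note cyc = H.submodule_cyclic[OF gH]
    have "g \<in> ?L" using H.set_add_upper(1)[OF cyc B_sub] H.smult_one[OF gH] by force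
    then have "?L \<noteq> B" using g(2) by auto
    then have "a\<^sub>1 \<in> ?L" using B_max[OF H.submodule_set_add[OF cyc B_sub] H.set_add_upper(2)[OF cyc B_sub]] by blast
    then obtain y b where yb: "y \<in> {c \<odot>\<^bsub>HQV\<^esub> g | c. c \<in> carrier K}" "b \<in> B" "a\<^sub>1 = y \<oplus>\<^bsub>HQV\<^esub> b"
      by (rule H.set_addE)
    then obtain d where d: "d \<in> carrier K" "y = d \<odot>\<^bsub>HQV\<^esub> g" by auto
    have bH: "b \<in> carrier HQV" "y \<in> carrier HQV" using B_D(3)[OF yb(2)] d gH by auto
    have ady: "a\<^sub>1 \<ominus>\<^bsub>HQV\<^esub> d \<odot>\<^bsub>HQV\<^esub> g = b"
      using H.add_minus_left[OF bH(2,1)] unfolding yb(3) d(2) .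
    \<comment> \<open>If \<open>d\<close> annihilated \<open>S\<close>, then \<open>d g\<close>
      would be zero and \<open>a\<^sub>1\<close> would be a member of \<open>B\<close>. So the
      kernel of \<open>d\<close> on the simple module \<open>S\<close> is proper, hence zero, and
      over an artinian ring injectivity yields an inverse.\<close>
    have S_nz: "\<exists>s\<in>S. \<phi> d \<odot>\<^bsub>V\<^esub> s \<noteq> \<zero>\<^bsub>V\<^esub>"
    proof (rule ccontr)
      assume "\<not> ?thesis"
      then have "y = \<zero>\<^bsub>HQV\<^esub>"
        using hom_modD(2)[OF g(1)] unfolding d(2) by (auto simp: hom_mod_simps(2,4) intro!: restrict_ext)
      then show False using yb bH a\<^sub>1(2) by simp
    qed
    have inj: "\<phi> d \<odot>\<^bsub>V\<^esub> s = \<zero>\<^bsub>V\<^esub> \<longrightarrow> s = \<zero>\<^bsub>V\<^esub>" if s: "s \<in> S" for s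
    proof
      assume z: "\<phi> d \<odot>\<^bsub>V\<^esub> s = \<zero>\<^bsub>V\<^esub>"
      let ?k = "S \<inter> mod_kernel V V (\<lambda>x. \<phi> d \<odot>\<^bsub>V\<^esub> x)"
      have k: "submodule ?k A V"
        by (rule V.submodule_Int[OF sS submodule_kernel[OF V_mod V_mod \<phi>_smult_hom[OF V_mod d(1)]]])
      have "?k \<noteq> S" using S_nz by (auto simp: mod_kernel_def)
      then have "?k = {\<zero>\<^bsub>V\<^esub>}" using V.simple_submoduleD(3)[OF S k] by blast
      moreover have "s \<in> ?k" using s z V.submoduleD(3)[OF sS] by (simp add: mod_kernel_def)
      ultimately show "s = \<zero>\<^bsub>V\<^esub>" by auto
    qed
    obtain c where c: "c \<in> carrier K" "\<And>s. s \<in> S \<Longrightarrow> \<phi> c \<odot>\<^bsub>V\<^esub> (\<phi> d \<odot>\<^bsub>V\<^esub> s) = s"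
    proof (rule artinian_acts_as_field[OF K_artinian left_module_restrict_scalars[OF V_mod] d(1)
          submodule_restrict_scalars[OF V_mod sS]])
      show "(\<forall>x\<in>S. \<exists>y\<in>S. x = d \<odot>\<^bsub>restrict_scalars \<phi> V\<^esub> y) \<or>
        (\<forall>x\<in>S. d \<odot>\<^bsub>restrict_scalars \<phi> V\<^esub> x = \<zero>\<^bsub>restrict_scalars \<phi> V\<^esub> \<longrightarrow> x = \<zero>\<^bsub>restrict_scalars \<phi> V\<^esub>)"
        using inj by simp
    qed auto
    have "c \<odot>\<^bsub>HQV\<^esub> y = g"
    proof (rule hom_mod_eqI[OF H.smult_closed[OF c(1) bH(2)] gH refl])
      fix x assume x: "x \<in> carrier Q"
      have "g x \<in> S" using hom_modD(2)[OF g(1) x] by simp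
      then show "(c \<odot>\<^bsub>HQV\<^esub> y) x = g x" using c(2) x unfolding d(2) by (simp add: hom_mod_simps(4))
    qed
    then have "c \<odot>\<^bsub>HQV\<^esub> a\<^sub>1 = g \<oplus>\<^bsub>HQV\<^esub> c \<odot>\<^bsub>HQV\<^esub> b"
      unfolding yb(3) using c(1) bH by (simp add: H.smult_r_distr)
    then have "g \<ominus>\<^bsub>HQV\<^esub> c \<odot>\<^bsub>HQV\<^esub> a\<^sub>1 = \<ominus>\<^bsub>HQV\<^esub> (c \<odot>\<^bsub>HQV\<^esub> b)"
      using gH c(1) bH by (simp add: H.M.minus_eq H.M.minus_add H.M.r_neg2 H.M.a_assoc[symmetric] H.M.r_neg)
    then have "g \<ominus>\<^bsub>HQV\<^esub> c \<odot>\<^bsub>HQV\<^esub> a\<^sub>1 \<in> B" using B_D(6)[OF B_D(5)[OF c(1) yb(2)]] by simp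
    then show ?thesis using c(1) d(1) ady yb(2) by auto
  qed
  show ?thesis
  proof (cases "h' \<in> B")
    case True
    have "h' \<ominus>\<^bsub>HQV\<^esub> \<zero>\<^bsub>K\<^esub> \<odot>\<^bsub>HQV\<^esub> h = h'"
      using sub[OF h'] sub[OF h(1)] by (simp add: H.minus_zero_right)
    then show ?thesis using True by force
  next
    case False
    obtain c where c: "c \<in> carrier K" "h' \<ominus>\<^bsub>HQV\<^esub> c \<odot>\<^bsub>HQV\<^esub> a\<^sub>1 \<in> B" using approx[OF h' False] by blast
    obtain d where d: "d \<in> carrier K" "a\<^sub>1 \<ominus>\<^bsub>HQV\<^esub> d \<odot>\<^bsub>HQV\<^esub> h \<in> B" using approx[OF h] by blast
    note hH = sub[OF h(1)] sub[OF h']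
    have ca: "c \<odot>\<^bsub>HQV\<^esub> a\<^sub>1 \<in> carrier HQV" "c \<odot>\<^bsub>HQV\<^esub> (d \<odot>\<^bsub>HQV\<^esub> h) \<in> carrier HQV" using c d hH a\<^sub>1 by auto
    have "(h' \<ominus>\<^bsub>HQV\<^esub> c \<odot>\<^bsub>HQV\<^esub> a\<^sub>1) \<oplus>\<^bsub>HQV\<^esub> c \<odot>\<^bsub>HQV\<^esub> (a\<^sub>1 \<ominus>\<^bsub>HQV\<^esub> d \<odot>\<^bsub>HQV\<^esub> h)
        = (h' \<ominus>\<^bsub>HQV\<^esub> c \<odot>\<^bsub>HQV\<^esub> a\<^sub>1) \<oplus>\<^bsub>HQV\<^esub> (c \<odot>\<^bsub>HQV\<^esub> a\<^sub>1 \<ominus>\<^bsub>HQV\<^esub> c \<odot>\<^bsub>HQV\<^esub> (d \<odot>\<^bsub>HQV\<^esub> h))"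
      using c d hH a\<^sub>1 by (simp add: H.M.minus_eq H.smult_r_distr H.smult_minus_right)
    also have "\<dots> = h' \<ominus>\<^bsub>HQV\<^esub> c \<odot>\<^bsub>HQV\<^esub> (d \<odot>\<^bsub>HQV\<^esub> h)"
      using ca hH by (simp add: H.M.minus_eq H.M.a_assoc H.M.r_neg1)
    also have "c \<odot>\<^bsub>HQV\<^esub> (d \<odot>\<^bsub>HQV\<^esub> h) = (c \<otimes>\<^bsub>K\<^esub> d) \<odot>\<^bsub>HQV\<^esub> h" using c d hH by (simp add: H.smult_assoc)
    finally have "h' \<ominus>\<^bsub>HQV\<^esub> (c \<otimes>\<^bsub>K\<^esub> d) \<odot>\<^bsub>HQV\<^esub> h \<in> B"
      using B_D(4)[OF c(2) B_D(5)[OF c(1) d(2)]] by simp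
    then show ?thesis using c(1) d(1) by blast
  qed
qed

text \<open>
  As \<open>N\<close> grows from \<open>0\<close> to \<open>V\<close>, \<open>ann N\<close> shrinks from all of \<open>Hom(Q, V)\<close> to \<open>0\<close>, and \<open>rad N\<close>
  grows accordingly. By duality, adding a simple summand to \<open>N\<close> shrinks \<open>ann N\<close> by at most the
  maps that factor through a single \<open>\<mu> : Q \<rightarrow> S\<close>, so \<open>\<mu>\<close> detects the growth of \<open>rad N\<close>.
\<close>

definition ann :: "'v set \<Rightarrow> ('q \<Rightarrow> 'v) set" where
  "ann N = {\<nu> \<in> carrier HQV. \<forall>v\<in>mod_hom A V V. v ` carrier V \<subseteq> N \<longrightarrow> cmp v \<nu> \<in> B}"

definition rad :: "'v set \<Rightarrow> 'q set" where
  "rad N = {x \<in> carrier Q. \<forall>\<nu>\<in>ann N. \<nu> x = \<zero>\<^bsub>V\<^esub>}"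

lemma cmp_minus:
  assumes "v \<in> mod_hom A V V" "\<nu> \<in> carrier HQV" "\<mu> \<in> carrier HQV"
  shows "cmp v (\<nu> \<ominus>\<^bsub>HQV\<^esub> \<mu>) = cmp v \<nu> \<ominus>\<^bsub>HQV\<^esub> cmp v \<mu>"
proof -
  have m: "\<nu> \<ominus>\<^bsub>HQV\<^esub> \<mu> = (\<lambda>x\<in>carrier Q. \<nu> x \<ominus>\<^bsub>V\<^esub> \<mu> x)" by (rule hom_mod_minus[OF Q_mod V_mod assms(2,3)])
  have m': "cmp v \<nu> \<ominus>\<^bsub>HQV\<^esub> cmp v \<mu> = (\<lambda>x\<in>carrier Q. cmp v \<nu> x \<ominus>\<^bsub>V\<^esub> cmp v \<mu> x)"
    by (rule hom_mod_minus[OF Q_mod V_mod cmp_closed[OF assms(1,2)] cmp_closed[OF assms(1,3)]])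
  show ?thesis unfolding m m' unfolding cmp_def
    by (rule restrict_ext)
      (simp add: mod_hom_minus[OF V_mod V_mod assms(1)] hom_modD(2)[OF assms(2)] hom_modD(2)[OF assms(3)])
qed

text \<open>An endomorphism with image in the direct sum of \<open>N\<close> and \<open>S\<close> is
  the sum of its two components, one with image in \<open>N\<close> and one in \<open>S\<close>, and
  each sends \<nu> into \<open>B\<close>.\<close>

lemma ann_add:
  assumes N: "submodule N A V" and S: "submodule S A V" "N \<inter> S = {\<zero>\<^bsub>V\<^esub>}"
    and \<nu>: "\<nu> \<in> ann N" "\<And>w. w \<in> mod_hom A V (sub S) \<Longrightarrow> cmp w \<nu> \<in> B"
  shows "\<nu> \<in> ann (N <+>\<^bsub>V\<^esub> S)"
  unfolding ann_def
proof (intro CollectI conjI ballI impI)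
  show \<nu>H: "\<nu> \<in> carrier HQV" using \<nu>(1) by (simp add: ann_def)
  fix v assume v: "v \<in> mod_hom A V V" "v ` carrier V \<subseteq> N <+>\<^bsub>V\<^esub> S"
  obtain p where p: "p \<in> mod_hom A (sub (N <+>\<^bsub>V\<^esub> S)) (sub N)"
    "\<And>x. x \<in> N <+>\<^bsub>V\<^esub> S \<Longrightarrow> x \<ominus>\<^bsub>V\<^esub> p x \<in> S"
    by (rule V.direct_sum_projections[OF N S]) blast
  have v': "v \<in> mod_hom A V (sub (N <+>\<^bsub>V\<^esub> S))" by (rule mod_hom_restrict_target[OF v])
  have pv: "(\<lambda>x. p (v x)) \<in> mod_hom A V (sub N)" by (rule mod_hom_comp[OF v' p(1)])
  note pvV = sub_hom_V[OF N pv]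
  have w: "(\<lambda>x. v x \<ominus>\<^bsub>V\<^esub> p (v x)) \<in> mod_hom A V V" by (rule mod_hom_minus_map[OF V_mod v(1) pvV])
  have "(\<lambda>x. v x \<ominus>\<^bsub>V\<^esub> p (v x)) \<in> mod_hom A V (sub S)"
    by (rule mod_hom_restrict_target[OF w]) (use v(2) p(2) in auto)
  then have 1: "cmp (\<lambda>x. v x \<ominus>\<^bsub>V\<^esub> p (v x)) \<nu> \<in> B" by (rule \<nu>(2))
  have "(\<lambda>x. p (v x)) ` carrier V \<subseteq> N" using mod_homD(1)[OF pv] by auto
  then have 2: "cmp (\<lambda>x. p (v x)) \<nu> \<in> B" using \<nu>(1) pvV unfolding ann_def by blast
  have "cmp (\<lambda>x. v x \<ominus>\<^bsub>V\<^esub> p (v x)) \<nu> \<oplus>\<^bsub>HQV\<^esub> cmp (\<lambda>x. p (v x)) \<nu> = cmp v \<nu>"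
    unfolding cmp_def hom_mod_simps(3)
    by (rule restrict_ext)
      (simp add: hom_modD(2)[OF \<nu>H] mod_homD(1)[OF v(1)] mod_homD(1)[OF pvV] V.M.minus_eq V.M.a_assoc V.M.l_neg)
  then show "cmp v \<nu> \<in> B" using B_D(4)[OF 1 2] by simp
qed

end

text \<open>Negation is defined by a description over the carrier, so it is not literally unchanged
  when the carrier shrinks; writing it as multiplication by \<open>-1\<close> bridges the
  gap.\<close>

lemma (in left_module) restrict_minus:
  assumes "submodule N A M" "y \<in> N"
  shows "x \<ominus>\<^bsub>M\<lparr>carrier := N\<rparr>\<^esub> y = x \<ominus>\<^bsub>M\<^esub> y"
proof -
  interpret N: left_module A "M\<lparr>carrier := N\<rparr>" by (rule submodule_left_module[OF assms(1)])
  have "\<ominus>\<^bsub>M\<lparr>carrier := N\<rparr>\<^esub> y = \<ominus>\<^bsub>M\<^esub> y"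
    using N.uminus_eq_smult[of y] uminus_eq_smult[of y] submoduleD(3)[OF assms] assms(2) by simp
  then show ?thesis by (simp add: a_minus_def)
qed

text \<open>The union of a chain is finitely generated and its generators already lie in one member,
  so chains have upper bounds inside the family and Zorn's lemma applies.\<close>

lemma noetherian_maximal:
  assumes M: "left_module A M" "noetherian_module A M"
    and F: "\<F> \<noteq> {}" "\<And>H. H \<in> \<F> \<Longrightarrow> submodule H A M"
  obtains H where "H \<in> \<F>" "\<And>L. \<lbrakk>L \<in> \<F>; H \<subseteq> L\<rbrakk> \<Longrightarrow> L = H"
proof -
  interpret left_module A M by fact
  have "\<exists>H\<in>\<F>. \<forall>L\<in>\<F>. H \<subseteq> L \<longrightarrow> L = H"
  proof (rule subset_Zorn_nonempty[OF F(1)])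
    fix \<C> assume c: "\<C> \<noteq> {}" "subset.chain \<F> \<C>"
    have "submodule (\<Union>\<C>) A M"
    proof (rule submodule_Union_chain[OF _ c(1)])
      show "submodule H A M" if "H \<in> \<C>" for H using c(2) F(2) that unfolding subset.chain_def by blast
      show "H \<subseteq> L \<or> L \<subseteq> H" if "H \<in> \<C>" "L \<in> \<C>" for H L
        using c(2) that unfolding subset.chain_def by blast
    qed
    then have "finitely_spanned A M (\<Union>\<C>)" using M(2) by (simp add: noetherian_module_def)
    then obtain S where S: "finite S" "S \<subseteq> \<Union>\<C>" "mod_span A M S = \<Union>\<C>"
      unfolding finitely_spanned_def by (elim exE conjE)
    obtain H where H: "H \<in> \<C>" "S \<subseteq> H" by (rule finite_subset_Union_chain[OF S(1,2) c])
    have HF: "H \<in> \<F>" using H(1) c(2) by (auto simp: subset.chain_def)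
    have "\<Union>\<C> \<subseteq> H" unfolding S(3)[symmetric] by (rule mod_span_least[OF F(2)[OF HF] H(2)])
    then have "\<Union>\<C> = H" using H(1) by auto
    then show "\<Union>\<C> \<in> \<F>" using HF by simp
  qed
  then show thesis using that by blast
qed

section \<open>The composition pairing and the construction of the map with minimal kernel\<close>

context hom_hyperplane
begin

lemma cmp_left_hom:
  assumes "\<nu> \<in> carrier HQV"
  shows "(\<lambda>w. cmp w \<nu>) \<in> mod_hom K (hom_mod A \<phi> V N) (hom_mod A \<phi> Q N)"
proof (rule mod_homI)
  fix w assume "w \<in> carrier (hom_mod A \<phi> V N)"
  from cmp_closed[OF hom_modD(1)[OF this] assms] show "cmp w \<nu> \<in> carrier (hom_mod A \<phi> Q N)" .
next
  fix w w'
  show "cmp (w \<oplus>\<^bsub>hom_mod A \<phi> V N\<^esub> w') \<nu> = cmp w \<nu> \<oplus>\<^bsub>hom_mod A \<phi> Q N\<^esub> cmp w' \<nu>"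
    unfolding hom_mod_simps cmp_def by (rule restrict_ext) (simp add: hom_modD(2)[OF assms])
next
  fix c w
  show "cmp (c \<odot>\<^bsub>hom_mod A \<phi> V N\<^esub> w) \<nu> = c \<odot>\<^bsub>hom_mod A \<phi> Q N\<^esub> cmp w \<nu>"
    unfolding hom_mod_simps cmp_def by (rule restrict_ext) (simp add: hom_modD(2)[OF assms])
qed

lemma cmp_right_hom:
  assumes "w \<in> mod_hom A V N"
  shows "cmp w \<in> mod_hom K HQV (hom_mod A \<phi> Q N)"
proof (rule mod_homI)
  fix \<nu> assume "\<nu> \<in> carrier HQV"
  then show "cmp w \<nu> \<in> carrier (hom_mod A \<phi> Q N)" by (rule cmp_closed[OF assms])
next
  fix \<nu> \<nu>' assume "\<nu> \<in> carrier HQV" "\<nu>' \<in> carrier HQV"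
  note D = hom_modD(2)[OF this(1)] hom_modD(2)[OF this(2)]
  show "cmp w (\<nu> \<oplus>\<^bsub>HQV\<^esub> \<nu>') = cmp w \<nu> \<oplus>\<^bsub>hom_mod A \<phi> Q N\<^esub> cmp w \<nu>'"
    unfolding hom_mod_simps cmp_def by (rule restrict_ext) (simp add: D mod_homD(2)[OF assms])
next
  fix c \<nu> assume "c \<in> carrier K" "\<nu> \<in> carrier HQV"
  note D = this(1) hom_modD(2)[OF this(2)]
  show "cmp w (c \<odot>\<^bsub>HQV\<^esub> \<nu>) = c \<odot>\<^bsub>hom_mod A \<phi> Q N\<^esub> cmp w \<nu>"
    unfolding hom_mod_simps cmp_def by (rule restrict_ext) (simp add: D mod_homD(3)[OF assms])
qed

lemma cmp_cmp:
  assumes "\<nu> \<in> carrier HQV"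
  shows "cmp v (cmp w \<nu>) = cmp (\<lambda>x. v (w x)) \<nu>"
  unfolding cmp_def by (rule restrict_ext) simp

lemma cmp_restrict: "\<nu> \<in> carrier HQV \<Longrightarrow> cmp (restrict w (carrier V)) \<nu> = cmp w \<nu>"
  unfolding cmp_def by (rule restrict_ext) (simp add: hom_modD(2))

text \<open>Nondegeneracy is the main point: a nonzero \<open>w\<close> from \<open>V\<close> to the
  simple module \<open>S\<close> is onto, so by semisimplicity it has a right inverse
  \<open>u\<close>, and \<open>w u \<mu> = \<mu>\<close> is outside \<open>B\<close>.\<close>

lemma pairing_composition:
  assumes S: "simple_submodule A V S"
    and \<mu>: "\<mu> \<in> carrier (hom_mod A \<phi> Q (sub S))" "\<mu> \<notin> B"
  shows "pairing K (hom_mod A \<phi> V (sub S)) (hom_mod A \<phi> V V) (hom_mod A \<phi> Q (sub S))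
    (\<lambda>w u. cmp w (cmp u \<mu>)) (B \<inter> carrier (hom_mod A \<phi> Q (sub S)))"
proof -
  note sS = V.simple_submoduleD(1)[OF S]
  let ?HS = "hom_mod A \<phi> Q (sub S)" and ?G = "hom_mod A \<phi> V (sub S)"
  note HS_sub = submodule_hom_sub[OF Q_mod sS]
  have \<mu>H: "\<mu> \<in> carrier HQV" using hom_sub_subset[OF sS] \<mu>(1) by blast
  interpret G: left_module K ?G by (rule left_module_hom_mod[OF V_mod sub_mod[OF sS]])
  interpret U: left_module K "hom_mod A \<phi> V V" by (rule left_module_hom_mod[OF V_mod V_mod])
  interpret HS: left_module K ?HS by (rule left_module_hom_mod[OF Q_mod sub_mod[OF sS]])
  show ?thesis
  proof (intro pairing.intro pairing_axioms.intro G.left_module_axioms U.left_module_axioms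
      HS.left_module_axioms)
    fix u assume "u \<in> carrier (hom_mod A \<phi> V V)"
    then have "cmp u \<mu> \<in> carrier HQV" using cmp_closed[OF hom_modD(1) \<mu>H] by blast
    then show "(\<lambda>w. cmp w (cmp u \<mu>)) \<in> mod_hom K ?G ?HS" by (rule cmp_left_hom)
  next
    fix w assume "w \<in> carrier ?G"
    then have "cmp w \<in> mod_hom K HQV ?HS" by (intro cmp_right_hom hom_modD(1))
    then show "(\<lambda>u. cmp w (cmp u \<mu>)) \<in> mod_hom K (hom_mod A \<phi> V V) ?HS"
      by (rule mod_hom_comp[OF cmp_left_hom[OF \<mu>H]])
  next
    have "submodule (B \<inter> carrier ?HS) K (HQV\<lparr>carrier := carrier ?HS\<rparr>)"
      using H.submodule_restrict_iff[OF HS_sub] H.submodule_Int[OF B_sub HS_sub] by simp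
    then show "submodule (B \<inter> carrier ?HS) K ?HS" unfolding hom_mod_restrict[symmetric] .
  next
    fix h h' assume h: "h \<in> carrier ?HS" "h \<notin> B \<inter> carrier ?HS" "h' \<in> carrier ?HS"
    then obtain c where c: "c \<in> carrier K" "h' \<ominus>\<^bsub>HQV\<^esub> c \<odot>\<^bsub>HQV\<^esub> h \<in> B" using hyperplane[OF S] by blast
    have ch: "c \<odot>\<^bsub>?HS\<^esub> h = c \<odot>\<^bsub>HQV\<^esub> h" by (simp add: hom_mod_simps)
    have chH: "c \<odot>\<^bsub>?HS\<^esub> h \<in> carrier ?HS" using c(1) h(1) by (rule HS.smult_closed)
    have "h' \<ominus>\<^bsub>?HS\<^esub> c \<odot>\<^bsub>?HS\<^esub> h = h' \<ominus>\<^bsub>HQV\<^esub> c \<odot>\<^bsub>HQV\<^esub> h"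
      using H.restrict_minus[OF HS_sub, of "c \<odot>\<^bsub>HQV\<^esub> h" h'] chH
      unfolding hom_mod_restrict[symmetric] ch by blast
    moreover have "h' \<ominus>\<^bsub>?HS\<^esub> c \<odot>\<^bsub>?HS\<^esub> h \<in> carrier ?HS" using h(3) chH by (rule HS.M.minus_closed)
    ultimately show "\<exists>c\<in>carrier K. h' \<ominus>\<^bsub>?HS\<^esub> c \<odot>\<^bsub>?HS\<^esub> h \<in> B \<inter> carrier ?HS"
      using c by (intro bexI[OF _ c(1)]) auto
  next
    fix w assume w: "w \<in> carrier ?G" "w \<noteq> \<zero>\<^bsub>?G\<^esub>"
    note wh = hom_modD(1)[OF w(1)]
    have im: "submodule (w ` carrier V) A V"
      by (rule submodule_image[OF V_mod V_mod sub_hom_V[OF sS wh] V.submodule_carrier])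
    have "w ` carrier V \<noteq> {\<zero>\<^bsub>V\<^esub>}"
    proof
      assume z: "w ` carrier V = {\<zero>\<^bsub>V\<^esub>}"
      have "w = \<zero>\<^bsub>?G\<^esub>"
        by (rule hom_mod_eqI[OF w(1) G.M.zero_closed refl]) (use z in \<open>auto simp: hom_mod_simps(2)\<close>)
      then show False using w(2) by simp
    qed
    moreover have "w ` carrier V \<subseteq> S" using mod_homD(1)[OF wh] by auto
    ultimately have "w ` carrier V = S" by (intro V.simple_submoduleD(3)[OF S im])
    then obtain u where u: "u \<in> mod_hom A V V" "\<And>s. s \<in> S \<Longrightarrow> w (u s) = s"
      by (rule V.semisimple_right_inverse[OF V_semisimple sS wh]) blast
    have "cmp w (cmp (restrict u (carrier V)) \<mu>) = cmp w (cmp u \<mu>)" by (simp add: cmp_restrict[OF \<mu>H])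
    also have "\<dots> = \<mu>"
      by (rule hom_mod_eqI[OF cmp_closed[OF wh cmp_closed[OF u(1) \<mu>H]] \<mu>(1) refl])
        (use u(2) hom_modD(2)[OF \<mu>(1)] in \<open>simp add: cmp_def\<close>)
    finally show "\<exists>u\<in>carrier (hom_mod A \<phi> V V). cmp w (cmp u \<mu>) \<notin> B \<inter> carrier ?HS"
      using \<mu>(2) restrict_mod_hom[OF V_mod u(1)] by (intro bexI[of _ "restrict u (carrier V)"]) auto
  qed
qed

lemma ann_step:
  assumes N: "submodule N A V" and S: "simple_submodule A V S" and NS: "N \<inter> S = {\<zero>\<^bsub>V\<^esub>}"
  shows "\<exists>\<mu>\<in>carrier (hom_mod A \<phi> Q (sub S)). \<forall>\<nu>\<in>ann N. \<exists>u\<in>mod_hom A V V.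
    \<nu> \<ominus>\<^bsub>HQV\<^esub> cmp u \<mu> \<in> ann (N <+>\<^bsub>V\<^esub> S)"
proof -
  note sS = V.simple_submoduleD(1)[OF S]
  let ?HS = "hom_mod A \<phi> Q (sub S)" and ?G = "hom_mod A \<phi> V (sub S)"
  note HS_sub = submodule_hom_sub[OF Q_mod sS]
  note HS_D = H.submoduleD[OF HS_sub]
  show ?thesis
  proof (cases "\<forall>\<nu>\<in>ann N. \<forall>w\<in>mod_hom A V (sub S). cmp w \<nu> \<in> B")
    case True
    show ?thesis
    \<comment> \<open>No map into \<open>S\<close> takes \<open>ann N\<close> out of
      \<open>B\<close>, so \<open>ann N\<close> does not shrink at all and the zero map serves as
      \<mu>.\<close>
    proof (rule bexI[OF _ HS_D(2)], intro ballI bexI[OF _ mod_hom_id])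
      fix \<nu> assume \<nu>: "\<nu> \<in> ann N"
      have "cmp (\<lambda>x. x) \<zero>\<^bsub>HQV\<^esub> = \<zero>\<^bsub>HQV\<^esub>"
        unfolding cmp_def hom_mod_simps(2) by (rule restrict_ext) simp
      moreover have "\<nu> \<in> carrier HQV" using \<nu> by (simp add: ann_def)
      ultimately have "\<nu> \<ominus>\<^bsub>HQV\<^esub> cmp (\<lambda>x. x) \<zero>\<^bsub>HQV\<^esub> = \<nu>" by (simp add: H.minus_zero_right)
      then show "\<nu> \<ominus>\<^bsub>HQV\<^esub> cmp (\<lambda>x. x) \<zero>\<^bsub>HQV\<^esub> \<in> ann (N <+>\<^bsub>V\<^esub> S)"
        using ann_add[OF N sS NS \<nu>] True \<nu> by simp
    qed
  next
    case False
    then obtain \<nu>\<^sub>0 w\<^sub>0 where 0: "\<nu>\<^sub>0 \<in> ann N" "w\<^sub>0 \<in> mod_hom A V (sub S)" "cmp w\<^sub>0 \<nu>\<^sub>0 \<notin> B" by blast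
    have \<nu>\<^sub>0: "\<nu>\<^sub>0 \<in> carrier HQV" using 0(1) by (simp add: ann_def)
    \<comment> \<open>Any witness that \<open>ann N\<close> shrinks supplies \<mu>. For \<nu> in
      \<open>ann N\<close>, the functional \<open>w |-> w \<nu>\<close> is represented by some
      \<open>u\<close>, so \<open>w (\<nu> - u \<mu>)\<close> lies in \<open>B\<close> for every
      \<open>w\<close> into \<open>S\<close>.\<close>
    define \<mu> where "\<mu> = cmp w\<^sub>0 \<nu>\<^sub>0"
    have \<mu>: "\<mu> \<in> carrier ?HS" "\<mu> \<notin> B" using cmp_closed[OF 0(2) \<nu>\<^sub>0] 0(3) by (simp_all add: \<mu>_def)
    have \<mu>H: "\<mu> \<in> carrier HQV" by (rule HS_D(3)[OF \<mu>(1)])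
    interpret P: pairing K ?G "hom_mod A \<phi> V V" ?HS "\<lambda>w u. cmp w (cmp u \<mu>)" "B \<inter> carrier ?HS"
      by (rule pairing_composition[OF S \<mu>])
    have fg: "fin_gen K ?G"
      by (rule fin_gen_hom_mod[OF V_mod V_fin_gen sub_mod[OF sS] fin_gen_submodule[OF V_mod V_fin_gen sS]])
    show ?thesis
    proof (rule bexI[OF _ \<mu>(1)], rule ballI)
      fix \<nu> assume \<nu>: "\<nu> \<in> ann N"
      have \<nu>H: "\<nu> \<in> carrier HQV" using \<nu> by (simp add: ann_def)
      obtain u where u: "u \<in> carrier (hom_mod A \<phi> V V)"
        "\<And>w. w \<in> carrier ?G \<Longrightarrow> cmp w (cmp u \<mu>) \<ominus>\<^bsub>?HS\<^esub> cmp w \<nu> \<in> B"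
        using P.functional_represented[OF fg cmp_left_hom[OF \<nu>H]] by blast
      note uh = hom_modD(1)[OF u(1)]
      have uH: "cmp u \<mu> \<in> carrier HQV" by (rule cmp_closed[OF uh \<mu>H])
      have dH: "\<nu> \<ominus>\<^bsub>HQV\<^esub> cmp u \<mu> \<in> carrier HQV" by (rule H.M.minus_closed[OF \<nu>H uH])
      show "\<exists>u\<in>mod_hom A V V. \<nu> \<ominus>\<^bsub>HQV\<^esub> cmp u \<mu> \<in> ann (N <+>\<^bsub>V\<^esub> S)"
      proof (rule bexI[OF _ uh], rule ann_add[OF N sS NS])
        show "\<nu> \<ominus>\<^bsub>HQV\<^esub> cmp u \<mu> \<in> ann N"
          unfolding ann_def
        proof (intro CollectI conjI ballI impI dH)
          fix v assume v: "v \<in> mod_hom A V V" "v ` carrier V \<subseteq> N"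
          \<comment> \<open>Since \<mu> was obtained from a member of \<open>ann N\<close>, so was
            \<open>u \<mu>\<close>: the composite \<open>v u w\<^sub>0\<close> is an endomorphism of
            \<open>V\<close> whose image lies in that of \<open>v\<close>, hence in
            \<open>N\<close>.\<close>
          have "cmp v (cmp u \<mu>) = cmp (\<lambda>x. v (u (w\<^sub>0 x))) \<nu>\<^sub>0"
            by (simp add: \<mu>_def cmp_cmp[OF \<nu>\<^sub>0])
          moreover have vuw: "(\<lambda>x. v (u (w\<^sub>0 x))) \<in> mod_hom A V V"
            by (rule mod_hom_comp[OF mod_hom_comp[OF sub_hom_V[OF sS 0(2)] uh] v(1)])
          moreover have "(\<lambda>x. v (u (w\<^sub>0 x))) ` carrier V \<subseteq> N"
            using v(2) mod_homD(1)[OF mod_hom_comp[OF sub_hom_V[OF sS 0(2)] uh]] by auto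
          ultimately have 1: "cmp v (cmp u \<mu>) \<in> B" using 0(1) unfolding ann_def by simp
          have "cmp v \<nu> \<in> B" using \<nu> v unfolding ann_def by blast
          then show "cmp v (\<nu> \<ominus>\<^bsub>HQV\<^esub> cmp u \<mu>) \<in> B"
            unfolding cmp_minus[OF v(1) \<nu>H uH] by (rule B_D(7)[OF _ 1])
        qed
      next
        fix w assume w: "w \<in> mod_hom A V (sub S)"
        note wV = sub_hom_V[OF sS w]
        let ?w = "restrict w (carrier V)"
        have e: "cmp ?w \<nu> = cmp w \<nu>" "cmp ?w (cmp u \<mu>) = cmp w (cmp u \<mu>)"
          using cmp_restrict \<nu>H uH by auto
        have c: "cmp w \<nu> \<in> carrier ?HS" "cmp w (cmp u \<mu>) \<in> carrier ?HS"
          by (rule cmp_closed[OF w \<nu>H], rule cmp_closed[OF w uH])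
        have "cmp w (cmp u \<mu>) \<ominus>\<^bsub>?HS\<^esub> cmp w \<nu> \<in> B"
          using u(2)[OF restrict_mod_hom[OF V_mod w]] unfolding e .
        then have "cmp w (cmp u \<mu>) \<ominus>\<^bsub>HQV\<^esub> cmp w \<nu> \<in> B"
          using H.restrict_minus[OF HS_sub c(1), of "cmp w (cmp u \<mu>)"]
          unfolding hom_mod_restrict[symmetric] by simp
        then have "\<ominus>\<^bsub>HQV\<^esub> (cmp w (cmp u \<mu>) \<ominus>\<^bsub>HQV\<^esub> cmp w \<nu>) \<in> B" by (rule B_D(6))
        moreover have "\<ominus>\<^bsub>HQV\<^esub> (cmp w (cmp u \<mu>) \<ominus>\<^bsub>HQV\<^esub> cmp w \<nu>) = cmp w (\<nu> \<ominus>\<^bsub>HQV\<^esub> cmp u \<mu>)"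
          unfolding cmp_minus[OF wV \<nu>H uH] using HS_D(3)[OF c(1)] HS_D(3)[OF c(2)]
          by (simp add: H.M.minus_eq H.M.minus_add H.M.a_comm)
        ultimately show "cmp w (\<nu> \<ominus>\<^bsub>HQV\<^esub> cmp u \<mu>) \<in> B" by simp
      qed
    qed
  qed
qed

text \<open>If \<nu> were nonzero, projecting to a simple submodule \<open>S\<close> of its image
  would give a surjection \<sigma> from \<open>Q\<close> onto \<open>S\<close>, with maximal kernel.
  The map \<open>a\<close> outside \<open>B\<close> that \<open>avoid\<close> provides for this
  kernel factors through \<sigma>, hence is an endomorphism of \<open>V\<close> applied to \<nu>,
  and so lies in \<open>B\<close> after all.\<close>

lemma ann_carrier:
  assumes \<nu>: "\<nu> \<in> ann (carrier V)" and x: "x \<in> carrier Q"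
  shows "\<nu> x = \<zero>\<^bsub>V\<^esub>"
proof (rule ccontr)
  assume nz: "\<nu> x \<noteq> \<zero>\<^bsub>V\<^esub>"
  have \<nu>H: "\<nu> \<in> carrier HQV" using \<nu> by (simp add: ann_def)
  note \<nu>h = hom_modD(1)[OF \<nu>H]
  have im: "submodule (\<nu> ` carrier Q) A V"
    by (rule submodule_image[OF Q_mod V_mod \<nu>h Q.submodule_carrier])
  have imnz: "\<nu> ` carrier Q \<noteq> {\<zero>\<^bsub>V\<^esub>}" using nz x by blast
  obtain S where S: "simple_submodule A V S" "S \<subseteq> \<nu> ` carrier Q"
    by (rule V.simple_submodule_exists[OF dcc_fin_gen_module[OF V_mod V_fin_gen] im imnz])
  note sS = V.simple_submoduleD(1)[OF S(1)]
  obtain p where p: "p \<in> mod_hom A V (sub S)" "\<And>x. x \<in> S \<Longrightarrow> p x = x"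
    by (rule V.semisimple_projection[OF V_semisimple sS]) blast
  note pV = sub_hom_V[OF sS p(1)]
  define \<sigma> where "\<sigma> x = p (\<nu> x)" for x
  have \<sigma>: "\<sigma> \<in> mod_hom A Q (sub S)" unfolding \<sigma>_def by (rule mod_hom_comp[OF \<nu>h p(1)])
  have \<sigma>_surj: "\<sigma> ` carrier Q = S"
  proof
    show "S \<subseteq> \<sigma> ` carrier Q"
    proof
      fix s assume s: "s \<in> S"
      then obtain y where "y \<in> carrier Q" "s = \<nu> y" using S(2) by blast
      then have "s = \<sigma> y" using p(2)[OF s] by (simp add: \<sigma>_def)
      then show "s \<in> \<sigma> ` carrier Q" using \<open>y \<in> carrier Q\<close> by (rule image_eqI)
    qed
  qed (use mod_homD(1)[OF \<sigma>] in auto)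
  let ?M = "mod_kernel Q (sub S) \<sigma>"
  have M: "submodule ?M A Q" by (rule submodule_kernel[OF Q_mod sub_mod[OF sS] \<sigma>])
  have "maximal_submodule A Q ?M"
    unfolding maximal_submodule_def
  proof (intro conjI allI impI M)
    show "?M \<noteq> carrier Q"
    proof
      assume "?M = carrier Q"
      then have "\<sigma> ` carrier Q \<subseteq> {\<zero>\<^bsub>V\<^esub>}" by (auto simp: mod_kernel_def)
      then show False
        using \<sigma>_surj V.simple_submoduleD(2)[OF S(1)] V.submoduleD(2)[OF sS] by blast
    qed
    fix L assume L: "submodule L A Q \<and> ?M \<subseteq> L"
    note l = Q.submoduleD[OF conjunct1[OF L]]
    have \<sigma>V: "\<sigma> \<in> mod_hom A Q V" by (rule sub_hom_V[OF sS \<sigma>])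
    have \<sigma>L: "submodule (\<sigma> ` L) A V" by (rule submodule_image[OF Q_mod V_mod \<sigma>V conjunct1[OF L]])
    have \<sigma>LS: "\<sigma> ` L \<subseteq> S" using \<sigma>_surj l(1) by blast
    show "L = ?M \<or> L = carrier Q"
    proof (cases "\<sigma> ` L = {\<zero>\<^bsub>V\<^esub>}")
      case True
      then have "L \<subseteq> ?M" using l(3) by (auto simp: mod_kernel_def)
      then show ?thesis using L by blast
    next
      case False
      then have eq: "\<sigma> ` L = S" using V.simple_submoduleD(3)[OF S(1) \<sigma>L \<sigma>LS] by simp
      have "carrier Q \<subseteq> L"
      proof
        fix y assume y: "y \<in> carrier Q"
        then have "\<sigma> y \<in> \<sigma> ` L" using \<sigma>_surj eq by blast
        then obtain z where z: "z \<in> L" "\<sigma> y = \<sigma> z" by auto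
        have zQ: "z \<in> carrier Q" by (rule l(3)[OF z(1)])
        have "\<sigma> (y \<ominus>\<^bsub>Q\<^esub> z) = \<zero>\<^bsub>V\<^esub>"
          using mod_hom_minus[OF Q_mod V_mod \<sigma>V y zQ] z(2) V.minus_self[OF mod_homD(1)[OF \<sigma>V zQ]] by simp
        then have "y \<ominus>\<^bsub>Q\<^esub> z \<in> L" using L y zQ by (auto simp: mod_kernel_def)
        from l(4)[OF this z(1)] show "y \<in> L"
          using y zQ by (simp add: Q.M.minus_eq Q.M.a_assoc Q.M.l_neg)
      qed
      then show ?thesis using l(1) by blast
    qed
  qed
  then obtain a where a: "a \<in> carrier HQV" "a \<notin> B" "\<forall>x\<in>?M. a x = \<zero>\<^bsub>V\<^esub>" using avoid by blast
  have "\<exists>t. t \<in> mod_hom A (sub S) V \<and> (\<forall>x\<in>carrier Q. t (\<sigma> x) = a x)"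
  proof (rule factor_through_surjection[OF Q_mod sub_mod[OF sS] V_mod \<sigma> _ hom_modD(1)[OF a(1)]])
    show "\<sigma> ` carrier Q = carrier (sub S)" using \<sigma>_surj by simp
    fix y assume "y \<in> carrier Q" "\<sigma> y = \<zero>\<^bsub>sub S\<^esub>"
    then show "a y = \<zero>\<^bsub>V\<^esub>" using a(3) by (simp add: mod_kernel_def)
  qed blast
  then obtain t where t: "t \<in> mod_hom A (sub S) V" "\<And>x. x \<in> carrier Q \<Longrightarrow> t (\<sigma> x) = a x" by blast
  have tp: "(\<lambda>x. t (p x)) \<in> mod_hom A V V" by (rule mod_hom_comp[OF p(1) t(1)])
  have "cmp (\<lambda>x. t (p x)) \<nu> = a"
    by (rule hom_mod_eqI[OF cmp_closed[OF tp \<nu>H] a(1) refl]) (use t(2) in \<open>simp add: cmp_def \<sigma>_def\<close>)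
  moreover have "(\<lambda>x. t (p x)) ` carrier V \<subseteq> carrier V" using mod_homD(1)[OF tp] by auto
  then have "cmp (\<lambda>x. t (p x)) \<nu> \<in> B" using \<nu> tp unfolding ann_def by simp
  ultimately show False using a(2) by simp
qed

lemma ann_zero: "ann {\<zero>\<^bsub>V\<^esub>} = carrier HQV"
proof
  show "carrier HQV \<subseteq> ann {\<zero>\<^bsub>V\<^esub>}"
    unfolding ann_def
  proof (intro subsetI CollectI conjI ballI impI)
    fix \<nu> v assume \<nu>: "\<nu> \<in> carrier HQV" and v: "v ` carrier V \<subseteq> {\<zero>\<^bsub>V\<^esub>}"
    have "cmp v \<nu> = \<zero>\<^bsub>HQV\<^esub>"
      unfolding cmp_def hom_mod_simps(2) by (rule restrict_ext) (use v hom_modD(2)[OF \<nu>] in blast)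
    then show "cmp v \<nu> \<in> B" using B_D(2) by simp
  qed
qed (auto simp: ann_def)

text \<open>The invariant is that \<open>l\<close> maps \<open>Q\<close> into \<open>N\<close> and
  that \<open>rad N\<close> meets its kernel only inside \<open>rad 0\<close>. It holds trivially
  for \<open>N = 0\<close>. For \<open>N = V\<close> it is the claim, because \<open>rad V\<close>
  is \<open>Q\<close> and \<open>rad 0\<close> is the common kernel of all maps into
  \<open>V\<close>.\<close>

theorem exists_minimal_kernel:
  "\<exists>l\<in>mod_hom A Q V. \<forall>x\<in>carrier Q. l x = \<zero>\<^bsub>V\<^esub> \<longrightarrow> (\<forall>\<nu>\<in>mod_hom A Q V. \<nu> x = \<zero>\<^bsub>V\<^esub>)"
proof -
  let ?F = "{N. submodule N A V \<and> (\<exists>l\<in>mod_hom A Q V. l ` carrier Q \<subseteq> N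
    \<and> (\<forall>x\<in>rad N. l x = \<zero>\<^bsub>V\<^esub> \<longrightarrow> x \<in> rad {\<zero>\<^bsub>V\<^esub>}))}"
  have "{\<zero>\<^bsub>V\<^esub>} \<in> ?F"
    using V.submodule_zero mod_hom_zero_map[OF V_mod] by (auto intro!: bexI[of _ "\<lambda>_. \<zero>\<^bsub>V\<^esub>"])
  then have ne: "?F \<noteq> {}" by blast
  obtain N where N: "N \<in> ?F" "\<And>L. \<lbrakk>L \<in> ?F; N \<subseteq> L\<rbrakk> \<Longrightarrow> L = N"
    by (rule noetherian_maximal[OF V_mod noetherian_fin_gen_module[OF V_mod V_fin_gen] ne]) blast+
  then obtain l where sN: "submodule N A V" and l: "l \<in> mod_hom A Q V" "l ` carrier Q \<subseteq> N"
    "\<And>x. x \<in> rad N \<Longrightarrow> l x = \<zero>\<^bsub>V\<^esub> \<Longrightarrow> x \<in> rad {\<zero>\<^bsub>V\<^esub>}" by blast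
  have "S \<subseteq> N" if S: "simple_submodule A V S" for S
  proof (rule ccontr)
    assume "\<not> S \<subseteq> N"
    then have NS: "N \<inter> S = {\<zero>\<^bsub>V\<^esub>}" using V.simple_submodule_cases[OF S sN] by blast
    note sS = V.simple_submoduleD(1)[OF S]
    obtain \<mu> where \<mu>: "\<mu> \<in> carrier (hom_mod A \<phi> Q (sub S))"
      "\<And>\<nu>. \<nu> \<in> ann N \<Longrightarrow> \<exists>u\<in>mod_hom A V V. \<nu> \<ominus>\<^bsub>HQV\<^esub> cmp u \<mu> \<in> ann (N <+>\<^bsub>V\<^esub> S)"
      using ann_step[OF sN S NS] by blast
    have \<mu>H: "\<mu> \<in> carrier HQV" using hom_sub_subset[OF sS] \<mu>(1) by blast
    \<comment> \<open>As \<open>N\<close> and \<open>S\<close> meet in zero, the sum vanishes only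
      where \<open>l\<close> and \<mu> both vanish. There every member of \<open>ann N\<close>
      agrees with its correction in \<open>ann (N + S)\<close>, which vanishes on the new
      \<open>rad\<close>.\<close>
    let ?l = "\<lambda>x. l x \<oplus>\<^bsub>V\<^esub> \<mu> x"
    have "N <+>\<^bsub>V\<^esub> S \<in> ?F"
    proof (intro CollectI conjI bexI[of _ ?l] ballI impI)
      show "submodule (N <+>\<^bsub>V\<^esub> S) A V" by (rule V.submodule_set_add[OF sN sS])
      show "?l \<in> mod_hom A Q V" by (rule mod_hom_add[OF V_mod l(1) hom_modD(1)[OF \<mu>H]])
      have lN: "l x \<in> N" if "x \<in> carrier Q" for x using that l(2) by blast
      have \<mu>S: "\<mu> x \<in> S" if "x \<in> carrier Q" for x using hom_modD(2)[OF \<mu>(1) that] by simp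
      show "?l ` carrier Q \<subseteq> N <+>\<^bsub>V\<^esub> S" using V.set_addI[OF lN \<mu>S] by blast
      fix x assume x: "x \<in> rad (N <+>\<^bsub>V\<^esub> S)" and z: "?l x = \<zero>\<^bsub>V\<^esub>"
      have xQ: "x \<in> carrier Q" using x by (simp add: rad_def)
      have m: "l x \<in> carrier V" "\<mu> x \<in> carrier V"
        using V.submoduleD(3)[OF sN lN[OF xQ]] V.submoduleD(3)[OF sS \<mu>S[OF xQ]] .
      have "l x = \<ominus>\<^bsub>V\<^esub> \<mu> x" using V.M.minus_equality[OF z m(2,1)] by simp
      then have "l x \<in> N \<inter> S" using lN[OF xQ] V.submoduleD(6)[OF sS \<mu>S[OF xQ]] by simp
      then have lx: "l x = \<zero>\<^bsub>V\<^esub>" using NS by blast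
      then have \<mu>x: "\<mu> x = \<zero>\<^bsub>V\<^esub>" using z m by simp
      have "\<nu> x = \<zero>\<^bsub>V\<^esub>" if \<nu>: "\<nu> \<in> ann N" for \<nu>
      proof -
        have \<nu>H: "\<nu> \<in> carrier HQV" using \<nu> by (simp add: ann_def)
        obtain u where u: "u \<in> mod_hom A V V" "\<nu> \<ominus>\<^bsub>HQV\<^esub> cmp u \<mu> \<in> ann (N <+>\<^bsub>V\<^esub> S)"
          using \<mu>(2)[OF \<nu>] by blast
        have "(\<nu> \<ominus>\<^bsub>HQV\<^esub> cmp u \<mu>) x = \<zero>\<^bsub>V\<^esub>" using x u(2) by (simp add: rad_def)
        then have "\<nu> x \<ominus>\<^bsub>V\<^esub> u (\<mu> x) = \<zero>\<^bsub>V\<^esub>"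
          using hom_mod_minus[OF Q_mod V_mod \<nu>H cmp_closed[OF u(1) \<mu>H]] xQ by (simp add: cmp_def)
        then show ?thesis
          using \<mu>x mod_hom_zero[OF V_mod V_mod u(1)] V.minus_zero_right[OF hom_modD(2)[OF \<nu>H xQ]] by simp
      qed
      then have "x \<in> rad N" using xQ by (simp add: rad_def)
      then show "x \<in> rad {\<zero>\<^bsub>V\<^esub>}" using l(3) lx by blast
    qed
    then have "N <+>\<^bsub>V\<^esub> S = N" using N(2) V.set_add_upper(1)[OF sN sS] by blast
    then show False using V.set_add_upper(2)[OF sN sS] \<open>\<not> S \<subseteq> N\<close> by simp
  qed
  then have "N = carrier V" using V_semisimple sN unfolding V.semisimple_def by blast
  then have radN: "rad N = carrier Q" using ann_carrier by (auto simp: rad_def)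
  show ?thesis
  proof (rule bexI[OF _ l(1)], intro ballI impI)
    fix x \<nu> assume x: "x \<in> carrier Q" "l x = \<zero>\<^bsub>V\<^esub>" and \<nu>: "\<nu> \<in> mod_hom A Q V"
    have "x \<in> rad {\<zero>\<^bsub>V\<^esub>}" by (rule l(3)) (use x radN in simp_all)
    moreover have "restrict \<nu> (carrier Q) \<in> carrier HQV" by (rule restrict_mod_hom[OF Q_mod \<nu>])
    ultimately have "restrict \<nu> (carrier Q) x = \<zero>\<^bsub>V\<^esub>" unfolding rad_def ann_zero by blast
    then show "\<nu> x = \<zero>\<^bsub>V\<^esub>" using x by simp
  qed
qed

end

text \<open>Zorn's lemma enlarges \<open>A\<^sub>0\<close> to a \<open>B\<close> maximal with
  respect to missing \<open>a\<^sub>1\<close>. No member \<open>a\<close> of the coset lies in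
  \<open>B\<close>, since \<open>a\<^sub>1 - a\<close> does; this turns the coset hypothesis into
  \<open>avoid\<close>.\<close>

theorem (in artin_alg) exists_hom_with_minimal_kernel:
  assumes Q: "left_module A Q" and V: "left_module A V" "fin_gen A V" "left_module.semisimple A V"
    and A\<^sub>0: "submodule A\<^sub>0 K (hom_mod A \<phi> Q V)"
    and a\<^sub>1: "a\<^sub>1 \<in> carrier (hom_mod A \<phi> Q V)" "a\<^sub>1 \<notin> A\<^sub>0"
    and coset: "\<And>M. maximal_submodule A Q M \<Longrightarrow> \<exists>a\<in>carrier (hom_mod A \<phi> Q V).
        a\<^sub>1 \<ominus>\<^bsub>hom_mod A \<phi> Q V\<^esub> a \<in> A\<^sub>0 \<and> (\<forall>x\<in>M. a x = \<zero>\<^bsub>V\<^esub>)"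
  shows "\<exists>l\<in>mod_hom A Q V. \<forall>x\<in>carrier Q. l x = \<zero>\<^bsub>V\<^esub> \<longrightarrow> (\<forall>\<nu>\<in>mod_hom A Q V. \<nu> x = \<zero>\<^bsub>V\<^esub>)"
proof -
  let ?H = "hom_mod A \<phi> Q V"
  interpret H: left_module K ?H by (rule left_module_hom_mod[OF Q V(1)])
  let ?C = "{B. submodule B K ?H \<and> A\<^sub>0 \<subseteq> B \<and> a\<^sub>1 \<notin> B}"
  have "\<exists>B\<in>?C. \<forall>L\<in>?C. B \<subseteq> L \<longrightarrow> L = B"
  proof (rule subset_Zorn_nonempty)
    show "?C \<noteq> {}" using A\<^sub>0 a\<^sub>1(2) by blast
    fix \<C> assume c: "\<C> \<noteq> {}" "subset.chain ?C \<C>"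
    then have "submodule (\<Union>\<C>) K ?H"
      by (intro H.submodule_Union_chain) (auto simp: subset.chain_def)
    then show "\<Union>\<C> \<in> ?C" using c unfolding subset.chain_def by blast
  qed
  then obtain B where B': "B \<in> ?C" "\<And>L. L \<in> ?C \<Longrightarrow> B \<subseteq> L \<Longrightarrow> L = B"
    by (elim bexE) (metis (no_types, lifting))
  then have B: "submodule B K ?H" "A\<^sub>0 \<subseteq> B" "a\<^sub>1 \<notin> B" by simp_all
  interpret Q: left_module A Q by (rule Q)
  interpret V: left_module A V by (rule V(1))
  interpret hom_hyperplane K A \<phi> Q V B a\<^sub>1
  proof (intro hom_hyperplane.intro hom_hyperplane_axioms.intro artin_alg_axioms Q V a\<^sub>1(1) B(1,3))
    fix L assume "submodule L K ?H" "B \<subseteq> L" "a\<^sub>1 \<notin> L"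
    then show "L = B" using B'(2)[of L] B(2) by blast
  next
    fix M assume "maximal_submodule A Q M"
    then obtain a where a: "a \<in> carrier ?H" "a\<^sub>1 \<ominus>\<^bsub>?H\<^esub> a \<in> A\<^sub>0" "\<forall>x\<in>M. a x = \<zero>\<^bsub>V\<^esub>" using coset by blast
    have "a \<notin> B"
    proof
      assume "a \<in> B"
      then have "(a\<^sub>1 \<ominus>\<^bsub>?H\<^esub> a) \<oplus>\<^bsub>?H\<^esub> a \<in> B" using H.submoduleD(4)[OF B(1)] a(2) B(2) by blast
      then show False using B(3) a\<^sub>1(1) a(1) by (simp add: H.M.minus_eq H.M.a_assoc H.M.l_neg)
    qed
    then show "\<exists>a\<in>carrier ?H. a \<notin> B \<and> (\<forall>x\<in>M. a x = \<zero>\<^bsub>V\<^esub>)" using a by blast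
  qed
  show ?thesis by (rule exists_minimal_kernel)
qed

subsection \<open>Free modules inside the universe\<close>

text \<open>The full product of copies of \<open>A\<close>, which is the free module when
  \<open>I\<close> is finite.\<close>

definition free_module :: "('a, 'r) ring_scheme \<Rightarrow> 'i set \<Rightarrow> ('a, 'i \<Rightarrow> 'a) module" where
  "free_module A I =
    \<lparr>carrier = I \<rightarrow>\<^sub>E carrier A, mult = undefined, one = undefined, zero = (\<lambda>i\<in>I. \<zero>\<^bsub>A\<^esub>),
     add = (\<lambda>f g. \<lambda>i\<in>I. f i \<oplus>\<^bsub>A\<^esub> g i), smult = (\<lambda>a f. \<lambda>i\<in>I. a \<otimes>\<^bsub>A\<^esub> f i)\<rparr>"

definition free_basis :: "('a, 'r) ring_scheme \<Rightarrow> 'i set \<Rightarrow> 'i \<Rightarrow> 'i \<Rightarrow> 'a" where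
  "free_basis A I j = (\<lambda>i\<in>I. if j = i then \<one>\<^bsub>A\<^esub> else \<zero>\<^bsub>A\<^esub>)"

lemma free_module_simps:
  "carrier (free_module A I) = I \<rightarrow>\<^sub>E carrier A"
  "zero (free_module A I) = (\<lambda>i\<in>I. \<zero>\<^bsub>A\<^esub>)"
  "f \<oplus>\<^bsub>free_module A I\<^esub> g = (\<lambda>i\<in>I. f i \<oplus>\<^bsub>A\<^esub> g i)"
  "a \<odot>\<^bsub>free_module A I\<^esub> f = (\<lambda>i\<in>I. a \<otimes>\<^bsub>A\<^esub> f i)"
  by (simp_all add: free_module_def)

text \<open>Unlike \<open>PiE_mem\<close>, this has a first-order conclusion and can rewrite.\<close>

lemma PiE_coord: "\<lbrakk>f \<in> I \<rightarrow>\<^sub>E C; i \<in> I\<rbrakk> \<Longrightarrow> f i \<in> C"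
  by (rule PiE_mem)

context ring
begin

lemma left_module_free: "left_module R (free_module R I)"
proof -
  have ab: "abelian_group (free_module R I)"
  proof (rule abelian_groupI; (unfold free_module_simps)?)
    fix f assume f: "f \<in> I \<rightarrow>\<^sub>E carrier R"
    have "(\<lambda>i\<in>I. \<ominus> f i) \<in> I \<rightarrow>\<^sub>E carrier R" by (simp add: PiE_coord[OF f])
    moreover have "(\<lambda>i\<in>I. (\<lambda>i\<in>I. \<ominus> f i) i \<oplus> f i) = (\<lambda>i\<in>I. \<zero>)"
      by (rule restrict_ext) (simp add: l_neg PiE_coord[OF f])
    ultimately show "\<exists>g\<in>I \<rightarrow>\<^sub>E carrier R. (\<lambda>i\<in>I. g i \<oplus> f i) = (\<lambda>i\<in>I. \<zero>)" by blast
    show "(\<lambda>i\<in>I. (\<lambda>i\<in>I. \<zero>) i \<oplus> f i) = f"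
      by (rule extensionalityI[of _ I]) (use f in \<open>simp_all add: PiE_coord[OF f] PiE_iff\<close>)
  next
    fix f g assume fg: "f \<in> I \<rightarrow>\<^sub>E carrier R" "g \<in> I \<rightarrow>\<^sub>E carrier R"
    show "(\<lambda>i\<in>I. f i \<oplus> g i) = (\<lambda>i\<in>I. g i \<oplus> f i)"
      by (rule restrict_ext) (simp add: a_comm PiE_coord[OF fg(1)] PiE_coord[OF fg(2)])
    show "(\<lambda>i\<in>I. f i \<oplus> g i) \<in> I \<rightarrow>\<^sub>E carrier R" by (simp add: PiE_coord[OF fg(1)] PiE_coord[OF fg(2)])
    fix h assume h: "h \<in> I \<rightarrow>\<^sub>E carrier R"
    show "(\<lambda>i\<in>I. (\<lambda>i\<in>I. f i \<oplus> g i) i \<oplus> h i) = (\<lambda>i\<in>I. f i \<oplus> (\<lambda>i\<in>I. g i \<oplus> h i) i)"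
      by (rule restrict_ext) (simp add: a_assoc PiE_coord[OF fg(1)] PiE_coord[OF fg(2)] PiE_coord[OF h])
  qed auto
  show ?thesis
  proof (intro left_module.intro left_module_axioms.intro ring_axioms ab; unfold free_module_simps)
    fix a f assume a: "a \<in> carrier R" and f: "f \<in> I \<rightarrow>\<^sub>E carrier R"
    show "(\<lambda>i\<in>I. a \<otimes> f i) \<in> I \<rightarrow>\<^sub>E carrier R" by (simp add: a PiE_coord[OF f])
    fix b assume b: "b \<in> carrier R"
    show "(\<lambda>i\<in>I. (a \<oplus> b) \<otimes> f i) = (\<lambda>i\<in>I. (\<lambda>i\<in>I. a \<otimes> f i) i \<oplus> (\<lambda>i\<in>I. b \<otimes> f i) i)"
      by (rule restrict_ext) (simp add: a b l_distr PiE_coord[OF f])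
    show "(\<lambda>i\<in>I. a \<otimes> b \<otimes> f i) = (\<lambda>i\<in>I. a \<otimes> (\<lambda>i\<in>I. b \<otimes> f i) i)"
      by (rule restrict_ext) (simp add: a b m_assoc PiE_coord[OF f])
  next
    fix a f g assume a: "a \<in> carrier R" and f: "f \<in> I \<rightarrow>\<^sub>E carrier R" "g \<in> I \<rightarrow>\<^sub>E carrier R"
    show "(\<lambda>i\<in>I. a \<otimes> (\<lambda>i\<in>I. f i \<oplus> g i) i) = (\<lambda>i\<in>I. (\<lambda>i\<in>I. a \<otimes> f i) i \<oplus> (\<lambda>i\<in>I. a \<otimes> g i) i)"
      by (rule restrict_ext) (simp add: a r_distr PiE_coord[OF f(1)] PiE_coord[OF f(2)])
  next
    fix f assume f: "f \<in> I \<rightarrow>\<^sub>E carrier R"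
    show "(\<lambda>i\<in>I. \<one> \<otimes> f i) = f"
      by (rule extensionalityI[of _ I]) (use f in \<open>simp_all add: PiE_coord[OF f] PiE_iff\<close>)
  qed
qed

lemma free_basis_closed: "free_basis R I j \<in> carrier (free_module R I)"
  by (auto simp: free_basis_def free_module_simps)

text \<open>Induction on a finite set \<open>T\<close> of indices outside which \<open>f\<close>
  vanishes, splitting off one coordinate at a time.\<close>

lemma free_module_span:
  assumes "finite I"
  shows "mod_span R (free_module R I) (free_basis R I ` I) = carrier (free_module R I)"
proof -
  let ?F = "free_module R I"
  interpret F: left_module R ?F by (rule left_module_free)
  have bas: "free_basis R I ` I \<subseteq> carrier ?F" using free_basis_closed by auto
  have sp: "submodule (mod_span R ?F (free_basis R I ` I)) R ?F" by (rule F.submodule_mod_span[OF bas])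
  have main: "f \<in> mod_span R ?F (free_basis R I ` I)"
    if "finite T" "T \<subseteq> I" "f \<in> carrier ?F" "\<forall>i\<in>I - T. f i = \<zero>" for T f
    using that
  proof (induction T arbitrary: f rule: finite_induct)
    case empty
    then have "f = \<zero>\<^bsub>?F\<^esub>"
      by (intro extensionalityI[of _ I]) (simp_all add: free_module_simps PiE_iff)
    then show ?case using F.submoduleD(2)[OF sp] by simp
  next
    case (insert t T)
    have fI: "f \<in> I \<rightarrow>\<^sub>E carrier R" using insert.prems(2) by (simp add: free_module_simps)
    define g where "g = (\<lambda>i\<in>I. if i = t then \<zero> else f i)"
    have g: "g \<in> carrier ?F" by (simp add: g_def free_module_simps PiE_coord[OF fI])
    have "g \<in> mod_span R ?F (free_basis R I ` I)"
      using insert.prems by (intro insert.IH g) (auto simp: g_def)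
    moreover have "f t \<odot>\<^bsub>?F\<^esub> free_basis R I t \<in> mod_span R ?F (free_basis R I ` I)"
      using F.mod_span_subset[of "free_basis R I ` I"] insert.prems(1) PiE_coord[OF fI, of t]
      by (intro F.submoduleD(5)[OF sp]) auto
    ultimately have "f t \<odot>\<^bsub>?F\<^esub> free_basis R I t \<oplus>\<^bsub>?F\<^esub> g \<in> mod_span R ?F (free_basis R I ` I)"
      by (intro F.submoduleD(4)[OF sp])
    moreover have "f t \<odot>\<^bsub>?F\<^esub> free_basis R I t \<oplus>\<^bsub>?F\<^esub> g = f"
      by (rule extensionalityI[of _ I])
        (use fI insert.prems(1) PiE_coord[OF fI, of t] in
          \<open>simp_all add: free_module_simps free_basis_def g_def PiE_coord[OF fI] PiE_iff\<close>)
    ultimately show ?case by simp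
  qed
  show ?thesis
    using main[OF assms subset_refl] F.submoduleD(1)[OF sp] by auto
qed

lemma free_module_hom:
  assumes M: "left_module R M" and I: "finite I" and m: "\<And>i. i \<in> I \<Longrightarrow> m i \<in> carrier M"
  obtains l where "l \<in> mod_hom R (free_module R I) M" "\<And>i. i \<in> I \<Longrightarrow> l (free_basis R I i) = m i"
proof -
  interpret M: left_module R M by fact
  define l where "l f = (\<Oplus>\<^bsub>M\<^esub>i\<in>I. f i \<odot>\<^bsub>M\<^esub> m i)" for f
  have cl: "(\<lambda>i. f i \<odot>\<^bsub>M\<^esub> m i) \<in> I \<rightarrow> carrier M" if "f \<in> I \<rightarrow>\<^sub>E carrier R" for f
    using PiE_coord[OF that] m by simp
  have smult: "a \<odot>\<^bsub>M\<^esub> (\<Oplus>\<^bsub>M\<^esub>i\<in>J. g i) = (\<Oplus>\<^bsub>M\<^esub>i\<in>J. a \<odot>\<^bsub>M\<^esub> g i)"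
    if "a \<in> carrier R" "finite J" "g \<in> J \<rightarrow> carrier M" for a J g
    using that(2,3)
  proof (induction J rule: finite_induct)
    case (insert j J)
    then show ?case using that(1) by (simp add: Pi_def M.smult_r_distr)
  qed (use that(1) in simp)
  show thesis
  proof (rule that[of l])
    show "l \<in> mod_hom R (free_module R I) M"
    proof (rule mod_homI; unfold free_module_simps)
      fix f assume f: "f \<in> I \<rightarrow>\<^sub>E carrier R"
      show "l f \<in> carrier M" unfolding l_def by (rule M.finsum_closed[OF cl[OF f]])
      fix g assume g: "g \<in> I \<rightarrow>\<^sub>E carrier R"
      have "l (\<lambda>i\<in>I. f i \<oplus> g i) = (\<Oplus>\<^bsub>M\<^esub>i\<in>I. f i \<odot>\<^bsub>M\<^esub> m i \<oplus>\<^bsub>M\<^esub> g i \<odot>\<^bsub>M\<^esub> m i)"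
        unfolding l_def
        by (rule M.finsum_cong') (simp_all add: m M.smult_l_distr PiE_coord[OF f] PiE_coord[OF g])
      then show "l (\<lambda>i\<in>I. f i \<oplus> g i) = l f \<oplus>\<^bsub>M\<^esub> l g"
        unfolding l_def using M.finsum_addf[OF cl[OF f] cl[OF g]] by simp
    next
      fix a f assume a: "a \<in> carrier R" and f: "f \<in> I \<rightarrow>\<^sub>E carrier R"
      have "l (\<lambda>i\<in>I. a \<otimes> f i) = (\<Oplus>\<^bsub>M\<^esub>i\<in>I. a \<odot>\<^bsub>M\<^esub> (f i \<odot>\<^bsub>M\<^esub> m i))"
        unfolding l_def
        by (rule M.finsum_cong') (simp_all add: a m M.smult_assoc PiE_coord[OF f])
      then show "l (\<lambda>i\<in>I. a \<otimes> f i) = a \<odot>\<^bsub>M\<^esub> l f"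
        unfolding l_def using smult[OF a I cl[OF f]] by simp
    qed
    fix j assume j: "j \<in> I"
    have "l (free_basis R I j) = (\<Oplus>\<^bsub>M\<^esub>i\<in>I. if j = i then m i else \<zero>\<^bsub>M\<^esub>)"
      unfolding l_def by (rule M.finsum_cong') (simp_all add: m free_basis_def M.smult_one)
    also have "\<dots> = m j" by (rule M.finsum_singleton[OF j I]) (simp add: m)
    finally show "l (free_basis R I j) = m j" .
  qed
qed

end

lemma mod_hom_eq_on_span:
  assumes M: "left_module A M" and N: "left_module A N" and g: "g \<in> mod_hom A M N" and h: "h \<in> mod_hom A M N"
    and S: "S \<subseteq> carrier M" "mod_span A M S = carrier M" "\<And>s. s \<in> S \<Longrightarrow> g s = h s"
    and x: "x \<in> carrier M"
  shows "g x = h x"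
proof -
  interpret M: left_module A M by fact
  interpret N: left_module A N by fact
  have d: "(\<lambda>x. g x \<ominus>\<^bsub>N\<^esub> h x) \<in> mod_hom A M N" by (rule mod_hom_minus_map[OF N g h])
  have "S \<subseteq> mod_kernel M N (\<lambda>x. g x \<ominus>\<^bsub>N\<^esub> h x)"
    using S(1,3) mod_homD(1)[OF h] N.minus_self by (auto simp: mod_kernel_def)
  then have "carrier M \<subseteq> mod_kernel M N (\<lambda>x. g x \<ominus>\<^bsub>N\<^esub> h x)"
    unfolding S(2)[symmetric] by (rule M.mod_span_least[OF submodule_kernel[OF M N d]])
  then have "g x \<ominus>\<^bsub>N\<^esub> h x = \<zero>\<^bsub>N\<^esub>" using x by (auto simp: mod_kernel_def)
  then show ?thesis using N.minus_eq_zero_iff mod_homD(1)[OF g x] mod_homD(1)[OF h x] by blast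
qed

text \<open>Free modules consist of functions, whereas the terms of the complexes have elements in
  \<open>'m\<close>; a module is moved there along an injection, with the structure carried over
  verbatim.\<close>

lemma module_transport:
  fixes L :: "('a, 'l) module" and \<iota> :: "'l \<Rightarrow> 'm"
  assumes L: "left_module A L" and \<iota>: "inj_on \<iota> (carrier L)"
  obtains L' :: "('a, 'm) module" and \<kappa> where "left_module A L'" "\<iota> \<in> mod_hom A L L'" "\<kappa> \<in> mod_hom A L' L"
    "carrier L' = \<iota> ` carrier L" "\<And>x. x \<in> carrier L \<Longrightarrow> \<kappa> (\<iota> x) = x"
proof -
  interpret L: left_module A L by fact
  define \<kappa> where "\<kappa> = inv_into (carrier L) \<iota>"
  have \<kappa>: "\<kappa> (\<iota> x) = x" if "x \<in> carrier L" for x using inv_into_f_f[OF \<iota> that] by (simp add: \<kappa>_def)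
  define L' :: "('a, 'm) module" where "L' =
    \<lparr>carrier = \<iota> ` carrier L, mult = undefined, one = undefined, zero = \<iota> \<zero>\<^bsub>L\<^esub>,
     add = (\<lambda>x y. \<iota> (\<kappa> x \<oplus>\<^bsub>L\<^esub> \<kappa> y)), smult = (\<lambda>a x. \<iota> (a \<odot>\<^bsub>L\<^esub> \<kappa> x))\<rparr>"
  have s: "carrier L' = \<iota> ` carrier L" "\<zero>\<^bsub>L'\<^esub> = \<iota> \<zero>\<^bsub>L\<^esub>" "x \<oplus>\<^bsub>L'\<^esub> y = \<iota> (\<kappa> x \<oplus>\<^bsub>L\<^esub> \<kappa> y)"
    "a \<odot>\<^bsub>L'\<^esub> x = \<iota> (a \<odot>\<^bsub>L\<^esub> \<kappa> x)" for x y a by (simp_all add: L'_def)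
  have ab: "abelian_group L'"
  proof (rule abelian_groupI)
    fix x assume "x \<in> carrier L'"
    then obtain u where u: "u \<in> carrier L" "x = \<iota> u" by (auto simp: s)
    then show "\<exists>y\<in>carrier L'. y \<oplus>\<^bsub>L'\<^esub> x = \<zero>\<^bsub>L'\<^esub>"
      by (intro bexI[of _ "\<iota> (\<ominus>\<^bsub>L\<^esub> u)"]) (auto simp: s \<kappa> L.M.l_neg)
  qed (auto simp: s \<kappa> L.M.a_ac)
  show thesis
  proof (rule that[of L' \<kappa>])
    show "left_module A L'"
      by (intro left_module.intro left_module_axioms.intro L.A.ring_axioms ab)
        (auto simp: s \<kappa> L.smult_l_distr L.smult_r_distr L.smult_assoc L.smult_one)
  qed (auto intro!: mod_homI simp: s \<kappa>)
qed

text \<open>A copy of a finite free module inside the universe \<open>'m\<close>. Its projectivity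
  is checked on the basis: images of basis elements are lifted by choice and extended
  linearly.\<close>

lemma projective_presentation:
  fixes N :: "('a, 'm) module"
  assumes U: "universe_for TYPE('m) A" and N: "left_module A N" "fin_gen A N"
  obtains L :: "('a, 'm) module" and q where "L \<in> proj A" "q \<in> mod_hom A L N" "q ` carrier L = carrier N"
proof -
  interpret N: left_module A N by (rule N(1))
  obtain I where I: "finite I" "I \<subseteq> carrier N" "mod_span A N I = carrier N"
    using N(2) unfolding fin_gen_def by blast
  let ?F = "free_module A I" and ?b = "free_basis A I"
  note F = N.A.left_module_free[of I]
  interpret F: left_module A ?F by (rule F)
  have b: "?b i \<in> carrier ?F" for i by (rule N.A.free_basis_closed)
  have bS: "?b ` I \<subseteq> carrier ?F" using b by auto
  note span = N.A.free_module_span[OF I(1)]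
  obtain xs where xs: "set xs = I" using finite_list[OF I(1)] by blast
  obtain j :: "'a list \<Rightarrow> 'm" where j: "inj_on j (lists (carrier A))"
    using U unfolding universe_for_def lepoll_def by blast
  \<comment> \<open>An element of the free module is coded by the list of its coordinates, which
    \<open>universe_for\<close> allows to be embedded into \<open>'m\<close>.\<close>
  define \<iota> where "\<iota> f = j (map f xs)" for f
  have "inj_on \<iota> (carrier ?F)"
  proof (rule inj_onI)
    fix f g assume f: "f \<in> carrier ?F" and g: "g \<in> carrier ?F" and eq: "\<iota> f = \<iota> g"
    have "map f xs \<in> lists (carrier A)" "map g xs \<in> lists (carrier A)"
      using f g xs by (auto simp: free_module_simps)
    from inj_onD[OF j _ this] eq have "map f xs = map g xs" by (simp add: \<iota>_def)
    then have "\<And>i. i \<in> I \<Longrightarrow> f i = g i" unfolding xs[symmetric] by simp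
    then show "f = g" using f g
      by (intro extensionalityI[of f I g]) (simp_all add: free_module_simps PiE_iff)
  qed
  from module_transport[OF F this] obtain L :: "('a, 'm) module" and \<kappa> where
    L: "left_module A L" "\<iota> \<in> mod_hom A ?F L" "\<kappa> \<in> mod_hom A L ?F"
      "carrier L = \<iota> ` carrier ?F" "\<And>x. x \<in> carrier ?F \<Longrightarrow> \<kappa> (\<iota> x) = x" by blast
  have "projective A L"
    unfolding projective_def
  proof (intro conjI allI impI L(1))
    fix M N :: "('a, 'm) module" and p h
    assume "left_module A M \<and> left_module A N \<and> p \<in> mod_hom A M N \<and> p ` carrier M = carrier N
      \<and> h \<in> mod_hom A L N"
    then have M: "left_module A M" and N': "left_module A N" and p: "p \<in> mod_hom A M N" "p ` carrier M = carrier N"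
      and h: "h \<in> mod_hom A L N" by auto
    note h\<iota> = mod_hom_comp[OF L(2) h]
    define m where "m i = (SOME y. y \<in> carrier M \<and> p y = h (\<iota> (?b i)))" for i
    have m: "m i \<in> carrier M \<and> p (m i) = h (\<iota> (?b i))" for i
    proof -
      have "h (\<iota> (?b i)) \<in> p ` carrier M" using mod_homD(1)[OF h\<iota> b] p(2) by simp
      then obtain y where "y \<in> carrier M \<and> p y = h (\<iota> (?b i))" by auto
      then show ?thesis unfolding m_def by (rule someI)
    qed
    obtain l where l: "l \<in> mod_hom A ?F M" "\<And>i. i \<in> I \<Longrightarrow> l (?b i) = m i"
      by (rule N.A.free_module_hom[OF M I(1), of m]) (use m in auto)
    have eq: "p (l x) = h (\<iota> x)" if "x \<in> carrier ?F" for x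
      by (rule mod_hom_eq_on_span[OF F N' mod_hom_comp[OF l(1) p(1)] h\<iota> bS span _ that]) (use l(2) m in auto)
    show "\<exists>l\<in>mod_hom A L M. \<forall>x\<in>carrier L. p (l x) = h x"
      by (rule bexI[OF _ mod_hom_comp[OF L(3) l(1)]]) (use eq L(4,5) in auto)
  qed
  moreover have "fin_gen A L"
    unfolding fin_gen_def
  proof (intro exI conjI)
    show "finite (\<iota> ` ?b ` I)" using I(1) by simp
    show "\<iota> ` ?b ` I \<subseteq> carrier L" using bS L(4) by auto
    show "mod_span A L (\<iota> ` ?b ` I) = carrier L"
      using mod_span_image[OF F L(1,2) bS] unfolding span L(4) by simp
  qed
  ultimately have "L \<in> proj A" by (simp add: proj_def)
  obtain l where l: "l \<in> mod_hom A ?F N" "\<And>i. i \<in> I \<Longrightarrow> l (?b i) = i"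
    by (rule N.A.free_module_hom[OF N(1) I(1), of "\<lambda>i. i"]) (use I(2) in auto)
  note q = mod_hom_comp[OF L(3) l(1)]
  show thesis
  proof (rule that[OF \<open>L \<in> proj A\<close> q])
    have "l ` carrier ?F = mod_span A N (l ` ?b ` I)"
      using mod_span_image[OF F N(1) l(1) bS] unfolding span .
    also have "l ` ?b ` I = I" using l(2) by force
    finally show "(\<lambda>x. l (\<kappa> x)) ` carrier L = carrier N"
      unfolding L(4) I(3) using L(5) by (auto simp: image_image)
  qed
qed

lemma projective_lift:
  fixes M N P :: "('a, 'm) module"
  assumes "projective A P" "left_module A M" "left_module A N" "p \<in> mod_hom A M N" "p ` carrier M = carrier N"
    "h \<in> mod_hom A P N"
  shows "\<exists>l\<in>mod_hom A P M. \<forall>x\<in>carrier P. p (l x) = h x"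
  using assms unfolding projective_def by simp

text \<open>With a section \<open>s\<close> of \<open>c\<close>, the complement is the kernel of
  \<open>c\<close>, and \<open>x |-> (c x, x - s (c x))\<close> is the isomorphism with inverse
  \<open>(z, y) |-> s z + y\<close>.\<close>

lemma projective_splits:
  fixes P Z :: "('a, 'm) module"
  assumes P: "left_module A P" and Z: "projective A Z" and c: "c \<in> mod_hom A P Z" "c ` carrier P = carrier Z"
  shows "mod_summand A Z P"
proof -
  have ZM: "left_module A Z" using Z unfolding projective_def by simp
  interpret P: left_module A P by fact
  interpret Z: left_module A Z by fact
  have "\<exists>s\<in>mod_hom A Z P. \<forall>z\<in>carrier Z. c (s z) = z"
    using Z P ZM c mod_hom_id unfolding projective_def by blast
  then obtain s where s: "s \<in> mod_hom A Z P" "\<And>z. z \<in> carrier Z \<Longrightarrow> c (s z) = z" by blast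
  let ?k = "mod_kernel P Z c"
  have k: "submodule ?k A P" by (rule submodule_kernel[OF P ZM c(1)])
  define e where "e x = x \<ominus>\<^bsub>P\<^esub> s (c x)" for x
  have e: "e \<in> mod_hom A P P"
    unfolding e_def by (rule mod_hom_minus_map[OF P mod_hom_id mod_hom_comp[OF c(1) s(1)]])
  note cD = mod_homD[OF c(1)] and sD = mod_homD[OF s(1)] and eD = mod_homD[OF e]
  have ek: "e x \<in> ?k" if x: "x \<in> carrier P" for x
  proof -
    have "c (e x) = c x \<ominus>\<^bsub>Z\<^esub> c (s (c x))"
      unfolding e_def by (rule mod_hom_minus[OF P ZM c(1) x sD(1)[OF cD(1)[OF x]]])
    then have "c (e x) = \<zero>\<^bsub>Z\<^esub>" using s(2)[OF cD(1)[OF x]] Z.minus_self[OF cD(1)[OF x]] by simp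
    then show ?thesis using eD(1)[OF x] by (simp add: mod_kernel_def)
  qed
  have sum_eq: "s (c x) \<oplus>\<^bsub>P\<^esub> e x = x" if x: "x \<in> carrier P" for x
    using x sD(1)[OF cD(1)[OF x]] by (simp add: e_def P.M.minus_eq P.M.a_lcomm P.M.r_neg)
  let ?N = "P\<lparr>carrier := ?k\<rparr>" and ?h = "\<lambda>x. (c x, e x)"
  have "mod_isomorphic A P (mod_sum Z ?N)"
    unfolding mod_isomorphic_def
  proof (rule bexI[of _ ?h])
    show "?h \<in> mod_hom A P (mod_sum Z ?N)"
      by (rule mod_homI) (simp_all add: mod_sum_def cD eD ek)
    show "bij_betw ?h (carrier P) (carrier (mod_sum Z ?N))"
      unfolding bij_betw_def
    proof
      show "inj_on ?h (carrier P)"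
      proof (rule inj_onI)
        fix x y assume x: "x \<in> carrier P" and y: "y \<in> carrier P" and "?h x = ?h y"
        then have "s (c x) \<oplus>\<^bsub>P\<^esub> e x = s (c y) \<oplus>\<^bsub>P\<^esub> e y" by (simp only: prod.inject)
        then show "x = y" unfolding sum_eq[OF x] sum_eq[OF y] .
      qed
      show "?h ` carrier P = carrier (mod_sum Z ?N)"
      proof
        show "?h ` carrier P \<subseteq> carrier (mod_sum Z ?N)" using cD(1) ek by (auto simp: mod_sum_def)
        show "carrier (mod_sum Z ?N) \<subseteq> ?h ` carrier P"
        proof
          fix w assume "w \<in> carrier (mod_sum Z ?N)"
          then obtain z y where w: "w = (z, y)" "z \<in> carrier Z" "y \<in> carrier P" "c y = \<zero>\<^bsub>Z\<^esub>"
            by (auto simp: mod_sum_def mod_kernel_def)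
          let ?x = "s z \<oplus>\<^bsub>P\<^esub> y"
          have x: "?x \<in> carrier P" using sD(1)[OF w(2)] w(3) by simp
          have cx: "c ?x = z" using cD(2)[OF sD(1)[OF w(2)] w(3)] s(2)[OF w(2)] w(2,4) by simp
          have "e ?x = y" unfolding e_def cx by (intro P.add_minus_left sD(1) w(2,3))
          then show "w \<in> ?h ` carrier P" using x cx w(1) by (auto intro!: image_eqI[of _ _ ?x])
        qed
      qed
    qed
  qed
  then show ?thesis unfolding mod_summand_def using P.submodule_left_module[OF k] by blast
qed

subsection \<open>Irreducible morphisms into complexes with an extra leftmost term\<close>

lemma maximal_submodule_above:
  assumes M: "left_module A M" "noetherian_module A M" and N: "submodule N A M" "N \<noteq> carrier M"
  obtains L where "maximal_submodule A M L" "N \<subseteq> L"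
proof -
  let ?F = "{L. submodule L A M \<and> N \<subseteq> L \<and> L \<noteq> carrier M}"
  have ne: "?F \<noteq> {}" using N by blast
  show thesis
  proof (rule noetherian_maximal[OF M ne])
    fix L assume L: "L \<in> ?F" and max: "\<And>H. \<lbrakk>H \<in> ?F; L \<subseteq> H\<rbrakk> \<Longrightarrow> H = L"
    have "maximal_submodule A M L"
      unfolding maximal_submodule_def
    proof (intro conjI allI impI)
      fix H assume "submodule H A M \<and> L \<subseteq> H"
      then show "H = L \<or> H = carrier M" using max[of H] L by auto
    qed (use L in auto)
    then show thesis using that L by blast
  qed simp
qed

lemma zero_modD: "\<lbrakk>zero_mod M; x \<in> carrier M\<rbrakk> \<Longrightarrow> x = \<zero>\<^bsub>M\<^esub>"
  by (simp add: zero_mod_def)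

lemma cpx_projD:
  assumes "X \<in> cpx_proj A m n"
  shows "Obj X i \<in> proj A" "left_module A (Obj X i)" "fin_gen A (Obj X i)"
    "i \<notin> {m..n} \<Longrightarrow> zero_mod (Obj X i)"
    "Diff X i \<in> mod_hom A (Obj X i) (Obj X (i + 1))"
    "x \<in> carrier (Obj X i) \<Longrightarrow> Diff X (i + 1) (Diff X i x) = \<zero>\<^bsub>Obj X (i + 2)\<^esub>"
proof -
  show "Obj X i \<in> proj A" using assms unfolding cpx_proj_def by blast
  then show "left_module A (Obj X i)" "fin_gen A (Obj X i)" by (simp_all add: proj_def projective_def)
qed (use assms in \<open>unfold cpx_proj_def, blast+\<close>)

lemma cpx_homD:
  assumes "f \<in> cpx_hom A X Y"
  shows "f i \<in> mod_hom A (Obj X i) (Obj Y i)"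
    "x \<in> carrier (Obj X i) \<Longrightarrow> f (i + 1) (Diff X i x) = Diff Y i (f i x)"
  using assms unfolding cpx_hom_def by blast+

text \<open>The map out of degree -1 is reset to zero because its target is now
  \<open>L\<close>.\<close>

definition replace_zeroth ::
  "('a, 'm) cpx \<Rightarrow> ('a, 'm) module \<Rightarrow> ('m \<Rightarrow> 'm) \<Rightarrow> ('a, 'm) cpx" where
  "replace_zeroth W L q =
    \<lparr>Obj = (\<lambda>i. if i = 0 then L else Obj W i),
     Diff = (\<lambda>i. if i = 0 then (\<lambda>x. Diff W 0 (q x)) else if i = - 1 then (\<lambda>_. \<zero>\<^bsub>L\<^esub>) else Diff W i)\<rparr>"

lemma replace_zeroth_cpx_proj:
  assumes W: "W \<in> cpx_proj A 0 n" and n: "n \<ge> 0"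
    and L: "L \<in> proj A" and q: "q \<in> mod_hom A L (Obj W 0)"
  shows "replace_zeroth W L q \<in> cpx_proj A 0 n"
proof -
  note WD = cpx_projD[OF W]
  have LM: "left_module A L" using L by (simp add: proj_def projective_def)
  have dq: "(\<lambda>x. Diff W 0 (q x)) \<in> mod_hom A L (Obj W 1)"
    using mod_hom_comp[OF q WD(5)[of 0]] by simp
  let ?V = "replace_zeroth W L q"
  have "Diff ?V i \<in> mod_hom A (Obj ?V i) (Obj ?V (i + 1))" for i
    using dq mod_hom_zero_map[OF LM] WD(5)[of i] by (auto simp: replace_zeroth_def)
  moreover have "Diff ?V (i + 1) (Diff ?V i x) = \<zero>\<^bsub>Obj ?V (i + 2)\<^esub>" if x: "x \<in> carrier (Obj ?V i)" for i x
  proof -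
    \<comment> \<open>Exactly the two-step composites starting in these three degrees begin in, pass
      through or end in degree 0.\<close>
    consider "i = 0" | "i = - 1" | "i = - 2" | "i \<noteq> 0" "i \<noteq> - 1" "i \<noteq> - 2" by blast
    then show ?thesis
    proof cases
      case 1
      then show ?thesis using WD(6)[OF mod_homD(1)[OF q], of x] x by (simp add: replace_zeroth_def)
    next
      case 2
      then show ?thesis using mod_hom_zero[OF LM WD(2) dq] by (simp add: replace_zeroth_def)
    next
      case 3
      then show ?thesis by (simp add: replace_zeroth_def)
    next
      case 4
      then have "i + 1 \<noteq> 0" "i + 1 \<noteq> - 1" "i + 2 \<noteq> 0 " by arith+
      then show ?thesis using WD(6)[of x i] x 4
        by (auto simp: replace_zeroth_def)
    qed
  qed
  ultimately show ?thesis
    using WD(1,4) L n unfolding cpx_proj_def by (auto simp: replace_zeroth_def)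
qed

locale irreducible_into =
  fixes A :: "('a, 'r) ring_scheme" and n :: int and X W :: "('a, 'm) cpx" and f :: "int \<Rightarrow> 'm \<Rightarrow> 'm"
  assumes universe: "universe_for TYPE('m) A" and n: "n \<ge> 0"
    and X: "X \<in> cpx_proj A 1 n" and W: "W \<in> cpx_proj A 0 n"
    and irr: "cpx_irreducible A 0 n X W f"
begin

lemmas X_D = cpx_projD[OF X] and W_D = cpx_projD[OF W]

lemma f: "f \<in> cpx_hom A X W"
  using irr unfolding cpx_irreducible_def by blast

lemma X_nonpos: "i \<le> 0 \<Longrightarrow> x \<in> carrier (Obj X i) \<Longrightarrow> x = \<zero>\<^bsub>Obj X i\<^esub>"
  using zero_modD[OF X_D(4)] by force

lemma X_hom_zero:
  "\<lbrakk>i \<le> 0; x \<in> carrier (Obj X i); left_module A M; h \<in> mod_hom A (Obj X i) M\<rbrakk> \<Longrightarrow> h x = \<zero>\<^bsub>M\<^esub>"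
  using X_nonpos mod_hom_zero[OF X_D(2)] by blast

text \<open>A chain map from the truncation of \<open>W\<close> to \<open>X\<close>. Degree 0 is
  left out on purpose: since \<open>X^0 = 0\<close>, compatibility there would mean that
  \<open>r^1 d^0\<close> vanishes, and this composite is the quantity to be studied.\<close>

definition partial_hom :: "(int \<Rightarrow> 'm \<Rightarrow> 'm) \<Rightarrow> bool" where
  "partial_hom r \<longleftrightarrow> (\<forall>i\<ge>1. r i \<in> mod_hom A (Obj W i) (Obj X i))
     \<and> (\<forall>i\<ge>1. \<forall>x\<in>carrier (Obj W i). r (i + 1) (Diff W i x) = Diff X i (r i x))"

definition partial_retraction :: "(int \<Rightarrow> 'm \<Rightarrow> 'm) \<Rightarrow> bool" where
  "partial_retraction r \<longleftrightarrow> partial_hom r \<and> (\<forall>i\<ge>1. \<forall>x\<in>carrier (Obj X i). r i (f i x) = x)"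

lemma partial_homD:
  assumes "partial_hom r" "i \<ge> 1"
  shows "r i \<in> mod_hom A (Obj W i) (Obj X i)"
    "x \<in> carrier (Obj W i) \<Longrightarrow> r (i + 1) (Diff W i x) = Diff X i (r i x)"
  using assms unfolding partial_hom_def by blast+

lemma partial_hom_comp_d0:
  assumes "partial_hom r"
  shows "(\<lambda>x. r 1 (Diff W 0 x)) \<in> mod_hom A (Obj W 0) (Obj X 1)"
  using mod_hom_comp[OF W_D(5)[of 0], of "r 1" "Obj X 1"] partial_homD(1)[OF assms, of 1] by simp

lemma partial_hom_comp_d0_kernel:
  assumes r: "partial_hom r" and x: "x \<in> carrier (Obj W 0)"
  shows "r 1 (Diff W 0 x) \<in> mod_kernel (Obj X 1) (Obj X 2) (Diff X 1)"
proof -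
  have d: "Diff W 0 x \<in> carrier (Obj W 1)" using mod_homD(1)[OF W_D(5) x] by simp
  have "Diff X 1 (r 1 (Diff W 0 x)) = r 2 (Diff W 1 (Diff W 0 x))"
    using partial_homD(2)[OF r _ d] by simp
  also have "\<dots> = \<zero>\<^bsub>Obj X 2\<^esub>"
    using W_D(6)[OF x] mod_hom_zero[OF W_D(2) X_D(2) partial_homD(1)[OF r, of 2]] by simp
  finally show ?thesis using mod_homD(1)[OF partial_hom_comp_d0[OF r] x] by (simp add: mod_kernel_def)
qed

lemma partial_hom_minus:
  assumes r: "partial_hom r" and s: "partial_hom s"
  shows "partial_hom (\<lambda>i x. r i x \<ominus>\<^bsub>Obj X i\<^esub> s i x)"
  unfolding partial_hom_def
proof (intro conjI allI impI ballI)
  fix i :: int assume i: "i \<ge> 1"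
  show "(\<lambda>x. r i x \<ominus>\<^bsub>Obj X i\<^esub> s i x) \<in> mod_hom A (Obj W i) (Obj X i)"
    by (rule mod_hom_minus_map[OF X_D(2) partial_homD(1)[OF r i] partial_homD(1)[OF s i]])
  fix x assume x: "x \<in> carrier (Obj W i)"
  show "r (i + 1) (Diff W i x) \<ominus>\<^bsub>Obj X (i + 1)\<^esub> s (i + 1) (Diff W i x) = Diff X i (r i x \<ominus>\<^bsub>Obj X i\<^esub> s i x)"
    unfolding partial_homD(2)[OF r i x] partial_homD(2)[OF s i x]
    by (rule mod_hom_minus[OF X_D(2) X_D(2) X_D(5) mod_homD(1)[OF partial_homD(1)[OF r i] x]
          mod_homD(1)[OF partial_homD(1)[OF s i] x], symmetric])
qed

text \<open>If \<open>r^1 d^0\<close> vanished, extending \<open>r\<close> by zero to degrees at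
  most 0 would give a chain map splitting \<open>f\<close>, but an irreducible \<open>f\<close> is
  not a section.\<close>

lemma partial_retraction_nonzero:
  assumes "partial_retraction r"
  shows "\<exists>x\<in>carrier (Obj W 0). r 1 (Diff W 0 x) \<noteq> \<zero>\<^bsub>Obj X 1\<^esub>"
proof (rule ccontr)
  assume "\<not> ?thesis"
  then have z: "\<And>x. x \<in> carrier (Obj W 0) \<Longrightarrow> r 1 (Diff W 0 x) = \<zero>\<^bsub>Obj X 1\<^esub>" by blast
  have r: "partial_hom r" "\<And>i x. i \<ge> 1 \<Longrightarrow> x \<in> carrier (Obj X i) \<Longrightarrow> r i (f i x) = x"
    using assms unfolding partial_retraction_def by blast+
  define s where "s i = (if i \<ge> 1 then r i else (\<lambda>_. \<zero>\<^bsub>Obj X i\<^esub>))" for i :: int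
  have d_zero: "Diff X i \<zero>\<^bsub>Obj X i\<^esub> = \<zero>\<^bsub>Obj X (i + 1)\<^esub>" for i
    by (rule mod_hom_zero[OF X_D(2) X_D(2) X_D(5)])
  have "s \<in> cpx_hom A W X"
    unfolding cpx_hom_def
  proof (intro CollectI conjI allI ballI)
    fix i
    show "s i \<in> mod_hom A (Obj W i) (Obj X i)"
      by (auto simp: s_def intro: partial_homD(1)[OF r(1)] mod_hom_zero_map[OF X_D(2)])
    fix x assume x: "x \<in> carrier (Obj W i)"
    consider "i \<ge> 1" | "i = 0" | "i < 0" by linarith
    then show "s (i + 1) (Diff W i x) = Diff X i (s i x)"
    proof cases
      case 1
      then show ?thesis using partial_homD(2)[OF r(1) _ x] by (simp add: s_def)
    next
      case 2
      then show ?thesis using z x d_zero[of 0] by (simp add: s_def)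
    next
      case 3
      then show ?thesis using d_zero by (simp add: s_def)
    qed
  qed
  moreover have "cpx_eq X (cpx_comp s f) (\<lambda>_. id)"
    unfolding cpx_eq_def cpx_comp_def using r(2) X_nonpos by (auto simp: s_def)
  ultimately have "cpx_section A X W f" unfolding cpx_section_def using f by blast
  then show False using irr unfolding cpx_irreducible_def by blast
qed

text \<open>
  Replacing \<open>W\<^sup>0\<close> by a projective module with image \<open>M\<close> gives a factorization of \<open>f\<close> whose
  second factor is no retraction, so the first factor is a section.
\<close>

lemma partial_retraction_killing:
  assumes M: "submodule M A (Obj W 0)" "M \<noteq> carrier (Obj W 0)" "fin_gen A ((Obj W 0)\<lparr>carrier := M\<rparr>)"
  shows "\<exists>r. partial_retraction r \<and> (\<forall>x\<in>M. r 1 (Diff W 0 x) = \<zero>\<^bsub>Obj X 1\<^esub>)"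
proof -
  interpret W0: left_module A "Obj W 0" by (rule W_D(2))
  obtain L :: "('a, 'm) module" and q where L: "L \<in> proj A" "q \<in> mod_hom A L ((Obj W 0)\<lparr>carrier := M\<rparr>)"
    "q ` carrier L = M"
    using projective_presentation[OF universe W0.submodule_left_module[OF M(1)] M(3)] by auto
  have LM: "left_module A L" using L(1) by (simp add: proj_def projective_def)
  have q: "q \<in> mod_hom A L (Obj W 0)" by (rule mod_hom_expand_target[OF L(2) W0.submoduleD(1)[OF M(1)]])
  let ?V = "replace_zeroth W L q"
  have V: "?V \<in> cpx_proj A 0 n" by (rule replace_zeroth_cpx_proj[OF W n L(1) q])
  \<comment> \<open>Since \<open>X^0 = 0\<close>, the map \<open>f\<close> is zero in degree 0 and
    factors there through \<open>L\<close>; in all other degrees it is factored as itself followed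
    by the identity.\<close>
  define g where "g i = (if i = 0 then (\<lambda>_. \<zero>\<^bsub>L\<^esub>) else f i)" for i :: int
  define h where "h i = (if i = 0 then q else (\<lambda>x. x))" for i :: int
  have q0: "q \<zero>\<^bsub>L\<^esub> = \<zero>\<^bsub>Obj W 0\<^esub>" by (rule mod_hom_zero[OF LM W_D(2) q])
  have d0: "Diff W 0 \<zero>\<^bsub>Obj W 0\<^esub> = \<zero>\<^bsub>Obj W 1\<^esub>" using mod_hom_zero[OF W_D(2) W_D(2) W_D(5)[of 0]] by simp
  have W_neg: "x = \<zero>\<^bsub>Obj W (- 1)\<^esub>" if "x \<in> carrier (Obj W (- 1))" for x
    using zero_modD[OF W_D(4) that] by simp
  have g: "g \<in> cpx_hom A X ?V"
    unfolding cpx_hom_def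
  proof (intro CollectI conjI allI ballI)
    fix i
    show "g i \<in> mod_hom A (Obj X i) (Obj ?V i)"
      using cpx_homD(1)[OF f, of i] by (auto simp: g_def replace_zeroth_def intro: mod_hom_zero_map[OF LM])
    fix x assume x: "x \<in> carrier (Obj X i)"
    consider "i = 0" | "i = - 1" | "i \<noteq> 0" "i \<noteq> - 1" by blast
    then show "g (i + 1) (Diff X i x) = Diff ?V i (g i x)"
    proof cases
      case 1
      have "f 1 (Diff X 0 x) = \<zero>\<^bsub>Obj W 1\<^esub>"
        using X_hom_zero[of 0 x "Obj W 1" "\<lambda>x. f 1 (Diff X 0 x)"] x 1 W_D(2)
          mod_hom_comp[OF X_D(5)[of 0], of "f 1" "Obj W 1"] cpx_homD(1)[OF f, of 1] by simp
      then show ?thesis using 1 q0 d0 by (simp add: g_def replace_zeroth_def)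
    next
      case 2
      then show ?thesis by (simp add: g_def replace_zeroth_def)
    next
      case 3
      then show ?thesis using cpx_homD(2)[OF f x] by (auto simp: g_def replace_zeroth_def)
    qed
  qed
  have h: "h \<in> cpx_hom A ?V W"
    unfolding cpx_hom_def
  proof (intro CollectI conjI allI ballI)
    fix i
    show "h i \<in> mod_hom A (Obj ?V i) (Obj W i)"
      using q by (auto simp: h_def replace_zeroth_def intro: mod_hom_id)
    fix x assume x: "x \<in> carrier (Obj ?V i)"
    consider "i = 0" | "i = - 1" | "i \<noteq> 0" "i \<noteq> - 1" by blast
    then show "h (i + 1) (Diff ?V i x) = Diff W i (h i x)"
    proof cases
      case 2
      then have "x = \<zero>\<^bsub>Obj W (- 1)\<^esub>" using W_neg x by (simp add: replace_zeroth_def)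
      then have "Diff W (- 1) x = \<zero>\<^bsub>Obj W 0\<^esub>" using mod_hom_zero[OF W_D(2) W_D(2) W_D(5)[of "- 1"]] by simp
      then show ?thesis using 2 q0 by (simp add: h_def replace_zeroth_def)
    qed (auto simp: h_def replace_zeroth_def)
  qed
  have fac: "cpx_eq X f (cpx_comp h g)"
    unfolding cpx_eq_def cpx_comp_def
  proof (intro allI ballI)
    fix i x assume x: "x \<in> carrier (Obj X i)"
    show "f i x = (h i \<circ> g i) x"
    proof (cases "i = 0")
      case True
      then show ?thesis using X_hom_zero[OF _ x W_D(2) cpx_homD(1)[OF f]] q0 by (simp add: h_def g_def)
    qed (simp add: h_def g_def)
  qed
  have "\<not> cpx_retraction A ?V W h"
  proof
    assume "cpx_retraction A ?V W h"
    then obtain s where s: "s \<in> cpx_hom A W ?V" "cpx_eq W (cpx_comp h s) (\<lambda>_. id)"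
      unfolding cpx_retraction_def by blast
    \<comment> \<open>A right inverse of \<open>h\<close> would make \<open>q\<close> onto in degree
      0, although its image is the proper submodule \<open>M\<close>.\<close>
    have "carrier (Obj W 0) \<subseteq> M"
    proof
      fix x assume x: "x \<in> carrier (Obj W 0)"
      have "s 0 x \<in> carrier L" using mod_homD(1)[OF cpx_homD(1)[OF s(1)] x] by (simp add: replace_zeroth_def)
      moreover have "q (s 0 x) = x" using s(2) x unfolding cpx_eq_def cpx_comp_def h_def by (auto dest: spec[of _ 0])
      ultimately show "x \<in> M" using L(3) by force
    qed
    then show False using M(2) W0.submoduleD(1)[OF M(1)] by blast
  qed
  then have "cpx_section A X ?V g" using irr V g h fac unfolding cpx_irreducible_def by blast
  then obtain r where r: "r \<in> cpx_hom A ?V X" "cpx_eq X (cpx_comp r g) (\<lambda>_. id)"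
    unfolding cpx_section_def by blast
  have "partial_hom r"
    unfolding partial_hom_def
  proof (intro conjI allI impI ballI)
    fix i :: int assume i: "i \<ge> 1"
    show "r i \<in> mod_hom A (Obj W i) (Obj X i)"
      using cpx_homD(1)[OF r(1), of i] i by (simp add: replace_zeroth_def)
    fix x assume "x \<in> carrier (Obj W i)"
    then show "r (i + 1) (Diff W i x) = Diff X i (r i x)"
      using cpx_homD(2)[OF r(1), of x i] i by (simp add: replace_zeroth_def)
  qed
  moreover have "r i (f i x) = x" if "i \<ge> 1" "x \<in> carrier (Obj X i)" for i x
  proof -
    have "(cpx_comp r g) i x = id x" using r(2) that(2) unfolding cpx_eq_def by blast
    then show ?thesis using that(1) by (simp add: cpx_comp_def g_def)
  qed
  moreover have "r 1 (Diff W 0 x) = \<zero>\<^bsub>Obj X 1\<^esub>" if x: "x \<in> M" for x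
  proof -
    obtain y where y: "y \<in> carrier L" "x = q y" using L(3) x by blast
    \<comment> \<open>Here \<open>r\<close> is a chain map on the modified complex, so on the image
      of \<open>q\<close> the composite passes through \<open>X^0\<close>, which is zero.\<close>
    have "r 1 (Diff W 0 x) = Diff X 0 (r 0 y)"
      using cpx_homD(2)[OF r(1), of y 0] y by (simp add: replace_zeroth_def)
    moreover have "r 0 y \<in> carrier (Obj X 0)"
      using mod_homD(1)[OF cpx_homD(1)[OF r(1), of 0], of y] y(1) by (simp add: replace_zeroth_def)
    ultimately show ?thesis using X_hom_zero[OF _ _ X_D(2) X_D(5)[of 0]] by simp
  qed
  ultimately show ?thesis unfolding partial_retraction_def by blast
qed

end

section \<open>The socle of the kernel and the coset of maps into it\<close>

lemma semisimple_soc: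
  assumes M: "left_module A M" and S: "S = soc A M"
  shows "submodule S A M" "left_module.semisimple A (M\<lparr>carrier := S\<rparr>)"
proof -
  interpret M: left_module A M by fact
  have car: "\<Union>{S. simple_submodule A M S} \<subseteq> carrier M"
    using M.simple_submoduleD(1) M.submoduleD(1) by blast
  show sS: "submodule S A M" unfolding S soc_def by (rule M.submodule_mod_span[OF car])
  interpret MS: left_module A "M\<lparr>carrier := S\<rparr>" by (rule M.submodule_left_module[OF sS])
  note iff = M.submodule_restrict_iff[OF sS]
  show MS.semisimple
    unfolding MS.semisimple_def
  proof (intro allI impI)
    fix H assume H: "submodule H A (M\<lparr>carrier := S\<rparr>)
      \<and> (\<forall>T. simple_submodule A (M\<lparr>carrier := S\<rparr>) T \<longrightarrow> T \<subseteq> H)"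
    then have h: "submodule H A M" "H \<subseteq> S" using iff by simp_all
    have "\<Union>{S. simple_submodule A M S} \<subseteq> H"
    proof (rule Union_least)
      fix T assume "T \<in> {S. simple_submodule A M S}"
      then have T: "simple_submodule A M T" by simp
      have "T \<subseteq> S" unfolding S soc_def
        by (rule subset_trans[OF Union_upper M.mod_span_subset]) (simp add: T)
      \<comment> \<open>A simple submodule of \<open>M\<close> lies in the socle and remains simple
        there, so a submodule of the socle containing all simple ones contains its
        generators.\<close>
      then have "simple_submodule A (M\<lparr>carrier := S\<rparr>) T"
        using T unfolding simple_submodule_def iff by simp
      then show "T \<subseteq> H" using H by blast
    qed
    then have "S \<subseteq> H" unfolding S soc_def by (rule M.mod_span_least[OF h(1)])
    then show "H = carrier (M\<lparr>carrier := S\<rparr>)" using h(2) by simp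
  qed
qed

text \<open>The preimage of a submodule of the image contains \<open>M\<close>, so by maximality it
  is \<open>M\<close> or everything.\<close>

lemma simple_image_of_maximal:
  assumes Q: "left_module A Q" and N: "left_module A N" and a: "a \<in> mod_hom A Q N"
    and M: "maximal_submodule A Q M" "\<And>x. x \<in> M \<Longrightarrow> a x = \<zero>\<^bsub>N\<^esub>"
    and nz: "x \<in> carrier Q" "a x \<noteq> \<zero>\<^bsub>N\<^esub>"
  shows "simple_submodule A N (a ` carrier Q)"
proof -
  interpret Q: left_module A Q by fact
  interpret N: left_module A N by fact
  show ?thesis
    unfolding simple_submodule_def
  proof (intro conjI allI impI)
    show "submodule (a ` carrier Q) A N" by (rule submodule_image[OF Q N a Q.submodule_carrier])
    show "a ` carrier Q \<noteq> {\<zero>\<^bsub>N\<^esub>}" using nz by blast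
    fix H assume H: "submodule H A N \<and> H \<subseteq> a ` carrier Q"
    let ?L = "{x \<in> carrier Q. a x \<in> H}"
    have L: "submodule ?L A Q" using submodule_vimage[OF Q N a] H by blast
    have mM: "submodule M A Q" using M(1) unfolding maximal_submodule_def by blast
    have incl: "M \<subseteq> ?L" using Q.submoduleD(1)[OF mM] M(2) N.submoduleD(2)[OF conjunct1[OF H]] by auto
    have aL: "a ` ?L = H" using H by blast
    from M(1) L incl have "?L = M \<or> ?L = carrier Q" unfolding maximal_submodule_def by blast
    then show "H = {\<zero>\<^bsub>N\<^esub>} \<or> H = a ` carrier Q"
    proof
      assume "?L = M"
      then have "H \<subseteq> {\<zero>\<^bsub>N\<^esub>}" using aL M(2) by auto
      then show ?thesis using N.submoduleD(2)[OF conjunct1[OF H]] by blast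
    next
      assume "?L = carrier Q"
      then show ?thesis using aL by simp
    qed
  qed
qed

locale irreducible_into_artin = artin_alg K A \<phi> + irreducible_into A n X W f
  for K :: "('k, 's) ring_scheme" and A :: "('a, 'r) ring_scheme" and \<phi> :: "'k \<Rightarrow> 'a"
    and n :: int and X W :: "('a, 'm) cpx" and f :: "int \<Rightarrow> 'm \<Rightarrow> 'm" +
  assumes W0_nonzero: "\<not> zero_mod (Obj W 0)"
begin

definition S :: "'m set" where
  "S = soc A ((Obj X 1)\<lparr>carrier := mod_kernel (Obj X 1) (Obj X 2) (Diff X 1)\<rparr>)"

abbreviation "Soc \<equiv> (Obj X 1)\<lparr>carrier := S\<rparr>"
abbreviation "Hom \<equiv> hom_mod A \<phi> (Obj W 0) Soc"

sublocale X1: left_module A "Obj X 1"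
  by (rule X_D(2))

sublocale W0: left_module A "Obj W 0"
  by (rule W_D(2))

lemma kernel_sub: "submodule (mod_kernel (Obj X 1) (Obj X 2) (Diff X 1)) A (Obj X 1)"
  using submodule_kernel[OF X_D(2) X_D(2) X_D(5)[of 1]] by simp

lemma S_sub: "submodule S A (Obj X 1)"
  and S_semisimple: "left_module.semisimple A Soc"
  and S_upper: "simple_submodule A ((Obj X 1)\<lparr>carrier := mod_kernel (Obj X 1) (Obj X 2) (Diff X 1)\<rparr>) T \<Longrightarrow> T \<subseteq> S"
proof -
  let ?k = "mod_kernel (Obj X 1) (Obj X 2) (Diff X 1)"
  interpret k: left_module A "(Obj X 1)\<lparr>carrier := ?k\<rparr>" by (rule X1.submodule_left_module[OF kernel_sub])
  note s = semisimple_soc[OF k.left_module_axioms S_def]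
  show "submodule S A (Obj X 1)" using s(1) X1.submodule_restrict_iff[OF kernel_sub] by blast
  show "left_module.semisimple A Soc" using s(2) by simp
  show "simple_submodule A ((Obj X 1)\<lparr>carrier := ?k\<rparr>) T \<Longrightarrow> T \<subseteq> S"
    unfolding S_def soc_def by (rule subset_trans[OF Union_upper k.mod_span_subset]) simp
qed

lemma Soc_mod: "left_module A Soc"
  by (rule X1.submodule_left_module[OF S_sub])

text \<open>The obstruction to extending \<open>r\<close> by zero to a chain map on all of
  \<open>W\<close>.\<close>

definition along :: "(int \<Rightarrow> 'm \<Rightarrow> 'm) \<Rightarrow> 'm \<Rightarrow> 'm" where
  "along r = (\<lambda>x\<in>carrier (Obj W 0). r 1 (Diff W 0 x))"

lemma along_closed:
  assumes "partial_hom r" "\<And>x. x \<in> carrier (Obj W 0) \<Longrightarrow> r 1 (Diff W 0 x) \<in> S"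
  shows "along r \<in> carrier Hom"
  unfolding along_def
  by (rule restrict_mod_hom[OF W_D(2) mod_hom_restrict_target[OF partial_hom_comp_d0[OF assms(1)]]])
    (use assms(2) in auto)

text \<open>The image of \<open>r\<^sup>1 d\<^sup>0\<close> is a quotient of \<open>W\<^sup>0/M\<close>, hence simple and contained in the socle.\<close>

lemma maximal_retraction:
  assumes M: "maximal_submodule A (Obj W 0) M"
  shows "\<exists>r. partial_retraction r \<and> along r \<in> carrier Hom \<and> (\<forall>x\<in>M. r 1 (Diff W 0 x) = \<zero>\<^bsub>Obj X 1\<^esub>)"
proof -
  have mM: "submodule M A (Obj W 0)" "M \<noteq> carrier (Obj W 0)" using M unfolding maximal_submodule_def by blast+
  obtain r where r: "partial_retraction r" "\<forall>x\<in>M. r 1 (Diff W 0 x) = \<zero>\<^bsub>Obj X 1\<^esub>"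
    using partial_retraction_killing[OF mM fin_gen_submodule[OF W_D(2,3) mM(1)]] by (elim exE conjE)
  have ph: "partial_hom r" using r(1) by (simp add: partial_retraction_def)
  let ?k = "mod_kernel (Obj X 1) (Obj X 2) (Diff X 1)" and ?a = "\<lambda>x. r 1 (Diff W 0 x)"
  have a: "?a \<in> mod_hom A (Obj W 0) ((Obj X 1)\<lparr>carrier := ?k\<rparr>)"
    by (rule mod_hom_restrict_target[OF partial_hom_comp_d0[OF ph]]) (use partial_hom_comp_d0_kernel[OF ph] in auto)
  obtain x where x: "x \<in> carrier (Obj W 0)" "?a x \<noteq> \<zero>\<^bsub>Obj X 1\<^esub>" using partial_retraction_nonzero[OF r(1)] by (elim bexE)
  have "simple_submodule A ((Obj X 1)\<lparr>carrier := ?k\<rparr>) (?a ` carrier (Obj W 0))"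
    by (rule simple_image_of_maximal[OF W_D(2) X1.submodule_left_module[OF kernel_sub] a M _ x(1)])
      (use r(2) x(2) in simp_all)
  then have "?a ` carrier (Obj W 0) \<subseteq> S" by (rule S_upper)
  then have "along r \<in> carrier Hom" by (intro along_closed[OF ph]) auto
  then show ?thesis using r by blast
qed

text \<open>The direction of the coset: differences of two partial retractions vanish on the image
  of \<open>f\<close>.\<close>

definition A\<^sub>0 :: "('m \<Rightarrow> 'm) set" where
  "A\<^sub>0 = {along d | d. partial_hom d \<and> (\<forall>i\<ge>1. \<forall>x\<in>carrier (Obj X i). d i (f i x) = \<zero>\<^bsub>Obj X i\<^esub>)
     \<and> along d \<in> carrier Hom}"

lemma A\<^sub>0I:
  "\<lbrakk>partial_hom d; \<And>i x. i \<ge> 1 \<Longrightarrow> x \<in> carrier (Obj X i) \<Longrightarrow> d i (f i x) = \<zero>\<^bsub>Obj X i\<^esub>;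
    along d \<in> carrier Hom\<rbrakk> \<Longrightarrow> along d \<in> A\<^sub>0"
  unfolding A\<^sub>0_def by (intro CollectI exI[of _ d]) simp

lemma A\<^sub>0E:
  assumes "h \<in> A\<^sub>0"
  obtains d where "h = along d" "partial_hom d"
    "\<forall>i\<ge>1. \<forall>x\<in>carrier (Obj X i). d i (f i x) = \<zero>\<^bsub>Obj X i\<^esub>" "along d \<in> carrier Hom"
  using assms unfolding A\<^sub>0_def by (elim CollectE exE conjE)

lemma A\<^sub>0_sub: "submodule A\<^sub>0 K Hom"
proof -
  interpret H: left_module K Hom by (rule left_module_hom_mod[OF W_D(2) Soc_mod])
  have Xi: "left_module A (Obj X i)" for i by (rule X_D(2))
  show ?thesis
  proof (rule H.submoduleI)
    show "A\<^sub>0 \<subseteq> carrier Hom" unfolding A\<^sub>0_def by blast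
    have z: "along (\<lambda>i _. \<zero>\<^bsub>Obj X i\<^esub>) = \<zero>\<^bsub>Hom\<^esub>" by (simp add: along_def hom_mod_simps)
    have "along (\<lambda>i _. \<zero>\<^bsub>Obj X i\<^esub>) \<in> A\<^sub>0"
    proof (rule A\<^sub>0I)
      show "partial_hom (\<lambda>i _. \<zero>\<^bsub>Obj X i\<^esub>)"
        unfolding partial_hom_def
        by (auto intro: mod_hom_zero_map[OF Xi] simp: mod_hom_zero[OF Xi Xi X_D(5)])
    qed (simp_all add: z)
    then show "\<zero>\<^bsub>Hom\<^esub> \<in> A\<^sub>0" unfolding z .
  next
    fix g h assume "g \<in> A\<^sub>0" "h \<in> A\<^sub>0"
    obtain d where d: "g = along d" "partial_hom d"
        "\<forall>i\<ge>1. \<forall>x\<in>carrier (Obj X i). d i (f i x) = \<zero>\<^bsub>Obj X i\<^esub>" "along d \<in> carrier Hom"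
      by (rule A\<^sub>0E[OF \<open>g \<in> A\<^sub>0\<close>])
    obtain e where e: "h = along e" "partial_hom e"
        "\<forall>i\<ge>1. \<forall>x\<in>carrier (Obj X i). e i (f i x) = \<zero>\<^bsub>Obj X i\<^esub>" "along e \<in> carrier Hom"
      by (rule A\<^sub>0E[OF \<open>h \<in> A\<^sub>0\<close>])
    let ?s = "\<lambda>i x. d i x \<oplus>\<^bsub>Obj X i\<^esub> e i x"
    have eq: "along ?s = g \<oplus>\<^bsub>Hom\<^esub> h"
      unfolding d(1) e(1) along_def hom_mod_simps by (rule restrict_ext) simp
    have "along ?s \<in> A\<^sub>0"
    proof (rule A\<^sub>0I)
      show "partial_hom ?s"
        unfolding partial_hom_def
      proof (intro conjI allI impI ballI)
        fix i :: int assume i: "i \<ge> 1"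
        show "?s i \<in> mod_hom A (Obj W i) (Obj X i)"
          by (rule mod_hom_add[OF Xi partial_homD(1)[OF d(2) i] partial_homD(1)[OF e(2) i]])
        fix x assume x: "x \<in> carrier (Obj W i)"
        show "?s (i + 1) (Diff W i x) = Diff X i (?s i x)"
          unfolding partial_homD(2)[OF d(2) i x] partial_homD(2)[OF e(2) i x]
          by (rule mod_homD(2)[OF X_D(5) mod_homD(1)[OF partial_homD(1)[OF d(2) i] x]
                mod_homD(1)[OF partial_homD(1)[OF e(2) i] x], symmetric])
      qed
      fix i x assume i: "i \<ge> (1::int)" and x: "x \<in> carrier (Obj X i)"
      interpret Xi: left_module A "Obj X i" by (rule Xi)
      show "?s i (f i x) = \<zero>\<^bsub>Obj X i\<^esub>" using d(3)[rule_format, OF i x] e(3)[rule_format, OF i x] by simp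
    next
      show "along ?s \<in> carrier Hom" unfolding eq using d(1,4) e(1,4) by (intro H.M.a_closed) simp_all
    qed
    then show "g \<oplus>\<^bsub>Hom\<^esub> h \<in> A\<^sub>0" unfolding eq .
  next
    fix c h assume c: "c \<in> carrier K" and "h \<in> A\<^sub>0"
    from \<open>h \<in> A\<^sub>0\<close> obtain d where d: "h = along d" "partial_hom d"
        "\<forall>i\<ge>1. \<forall>x\<in>carrier (Obj X i). d i (f i x) = \<zero>\<^bsub>Obj X i\<^esub>" "along d \<in> carrier Hom"
      by (rule A\<^sub>0E)
    let ?s = "\<lambda>i x. \<phi> c \<odot>\<^bsub>Obj X i\<^esub> d i x"
    have eq: "along ?s = c \<odot>\<^bsub>Hom\<^esub> h"
      unfolding d(1) along_def hom_mod_simps by (rule restrict_ext) simp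
    have "along ?s \<in> A\<^sub>0"
    proof (rule A\<^sub>0I)
      show "partial_hom ?s"
        unfolding partial_hom_def
      proof (intro conjI allI impI ballI)
        fix i :: int assume i: "i \<ge> 1"
        show "?s i \<in> mod_hom A (Obj W i) (Obj X i)"
          by (rule mod_hom_comp[OF partial_homD(1)[OF d(2) i] \<phi>_smult_hom[OF Xi c]])
        fix x assume x: "x \<in> carrier (Obj W i)"
        show "?s (i + 1) (Diff W i x) = Diff X i (?s i x)"
          unfolding partial_homD(2)[OF d(2) i x]
          by (rule mod_homD(3)[OF X_D(5) \<phi>_closed[OF c] mod_homD(1)[OF partial_homD(1)[OF d(2) i] x], symmetric])
      qed
      fix i x assume i: "i \<ge> (1::int)" and x: "x \<in> carrier (Obj X i)"
      interpret Xi: left_module A "Obj X i" by (rule Xi)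
      show "?s i (f i x) = \<zero>\<^bsub>Obj X i\<^esub>" using d(3)[rule_format, OF i x] c by simp
    next
      show "along ?s \<in> carrier Hom" unfolding eq using d(1,4) c by (intro H.smult_closed) simp_all
    qed
    then show "c \<odot>\<^bsub>Hom\<^esub> h \<in> A\<^sub>0" unfolding eq .
  qed
qed

text \<open>Subtracting such a \<open>d\<close> from \<open>r\<close> would leave a partial
  retraction whose composite with \<open>d^0\<close> vanishes, which would make \<open>f\<close> a
  section. So the coset does not contain zero.\<close>

lemma along_retraction_not_in_A\<^sub>0:
  assumes r: "partial_retraction r" "along r \<in> carrier Hom"
  shows "along r \<notin> A\<^sub>0"
proof
  assume "along r \<in> A\<^sub>0"
  then obtain d where d: "along r = along d" "partial_hom d"
    "\<forall>i\<ge>1. \<forall>x\<in>carrier (Obj X i). d i (f i x) = \<zero>\<^bsub>Obj X i\<^esub>"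
    "along d \<in> carrier Hom" by (rule A\<^sub>0E)
  have ph: "partial_hom r" using r(1) unfolding partial_retraction_def by blast
  let ?s = "\<lambda>i x. r i x \<ominus>\<^bsub>Obj X i\<^esub> d i x"
  have "partial_retraction ?s"
    unfolding partial_retraction_def
  proof (intro conjI allI impI ballI partial_hom_minus[OF ph d(2)])
    fix i x assume i: "i \<ge> (1::int)" and x: "x \<in> carrier (Obj X i)"
    interpret Xi: left_module A "Obj X i" by (rule X_D(2))
    have "r i (f i x) = x" using r(1) i x unfolding partial_retraction_def by blast
    then show "?s i (f i x) = x" using d(3)[rule_format, OF i x] Xi.minus_zero_right[OF x] by simp
  qed
  then obtain x where x: "x \<in> carrier (Obj W 0)" "?s 1 (Diff W 0 x) \<noteq> \<zero>\<^bsub>Obj X 1\<^esub>"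
    using partial_retraction_nonzero by blast
  have "r 1 (Diff W 0 x) = d 1 (Diff W 0 x)" using fun_cong[OF d(1), of x] x(1) by (simp add: along_def)
  moreover have "d 1 (Diff W 0 x) \<in> carrier (Obj X 1)"
    using mod_homD(1)[OF partial_hom_comp_d0[OF d(2)] x(1)] .
  ultimately show False using x(2) X1.minus_self by simp
qed

lemma along_retraction_diff:
  assumes r: "partial_retraction r" "along r \<in> carrier Hom" and s: "partial_retraction s" "along s \<in> carrier Hom"
  shows "along r \<ominus>\<^bsub>Hom\<^esub> along s \<in> A\<^sub>0"
proof -
  interpret H: left_module K Hom by (rule left_module_hom_mod[OF W_D(2) Soc_mod])
  have ph: "partial_hom r" "partial_hom s" using r(1) s(1) unfolding partial_retraction_def by blast+
  let ?d = "\<lambda>i x. r i x \<ominus>\<^bsub>Obj X i\<^esub> s i x"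
  have eq: "along ?d = along r \<ominus>\<^bsub>Hom\<^esub> along s"
    unfolding hom_mod_minus[OF W_D(2) Soc_mod r(2) s(2)]
  proof (unfold along_def, rule restrict_ext)
    fix x assume x: "x \<in> carrier (Obj W 0)"
    have "s 1 (Diff W 0 x) \<in> S" using hom_modD(2)[OF s(2) x] x by (simp add: along_def)
    from X1.restrict_minus[OF S_sub this] x
    show "?d 1 (Diff W 0 x) = (\<lambda>x\<in>carrier (Obj W 0). r 1 (Diff W 0 x)) x
        \<ominus>\<^bsub>Soc\<^esub> (\<lambda>x\<in>carrier (Obj W 0). s 1 (Diff W 0 x)) x" by simp
  qed
  have "along ?d \<in> A\<^sub>0"
  proof (rule A\<^sub>0I[OF partial_hom_minus[OF ph]])
    fix i x assume i: "i \<ge> (1::int)" and x: "x \<in> carrier (Obj X i)"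
    interpret Xi: left_module A "Obj X i" by (rule X_D(2))
    have "r i (f i x) = x" "s i (f i x) = x" using r(1) s(1) i x unfolding partial_retraction_def by blast+
    then show "?d i (f i x) = \<zero>\<^bsub>Obj X i\<^esub>" using Xi.minus_self[OF x] by simp
  next
    show "along ?d \<in> carrier Hom" unfolding eq by (rule H.M.minus_closed[OF r(2) s(2)])
  qed
  then show ?thesis unfolding eq .
qed

lemma minimal_kernel:
  "\<exists>l\<in>mod_hom A (Obj W 0) Soc. \<forall>x\<in>carrier (Obj W 0). l x = \<zero>\<^bsub>Soc\<^esub>
     \<longrightarrow> (\<forall>\<nu>\<in>mod_hom A (Obj W 0) Soc. \<nu> x = \<zero>\<^bsub>Soc\<^esub>)"
proof -
  \<comment> \<open>A nonzero finitely generated \<open>W^0\<close> has a maximal submodule; the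
    retraction belonging to it becomes the base point of the coset.\<close>
  have "{\<zero>\<^bsub>Obj W 0\<^esub>} \<noteq> carrier (Obj W 0)" using W0_nonzero unfolding zero_mod_def by blast
  then obtain M\<^sub>0 where M\<^sub>0: "maximal_submodule A (Obj W 0) M\<^sub>0"
    using maximal_submodule_above[OF W_D(2) noetherian_fin_gen_module[OF W_D(2,3)] W0.submodule_zero] by blast
  then obtain r\<^sub>0 where r\<^sub>0: "partial_retraction r\<^sub>0" "along r\<^sub>0 \<in> carrier Hom" using maximal_retraction by blast
  show ?thesis
  proof (rule exists_hom_with_minimal_kernel[OF W_D(2) Soc_mod fin_gen_submodule[OF X_D(2,3) S_sub]
        S_semisimple A\<^sub>0_sub r\<^sub>0(2) along_retraction_not_in_A\<^sub>0[OF r\<^sub>0]])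
    fix M assume M: "maximal_submodule A (Obj W 0) M"
    then obtain r where r: "partial_retraction r" "along r \<in> carrier Hom"
      "\<forall>x\<in>M. r 1 (Diff W 0 x) = \<zero>\<^bsub>Obj X 1\<^esub>" using maximal_retraction by blast
    have "M \<subseteq> carrier (Obj W 0)" using M W0.submoduleD(1) unfolding maximal_submodule_def by blast
    then have "\<forall>x\<in>M. along r x = \<zero>\<^bsub>Soc\<^esub>" using r(3) by (auto simp: along_def)
    then show "\<exists>a\<in>carrier Hom. along r\<^sub>0 \<ominus>\<^bsub>Hom\<^esub> a \<in> A\<^sub>0 \<and> (\<forall>x\<in>M. a x = \<zero>\<^bsub>Soc\<^esub>)"
      using along_retraction_diff[OF r\<^sub>0 r(1,2)] r(2) by blast
  qed
qed

text \<open>Projecting the socle onto the image of \<open>l\<close> and lifting through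
  \<open>l\<close> gives \<open>b\<close> with \<open>l b = e p\<close>. If its image lay in a
  maximal \<open>M\<close>, take a retraction \<open>r\<close> whose composite kills
  \<open>M\<close>. Each \<open>y\<close> agrees with some \<open>b x\<close> up to the kernel of
  \<open>l\<close>, which every map into the socle kills, so \<open>along r\<close> would vanish at
  \<open>y\<close>, and hence everywhere.\<close>

theorem projective_onto_W0:
  fixes P :: "('a, 'm) module"
  assumes P: "projective A P" and p: "p \<in> mod_hom A P Soc" "p ` carrier P = carrier Soc"
  shows "\<exists>b\<in>mod_hom A P (Obj W 0). b ` carrier P = carrier (Obj W 0)"
proof -
  interpret V: left_module A Soc by (rule Soc_mod)
  have PM: "left_module A P" using P unfolding projective_def by simp
  interpret P: left_module A P by (rule PM)
  obtain l where l: "l \<in> mod_hom A (Obj W 0) Soc"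
    "\<And>x \<nu>. \<lbrakk>x \<in> carrier (Obj W 0); l x = \<zero>\<^bsub>Soc\<^esub>; \<nu> \<in> mod_hom A (Obj W 0) Soc\<rbrakk> \<Longrightarrow> \<nu> x = \<zero>\<^bsub>Soc\<^esub>"
    using minimal_kernel by blast
  let ?I = "l ` carrier (Obj W 0)"
  have I: "submodule ?I A Soc" by (rule submodule_image[OF W_D(2) Soc_mod l(1) W0.submodule_carrier])
  obtain e where e: "e \<in> mod_hom A Soc (Soc\<lparr>carrier := ?I\<rparr>)" "\<And>x. x \<in> ?I \<Longrightarrow> e x = x"
    by (rule V.semisimple_projection[OF S_semisimple I]) blast
  have l': "l \<in> mod_hom A (Obj W 0) (Soc\<lparr>carrier := ?I\<rparr>)" by (rule mod_hom_restrict_target[OF l(1)]) simp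
  have "\<exists>b\<in>mod_hom A P (Obj W 0). \<forall>x\<in>carrier P. l (b x) = e (p x)"
    by (rule projective_lift[OF P W_D(2) V.submodule_left_module[OF I] l' _ mod_hom_comp[OF p(1) e(1)]]) simp
  then obtain b where b: "b \<in> mod_hom A P (Obj W 0)" "\<And>x. x \<in> carrier P \<Longrightarrow> l (b x) = e (p x)" by blast
  have "b ` carrier P = carrier (Obj W 0)"
  proof (rule ccontr)
    assume ne: "b ` carrier P \<noteq> carrier (Obj W 0)"
    have "submodule (b ` carrier P) A (Obj W 0)" by (rule submodule_image[OF PM W_D(2) b(1) P.submodule_carrier])
    then obtain M where M: "maximal_submodule A (Obj W 0) M" "b ` carrier P \<subseteq> M"
      using maximal_submodule_above[OF W_D(2) noetherian_fin_gen_module[OF W_D(2,3)] _ ne] by blast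
    obtain r where r: "partial_retraction r" "along r \<in> carrier Hom"
      "\<forall>x\<in>M. r 1 (Diff W 0 x) = \<zero>\<^bsub>Obj X 1\<^esub>" using maximal_retraction[OF M(1)] by blast
    note \<nu> = hom_modD(1)[OF r(2)]
    obtain y where y: "y \<in> carrier (Obj W 0)" "r 1 (Diff W 0 y) \<noteq> \<zero>\<^bsub>Obj X 1\<^esub>"
      using partial_retraction_nonzero[OF r(1)] by blast
    have "l y \<in> p ` carrier P" unfolding p(2) by (rule mod_homD(1)[OF l(1) y(1)])
    then obtain x where x: "x \<in> carrier P" "p x = l y" by force
    have lb: "l (b x) = l y" using b(2)[OF x(1)] e(2) y(1) x(2) by simp
    have bx: "b x \<in> carrier (Obj W 0)" by (rule mod_homD(1)[OF b(1) x(1)])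
    have "l (y \<ominus>\<^bsub>Obj W 0\<^esub> b x) = \<zero>\<^bsub>Soc\<^esub>"
      using mod_hom_minus[OF W_D(2) Soc_mod l(1) y(1) bx] V.minus_self[OF mod_homD(1)[OF l(1) y(1)]] lb by simp
    then have "along r (y \<ominus>\<^bsub>Obj W 0\<^esub> b x) = \<zero>\<^bsub>Soc\<^esub>"
      using l(2)[OF _ _ \<nu>] W0.M.minus_closed[OF y(1) bx] by blast
    then have "along r y = along r (b x)"
      using mod_hom_minus[OF W_D(2) Soc_mod \<nu> y(1) bx]
        V.minus_eq_zero_iff[OF mod_homD(1)[OF \<nu> y(1)] mod_homD(1)[OF \<nu> bx]] by simp
    then show False using r(3) M(2) x(1) y bx by (auto simp: along_def)
  qed
  then show ?thesis using b(1) by blast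
qed

end

theorem theoremB:
  fixes K :: "('k, 's) ring_scheme" and A :: "('a, 'r) ring_scheme" and \<phi> :: "'k \<Rightarrow> 'a"
    and n :: int and X W Z :: "('a, 'm) cpx"
    and f :: "int \<Rightarrow> 'm \<Rightarrow> 'm" and a :: "'m \<Rightarrow> 'm"
  assumes "artin_algebra K A \<phi>"
    and "universe_for TYPE('m) A"
    and "n \<ge> 2"
    and "X \<in> cpx_proj A 1 n" and "cpx_indecomposable A 1 n X"
    and "left_enlargement A n X W"
    and "cpx_irreducible A 0 n X W f"
    and "Z \<in> cpx_proj A 0 n"
    and "a \<in> mod_hom A (Obj Z 0) (Obj X 1)"
    and "cpx_isomorphic A W (block_cpx X Z a)"
  defines "S \<equiv> soc A ((Obj X 1)\<lparr>carrier := mod_kernel (Obj X 1) (Obj X 2) (Diff X 1)\<rparr>)"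
  shows "\<forall>(P :: ('a, 'm) module) p.
    projective_cover A P p ((Obj X 1)\<lparr>carrier := S\<rparr>) \<longrightarrow> mod_summand A (Obj Z 0) P"
proof (intro allI impI)
  fix P :: "('a, 'm) module" and p
  assume cover: "projective_cover A P p ((Obj X 1)\<lparr>carrier := S\<rparr>)"
  have W: "W \<in> cpx_proj A 0 n" "\<not> zero_mod (Obj W 0)"
    using assms(6) unfolding left_enlargement_def by blast+
  interpret irr: irreducible_into_artin K A \<phi> n X W f
    by (intro irreducible_into_artin.intro artin_alg.intro irreducible_into.intro
        irreducible_into_artin_axioms.intro) (use assms W in auto)
  have S: "irr.S = S" unfolding irr.S_def S_def ..
  have "projective A P" "p \<in> mod_hom A P irr.Soc" "p ` carrier P = carrier irr.Soc"
    using cover unfolding projective_cover_def S by auto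
  from irr.projective_onto_W0[OF this] obtain b where
    b: "b \<in> mod_hom A P (Obj W 0)" "b ` carrier P = carrier (Obj W 0)" by blast
  obtain g h where g: "g \<in> cpx_hom A W (block_cpx X Z a)" and h: "h \<in> cpx_hom A (block_cpx X Z a) W"
    and gh: "cpx_eq (block_cpx X Z a) (cpx_comp g h) (\<lambda>_. id)"
    using assms(10) unfolding cpx_isomorphic_def by blast
  \<comment> \<open>In degree 0 the isomorphism identifies \<open>W^0\<close> with the sum of
    \<open>X^0\<close> and \<open>Z^0\<close>. Following it by the second projection maps
    \<open>W^0\<close> onto \<open>Z^0\<close>, so \<open>P\<close> maps onto \<open>Z^0\<close>,
    and this surjection splits by projectivity of \<open>Z^0\<close>.\<close>
  let ?B = "mod_sum (Obj X 0) (Obj Z 0)"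
  have g0: "g 0 \<in> mod_hom A (Obj W 0) ?B" and h0: "h 0 \<in> mod_hom A ?B (Obj W 0)"
    using cpx_homD(1)[OF g, of 0] cpx_homD(1)[OF h, of 0] by (simp_all add: block_cpx_def)
  have "snd \<in> mod_hom A ?B (Obj Z 0)"
    by (rule mod_homI) (auto simp: mod_sum_def)
  from mod_hom_comp[OF b(1) mod_hom_comp[OF g0 this]]
  have c: "(\<lambda>x. snd (g 0 (b x))) \<in> mod_hom A P (Obj Z 0)" .
  have "(\<lambda>x. snd (g 0 (b x))) ` carrier P = carrier (Obj Z 0)"
  proof
    show "(\<lambda>x. snd (g 0 (b x))) ` carrier P \<subseteq> carrier (Obj Z 0)" using mod_homD(1)[OF c] by auto
    show "carrier (Obj Z 0) \<subseteq> (\<lambda>x. snd (g 0 (b x))) ` carrier P"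
    proof
      fix z assume z: "z \<in> carrier (Obj Z 0)"
      interpret X0: left_module A "Obj X 0" by (rule cpx_projD(2)[OF assms(4)])
      let ?z = "(\<zero>\<^bsub>Obj X 0\<^esub>, z)"
      have zB: "?z \<in> carrier ?B" using z by (simp add: mod_sum_def)
      then have "h 0 ?z \<in> b ` carrier P" unfolding b(2) by (rule mod_homD(1)[OF h0])
      then obtain x where x: "x \<in> carrier P" "b x = h 0 ?z" by force
      have "(cpx_comp g h) 0 ?z = id ?z" using gh zB unfolding cpx_eq_def block_cpx_def by simp
      then have "z = snd (g 0 (b x))" using x(2) by (simp add: cpx_comp_def)
      then show "z \<in> (\<lambda>x. snd (g 0 (b x))) ` carrier P" using x(1) by (rule image_eqI)
    qed
  qed
  moreover have "projective A (Obj Z 0)" using cpx_projD(1)[OF assms(8)] by (simp add: proj_def)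
  moreover have "left_module A P" using cover unfolding projective_cover_def projective_def by blast
  ultimately show "mod_summand A (Obj Z 0) P" using projective_splits[OF _ _ c] by blast
qed

end
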